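(* Let $\bullet\in\{\sharp,\flat\}$ and $n\in\mathcal N$. Suppose that $\boldsymbol\kappa_n^\bullet(\mathbb 1)=0$ in $H^1(K,T/I_nT)$, where $\mathbb 1$ is the trivial character of $\Gamma$. Then for every $m\in\mathbb Z_{>0}$ and every character $\alpha:\Gamma\to\mathcal O^\times$ with $\alpha\equiv1\bmod\varpi^m$, we have $$\boldsymbol\kappa_n^\bullet(\alpha)\in\varpi^mH^1(K,T_\alpha/I_nT_\alpha).$$
   Context: **Setting.** $K$ is an imaginary quadratic field of discriminant $D_K$, $p\ge5$ a prime unramified in $K$, $f$ a weight-two newform of level $N_0$ with trivial nebentypus, $p\nmid N_0$, $\gcd(N_0,D_K)=1$, with Fourier coefficients $a_n=a_n(f)$. $F/\mathbb Q_p$ is the local Hecke field generated by the $a_n$, $\mathcal O$ its ring of integers, $\varpi$ a uniformizer. $\mathcal A_f/\mathbb Q$ is a $\mathrm{GL}_2$-type abelian variety attached to $f$ with $\mathcal O\cong\mathrm{End}(\mathcal A_f)\otimes\mathbb Z_p$; $T$ is its $\varpi$-adic Tate module (free of rank two over $\mathcal O$). It is assumed that $\mathcal A_f$ has good non-ordinary reduction ($\varpi\mid a_p$). $N_0=N^+N^-$ with $N^+$ (resp. $N^-$) divisible only by primes split (resp. inert) in $K$, and $N^-$ is a square-free product of an even number of primes. If $p$ is inert in $K$, $\mathcal A_f$ is an elliptic curve over $\mathbb Q$ (so $F=\mathbb Q_p$, $a_p=0$). $K_\infty/K$ is the anticyclotomic $\mathbb Z_p$-extension, $\Gamma=\mathrm{Gal}(K_\infty/K)$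 with topological generator $\gamma$, $\Lambda=\mathcal O[[\Gamma]]\cong\mathcal O[[X]]$ via $\gamma\mapsto1+X$. $\mathbb T=T\otimes_{\mathcal O}\Lambda^\iota$, where $G_K$ acts on $\Lambda^\iota=\Lambda$ through $G_K\to\Gamma$ composed with inversion. For a character $\alpha:\Gamma\to\mathcal O^\times$, $T_\alpha=T\otimes\mathcal O(\alpha)$; there is the specialization $\mathbb T\to T_\alpha$ with kernel $(\gamma-\alpha^{-1}(\gamma))\mathbb T$, inducing $\pi_\alpha:H^1(K,\mathbb T/I_n\mathbb T)\to H^1(K,T_\alpha/I_nT_\alpha)$, and $\boldsymbol\kappa_n^\bullet(\alpha):=\pi_\alpha(\boldsymbol\kappa_n^\bullet)$. **Kolyvagin primes and signed Heegner classes.** $\mathcal L$ is the set of primes $\ell\nmid N_0p$ inert in $K$ with $M(\ell)=\min\{\mathrm{ord}_\varpi(\ell+1),\mathrm{ord}_\varpi(a_\ell)\}>0$; $\mathcal N$ is the set of square-free products of primes in $\mathcal L$ (including $1$); $M(n)=\min_{\ell\mid n}M(\ell)$, $M(1)=\infty$, $I_n=\varpi^{M(n)}\mathcal O$ ($I_1=0$). $K[c]$ is the ring class field of conductor $c$, $K[np^\infty]=\bigcup_kK[np^k]$, $\mathcal G(n)=\mathrm{Gal}(K[n]/K)$, $G(n)=\mathrm{Gal}(K[n]/K[1])\cong\prod_{\ell\mid n}G(\ell)$, with $G(\ell)=\mathrm{Gal}(K[\ell]/K[1])=\langle\sigma_\ell\rangle$ cyclic. $P[np^k]\in\mathcal A_f(K[np^k])$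 is the Heegner point of conductor $np^k$: the image, under the parametrization of $\mathcal A_f$ by the Shimura curve of discriminant $N^-$ and level $N^+$, of a compatible choice of CM points (constructions of S. Zhang and Howard), regarded in $H^1(K[np^k],T)$ by the Kummer map. These satisfy $\mathrm{Tr}_{K[\ell np^k]/K[np^k]}P[\ell np^k]=a_\ell P[np^k]$ for primes $\ell\in\mathcal L$, $\ell\nmid n$, and $\mathrm{Tr}_{K[np^{k+1}]/K[np^k]}P[np^{k+1}]=a_pP[np^k]-P[np^{k-1}]$ for $k\ge1$. Put $D_n=\prod_{\ell\mid n}\sum_{j=1}^{\ell}j\sigma_\ell^j$ and let $S_n$ be a set of coset representatives of $\mathcal G(n)/G(n)$. Let $\Gamma^{(np)}=\mathrm{Gal}(K[np^\infty]/K[np])$, $\tilde\Lambda=\mathcal O[[\Gamma^{(np)}]]\cong\mathcal O[[X]]$, $\tilde\Lambda_k=\mathcal O[\mathrm{Gal}(K[np^{k+1}]/K[np])]$, $\Phi_k=\frac{(1+X)^{p^k}-1}{(1+X)^{p^{k-1}}-1}$, $C_k=\begin{bmatrix}a_p&1\\-\Phi_k&0\end{bmatrix}$, $H_k=C_k\cdots C_1$ acting on $\tilde\Lambda_k^2$. For $k\ge1$ there are unique classes $P[np^{k+1}]^\sharp,P[np^{k+1}]^\flat$ in $H^1(K[np^{k+1}],T)^{\oplus2}$ modulo $\ker(H_k)\cdot H^1(K[np^{k+1}],T)^{\oplus2}$ with $H_k[P[np^{k+1}]^\sharp,P[np^{k+1}]^\flat]^t=[P[np^{k+1}],-\mathrm{res}(P[np^k])]^t$;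 they are compatible under corestriction and, since $\tilde\Lambda^2\cong\varprojlim_k\tilde\Lambda_k^2/\ker H_k$, define $\tilde{\mathbb P}_n^\sharp,\tilde{\mathbb P}_n^\flat\in H^1(K[np],T\otimes\tilde\Lambda^\iota)$. $\mathbb P_n^\bullet$ is the image of $\tilde{\mathbb P}_n^\bullet$ under $H^1(K[np],T\otimes\tilde\Lambda^\iota)\to H^1(K[np],\mathbb T)\xrightarrow{\mathrm{cores}}H^1(K[n],\mathbb T)$ (first map induced by $\Gamma^{(np)}\to\Gamma$). Then $\tilde{\boldsymbol\kappa}_n^\bullet=\sum_{\sigma\in S_n}\sigma D_n\mathbb P_n^\bullet$, and $\boldsymbol\kappa_n^\bullet\in H^1(K,\mathbb T/I_n\mathbb T)$ is the class corresponding to the image of $\tilde{\boldsymbol\kappa}_n^\bullet$ in $H^1(K[n],\mathbb T/I_n\mathbb T)^{\mathcal G(n)}\cong H^1(K,\mathbb T/I_n\mathbb T)$ (restriction isomorphism). *)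

theory Defs
  imports
    "HOL-Analysis.Analysis"
    "HOL-Algebra.FiniteProduct"
    "HOL-Algebra.RingHom"
    "HOL-Algebra.Coset"
    "HOL-Algebra.Generated_Groups"
    "HOL-Library.Poly_Mapping"
    "HOL-Library.Extended_Nat"
    "HOL-Computational_Algebra.Formal_Power_Series"
    "HOL-Computational_Algebra.Primes"
    "HOL-Computational_Algebra.Squarefree"
begin

section \<open>Number fields inside the complex numbers and their Galois groups\<close>

text \<open>All number fields live in the field of algebraic numbers inside the complex numbers.
  An automorphism of that field is represented by the function that is the identity on
  transcendental numbers, so that the group law is composition and inversion is
  \<open>inv_into UNIV\<close>.\<close>

type_synonym gal = "complex \<Rightarrow> complex"

definition qbar :: "complex set" where
  "qbar = {x. algebraic x}"

definition zbar :: "complex set" where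
  "zbar = {x. algebraic_int x}"

definition gal :: "complex set \<Rightarrow> gal set" where
  "gal L = {\<sigma>. bij \<sigma> \<and> (\<forall>x. x \<notin> qbar \<longrightarrow> \<sigma> x = x) \<and> (\<forall>x\<in>qbar. \<sigma> x \<in> qbar)
     \<and> (\<forall>x\<in>qbar. \<forall>y\<in>qbar. \<sigma> (x + y) = \<sigma> x + \<sigma> y \<and> \<sigma> (x * y) = \<sigma> x * \<sigma> y)
     \<and> (\<forall>x\<in>L. \<sigma> x = x)}"

abbreviation ginv :: "gal \<Rightarrow> gal" where
  "ginv \<sigma> \<equiv> inv_into UNIV \<sigma>"

definition krull :: "gal set \<Rightarrow> gal topology" where
  "krull G = subtopology (product_topology (\<lambda>_. discrete_topology UNIV) UNIV) G"

definition agree :: "complex set \<Rightarrow> gal \<Rightarrow> gal \<Rightarrow> bool" where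
  "agree L \<sigma> \<tau> \<longleftrightarrow> (\<forall>x\<in>L. \<sigma> x = \<tau> x)"

definition is_subfield :: "complex set \<Rightarrow> bool" where
  "is_subfield L \<longleftrightarrow> 1 \<in> L \<and> (\<forall>x\<in>L. \<forall>y\<in>L. x - y \<in> L \<and> x * y \<in> L \<and> x / y \<in> L)"

definition field_gen :: "complex set \<Rightarrow> complex set" where
  "field_gen S = \<Inter>{L. is_subfield L \<and> S \<subseteq> L}"

definition prime_over :: "nat \<Rightarrow> complex set \<Rightarrow> bool" where
  "prime_over q Q \<longleftrightarrow> Q \<subseteq> zbar \<and> of_nat q \<in> Q \<and> 1 \<notin> Q
     \<and> (\<forall>x\<in>Q. \<forall>y\<in>Q. x + y \<in> Q) \<and> (\<forall>x\<in>zbar. \<forall>y\<in>Q. x * y \<in> Q)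
     \<and> (\<forall>x\<in>zbar. \<forall>y\<in>zbar. x * y \<in> Q \<longrightarrow> x \<in> Q \<or> y \<in> Q)"

definition frobenius :: "nat \<Rightarrow> complex set \<Rightarrow> gal \<Rightarrow> bool" where
  "frobenius q Q \<sigma> \<longleftrightarrow> \<sigma> \<in> gal \<rat> \<and> prime_over q Q \<and> (\<forall>x\<in>zbar. \<sigma> x - x ^ q \<in> Q)"


section \<open>Imaginary quadratic fields, orders and ring class fields\<close>

definition imag_quad_disc :: "int \<Rightarrow> bool" where
  "imag_quad_disc D \<longleftrightarrow> D < 0 \<and>
     (D mod 4 = 1 \<and> squarefree D \<or>
      (\<exists>m. D = 4 * m \<and> squarefree m \<and> (m mod 4 = 2 \<or> m mod 4 = 3)))"

definition quad_field :: "int \<Rightarrow> complex set" where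
  "quad_field D = {of_rat a + of_rat b * csqrt (of_int D) | a b. True}"

definition ring_of_integers :: "int \<Rightarrow> complex set" where
  "ring_of_integers D = quad_field D \<inter> zbar"

definition quad_order :: "int \<Rightarrow> nat \<Rightarrow> complex set" where
  "quad_order D c = {of_int a + of_nat c * x | a x. x \<in> ring_of_integers D}"

definition inert_in :: "int \<Rightarrow> nat \<Rightarrow> bool" where
  "inert_in D q \<longleftrightarrow> (\<forall>x\<in>ring_of_integers D. \<forall>y\<in>ring_of_integers D.
     x * y \<in> (*) (of_nat q) ` ring_of_integers D \<longrightarrow>
     x \<in> (*) (of_nat q) ` ring_of_integers D \<or> y \<in> (*) (of_nat q) ` ring_of_integers D)"

definition ramified_in :: "int \<Rightarrow> nat \<Rightarrow> bool" where
  "ramified_in D q \<longleftrightarrow> (\<exists>x\<in>ring_of_integers D.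
     x \<notin> (*) (of_nat q) ` ring_of_integers D \<and> x\<^sup>2 \<in> (*) (of_nat q) ` ring_of_integers D)"

definition split_in :: "int \<Rightarrow> nat \<Rightarrow> bool" where
  "split_in D q \<longleftrightarrow> \<not> inert_in D q \<and> \<not> ramified_in D q"

definition eisenstein_sum :: "complex set \<Rightarrow> nat \<Rightarrow> complex" where
  "eisenstein_sum L k = infsum (\<lambda>w. 1 / w ^ k) (L - {0})"

definition j_invariant :: "complex set \<Rightarrow> complex" where
  "j_invariant L = (let g2 = 60 * eisenstein_sum L 4; g3 = 140 * eisenstein_sum L 6
     in 1728 * g2 ^ 3 / (g2 ^ 3 - 27 * g3\<^sup>2))"

text \<open>The ring class field of conductor \<open>c\<close>, in its usual description by complex multiplication.\<close>

definition ring_class_field :: "int \<Rightarrow> nat \<Rightarrow> complex set" where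
  "ring_class_field D c = field_gen (insert (j_invariant (quad_order D c)) (quad_field D))"


section \<open>Newforms of weight two and trivial nebentypus\<close>

definition upper_half :: "complex set" where
  "upper_half = {z. 0 < Im z}"

definition moebius :: "real^2^2 \<Rightarrow> complex \<Rightarrow> complex" where
  "moebius g z = (of_real (g$1$1) * z + of_real (g$1$2)) / (of_real (g$2$1) * z + of_real (g$2$2))"

definition slash2 :: "(complex \<Rightarrow> complex) \<Rightarrow> real^2^2 \<Rightarrow> complex \<Rightarrow> complex" where
  "slash2 f g z = f (moebius g z) / (of_real (g$2$1) * z + of_real (g$2$2))\<^sup>2"

definition SL2Z :: "(real^2^2) set" where
  "SL2Z = {g. det g = 1 \<and> (\<forall>i j. g$i$j \<in> \<int>)}"

definition Gamma0 :: "nat \<Rightarrow> (real^2^2) set" where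
  "Gamma0 N = {g \<in> SL2Z. \<exists>k::int. g$2$1 = of_int (int N * k)}"

definition cusp_form2 :: "nat \<Rightarrow> (complex \<Rightarrow> complex) \<Rightarrow> bool" where
  "cusp_form2 N f \<longleftrightarrow> f holomorphic_on upper_half
     \<and> (\<forall>g\<in>Gamma0 N. \<forall>z\<in>upper_half. slash2 f g z = f z)
     \<and> (\<forall>g\<in>SL2Z. (slash2 f g \<longlongrightarrow> 0) (filtercomap Im at_top))"

text \<open>In weight two the factor \<open>y\<^sup>2\<close> of the Petersson product cancels the density of the
  hyperbolic measure.  The quotient of the upper half plane by \<open>\<Gamma>\<^sub>0(N)\<close> is covered by the
  translates of the standard fundamental domain by representatives of \<open>\<Gamma>\<^sub>0(N)\SL\<^sub>2(\<int>)\<close>.\<close>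

definition petersson :: "nat \<Rightarrow> (complex \<Rightarrow> complex) \<Rightarrow> (complex \<Rightarrow> complex) \<Rightarrow> complex" where
  "petersson N f h =
     set_lebesgue_integral lborel {z \<in> upper_half. \<bar>Re z\<bar> \<le> 1/2 \<and> 1 \<le> norm z}
       (\<lambda>z. \<Sum>C\<in>(\<lambda>g. (\<lambda>u. u ** g) ` Gamma0 N) ` SL2Z.
              slash2 f (SOME g. g \<in> C) z * cnj (slash2 h (SOME g. g \<in> C) z))"

definition hecke :: "nat \<Rightarrow> nat \<Rightarrow> (complex \<Rightarrow> complex) \<Rightarrow> complex \<Rightarrow> complex" where
  "hecke N q f z = (\<Sum>j<q. f ((z + of_nat j) / of_nat q)) / of_nat q
     + (if q dvd N then 0 else of_nat q * f (of_nat q * z))"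

definition newform2 :: "nat \<Rightarrow> (complex \<Rightarrow> complex) \<Rightarrow> (nat \<Rightarrow> complex) \<Rightarrow> bool" where
  "newform2 N f a \<longleftrightarrow> cusp_form2 N f
     \<and> (\<forall>z\<in>upper_half. (\<lambda>n. a n * exp (2 * pi * \<i> * of_nat n * z)) sums f z)
     \<and> a 0 = 0 \<and> a 1 = 1
     \<and> (\<forall>q. prime q \<longrightarrow> (\<forall>z\<in>upper_half. hecke N q f z = a q * f z))
     \<and> (\<forall>M d h. M * d dvd N \<and> M < N \<and> cusp_form2 M h \<longrightarrow> petersson N f (\<lambda>z. h (of_nat d * z)) = 0)"


section \<open>The local Hecke field\<close>

text \<open>The ring of integers of a finite extension of \<open>\<rat>\<^sub>p\<close>, with uniformizer \<open>w\<close>: a complete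
  discrete valuation ring of characteristic zero with finite residue field of
  characteristic \<open>p\<close>.\<close>

definition padic_integer_ring :: "nat \<Rightarrow> 'o::{idom,ring_char_0} \<Rightarrow> bool" where
  "padic_integer_ring p w \<longleftrightarrow> w \<noteq> 0 \<and> \<not> w dvd 1 \<and> w dvd of_nat p
     \<and> (\<forall>x. x \<noteq> 0 \<longrightarrow> (\<exists>u k. u dvd 1 \<and> x = u * w ^ k))
     \<and> (\<forall>s. (\<forall>k. w ^ k dvd s (Suc k) - s k) \<longrightarrow> (\<exists>y. \<forall>k. w ^ k dvd s k - y))
     \<and> (\<exists>X. finite X \<and> (\<forall>x. \<exists>r\<in>X. w dvd x - r))"

definition hecke_ring :: "(nat \<Rightarrow> complex) \<Rightarrow> complex set" where
  "hecke_ring a = \<Inter>{S. 1 \<in> S \<and> range a \<subseteq> S \<and> (\<forall>x\<in>S. \<forall>y\<in>S. x - y \<in> S \<and> x * y \<in> S)}"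

text \<open>The last condition of the next definition says that the fraction field of the ring is
  generated over \<open>\<rat>\<^sub>p\<close> by the images of the Fourier coefficients.\<close>

definition local_hecke_field :: "nat \<Rightarrow> (nat \<Rightarrow> complex) \<Rightarrow> 'o::{idom,ring_char_0} \<Rightarrow> (complex \<Rightarrow> 'o) \<Rightarrow> bool" where
  "local_hecke_field p a w emb \<longleftrightarrow> padic_integer_ring p w
     \<and> inj_on emb (hecke_ring a) \<and> emb 1 = 1
     \<and> (\<forall>x\<in>hecke_ring a. \<forall>y\<in>hecke_ring a. emb (x - y) = emb x - emb y \<and> emb (x * y) = emb x * emb y)
     \<and> (\<forall>x. \<exists>k. \<forall>j. \<exists>y\<in>emb ` hecke_ring a. w ^ j dvd of_nat p ^ k * x - y)"

definition ord_w :: "'o::comm_semiring_1 \<Rightarrow> 'o \<Rightarrow> enat" where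
  "ord_w w x = (SUP k\<in>{k. w ^ k dvd x}. enat k)"


section \<open>Projective varieties and abelian varieties over the rationals\<close>

text \<open>A point of \<open>d\<close>-dimensional projective space is represented by its homogeneous coordinate
  vector whose first nonzero entry is 1; coordinates beyond \<open>d\<close> are 0.  In this form a point is
  defined over a subfield iff its coordinates lie in it, and automorphisms act on coordinates.\<close>

type_synonym pt = "nat \<Rightarrow> complex"

definition proj_space :: "nat \<Rightarrow> pt set" where
  "proj_space d = {x. (\<exists>i\<le>d. x i \<noteq> 0) \<and> (\<forall>i>d. x i = 0) \<and> x (LEAST i. x i \<noteq> 0) = 1}"

definition pnormalize :: "nat \<Rightarrow> (nat \<Rightarrow> complex) \<Rightarrow> pt" where
  "pnormalize d v = (\<lambda>i. if i \<le> d then v i / v (LEAST j. v j \<noteq> 0) else 0)"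

definition pact :: "gal \<Rightarrow> pt \<Rightarrow> pt" where
  "pact \<sigma> x = (\<lambda>i. \<sigma> (x i))"

type_synonym cpoly = "(nat \<Rightarrow>\<^sub>0 nat) \<Rightarrow>\<^sub>0 complex"

definition peval :: "cpoly \<Rightarrow> (nat \<Rightarrow> complex) \<Rightarrow> complex" where
  "peval P x = (\<Sum>m\<in>Poly_Mapping.keys P. Poly_Mapping.lookup P m * (\<Prod>i\<in>Poly_Mapping.keys m. x i ^ Poly_Mapping.lookup m i))"

definition homogeneous :: "nat \<Rightarrow> nat \<Rightarrow> cpoly \<Rightarrow> bool" where
  "homogeneous d e P \<longleftrightarrow> (\<forall>m\<in>Poly_Mapping.keys P. Poly_Mapping.keys m \<subseteq> {..d} \<and> (\<Sum>i\<in>Poly_Mapping.keys m. Poly_Mapping.lookup m i) = e)"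

definition rational_poly :: "cpoly \<Rightarrow> bool" where
  "rational_poly P \<longleftrightarrow> (\<forall>m. Poly_Mapping.lookup P m \<in> \<rat>)"

text \<open>Zero loci over the complex numbers of rational homogeneous polynomials, geometrically
  irreducible.\<close>

definition proj_variety :: "nat \<Rightarrow> pt set \<Rightarrow> bool" where
  "proj_variety d V \<longleftrightarrow>
     (\<exists>S. (\<forall>P\<in>S. rational_poly P \<and> (\<exists>e. homogeneous d e P)) \<and>
          V = {x \<in> proj_space d. \<forall>P\<in>S. peval P x = 0})
     \<and> V \<noteq> {}
     \<and> (\<forall>P Q e e'. homogeneous d e P \<and> homogeneous d e' Q \<and> (\<forall>x\<in>V. peval P x * peval Q x = 0)
          \<longrightarrow> (\<forall>x\<in>V. peval P x = 0) \<or> (\<forall>x\<in>V. peval Q x = 0))"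

definition proj_curve :: "nat \<Rightarrow> pt set \<Rightarrow> bool" where
  "proj_curve d V \<longleftrightarrow> proj_variety d V \<and> infinite V \<and>
     (\<forall>P e. homogeneous d e P \<longrightarrow> (\<forall>x\<in>V. peval P x = 0) \<or> finite {x \<in> V. peval P x = 0})"

text \<open>Morphisms over \<open>\<rat>\<close>: locally given by rational homogeneous polynomials of equal degree.\<close>

definition proj_morphism :: "nat \<Rightarrow> pt set \<Rightarrow> nat \<Rightarrow> (pt \<Rightarrow> pt) \<Rightarrow> bool" where
  "proj_morphism d V d' \<phi> \<longleftrightarrow> (\<forall>x\<in>V. \<exists>e F.
     (\<forall>i\<le>d'. rational_poly (F i) \<and> homogeneous d e (F i))
     \<and> (\<exists>i\<le>d'. peval (F i) x \<noteq> 0)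
     \<and> (\<forall>y\<in>V. (\<exists>i\<le>d'. peval (F i) y \<noteq> 0) \<longrightarrow>
          \<phi> y = pnormalize d' (\<lambda>i. if i \<le> d' then peval (F i) y else 0)))"

definition segre :: "nat \<Rightarrow> pt \<Rightarrow> pt \<Rightarrow> pt" where
  "segre d x y = (\<lambda>k. x (k div Suc d) * y (k mod Suc d))"

text \<open>The carrier of \<open>A\<close> is the set of complex points.  The group law is a morphism on the
  product, which is made projective by the Segre embedding.\<close>

definition abelian_variety :: "nat \<Rightarrow> pt monoid \<Rightarrow> bool" where
  "abelian_variety d A \<longleftrightarrow> proj_variety d (carrier A) \<and> comm_group A
     \<and> (\<forall>i. \<one>\<^bsub>A\<^esub> i \<in> \<rat>)
     \<and> proj_morphism d (carrier A) d (\<lambda>x. inv\<^bsub>A\<^esub> x)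
     \<and> (\<exists>\<mu>. proj_morphism (Suc d * Suc d - 1) {segre d x y | x y. x \<in> carrier A \<and> y \<in> carrier A} d \<mu>
            \<and> (\<forall>x\<in>carrier A. \<forall>y\<in>carrier A. \<mu> (segre d x y) = x \<otimes>\<^bsub>A\<^esub> y))"

definition points_over :: "pt monoid \<Rightarrow> complex set \<Rightarrow> pt set" where
  "points_over A L = {x \<in> carrier A. \<forall>i. x i \<in> L}"

definition End_ring :: "nat \<Rightarrow> pt monoid \<Rightarrow> (pt \<Rightarrow> pt) ring" where
  "End_ring d A = \<lparr> carrier = {\<phi> \<in> extensional (carrier A). \<phi> \<in> hom A A \<and> proj_morphism d (carrier A) d \<phi>},
     mult = compose (carrier A), one = (\<lambda>x\<in>carrier A. x),
     zero = (\<lambda>x\<in>carrier A. \<one>\<^bsub>A\<^esub>), add = (\<lambda>\<phi> \<psi>. \<lambda>x\<in>carrier A. \<phi> x \<otimes>\<^bsub>A\<^esub> \<psi> x) \<rparr>"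

definition type_ring :: "'o::comm_ring_1 ring" where
  "type_ring = \<lparr> carrier = UNIV, mult = (*), one = 1, zero = 0, add = (+) \<rparr>"

text \<open>\<open>e\<close> induces an isomorphism from \<open>End(A) \<otimes> \<int>\<^sub>p\<close> onto the coefficient ring.  Since
  \<open>End(A)\<close> is finitely generated, the former is the \<open>p\<close>-adic completion of \<open>End(A)\<close>, so
  this is bijectivity modulo every power of \<open>p\<close>.\<close>

definition End_padic_iso :: "nat \<Rightarrow> nat \<Rightarrow> pt monoid \<Rightarrow> ((pt \<Rightarrow> pt) \<Rightarrow> 'o::comm_ring_1) \<Rightarrow> bool" where
  "End_padic_iso p d A e \<longleftrightarrow> ring_hom_ring (End_ring d A) type_ring e
     \<and> (\<forall>j y. \<exists>\<phi>\<in>carrier (End_ring d A). of_nat p ^ j dvd e \<phi> - y)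
     \<and> (\<forall>j. \<forall>\<phi>\<in>carrier (End_ring d A). of_nat p ^ j dvd e \<phi> \<longrightarrow>
          (\<exists>\<theta>\<in>carrier (End_ring d A). \<forall>x\<in>carrier A. \<phi> x = \<theta> x [^]\<^bsub>A\<^esub> (p ^ j)))"


section \<open>Topological Galois modules and continuous cohomology in degree one\<close>

text \<open>Modules are written multiplicatively, as groups of HOL-Algebra.\<close>

record ('r, 'm) gmod = "'m monoid" +
  gact :: "gal \<Rightarrow> 'm \<Rightarrow> 'm"
  smul :: "'r \<Rightarrow> 'm \<Rightarrow> 'm"
  mtop :: "'m topology"

definition coset_map :: "('b, 'c) monoid_scheme \<Rightarrow> 'b set \<Rightarrow> ('a \<Rightarrow> 'b) \<Rightarrow> 'a set \<Rightarrow> 'b set" where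
  "coset_map M' N' f C = (\<Union>x\<in>C. N' #>\<^bsub>M'\<^esub> f x)"

definition Z1 :: "gal set \<Rightarrow> ('r, 'm) gmod \<Rightarrow> (gal \<Rightarrow> 'm) monoid" where
  "Z1 G M = \<lparr> carrier = {z \<in> G \<rightarrow>\<^sub>E carrier M. continuous_map (krull G) (mtop M) z \<and>
       (\<forall>g\<in>G. \<forall>h\<in>G. z (g \<circ> h) = z g \<otimes>\<^bsub>M\<^esub> gact M g (z h))},
     mult = (\<lambda>y z. \<lambda>g\<in>G. y g \<otimes>\<^bsub>M\<^esub> z g), one = (\<lambda>g\<in>G. \<one>\<^bsub>M\<^esub>) \<rparr>"

definition B1 :: "gal set \<Rightarrow> ('r, 'm) gmod \<Rightarrow> (gal \<Rightarrow> 'm) set" where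
  "B1 G M = {(\<lambda>g\<in>G. gact M g m \<otimes>\<^bsub>M\<^esub> inv\<^bsub>M\<^esub> m) | m. m \<in> carrier M}"

definition H1 :: "gal set \<Rightarrow> ('r, 'm) gmod \<Rightarrow> (gal \<Rightarrow> 'm) set monoid" where
  "H1 G M = Z1 G M Mod B1 G M"

definition H1_map :: "gal set \<Rightarrow> ('s, 'n) gmod \<Rightarrow> ('m \<Rightarrow> 'n) \<Rightarrow> (gal \<Rightarrow> 'm) set \<Rightarrow> (gal \<Rightarrow> 'n) set" where
  "H1_map G N f = coset_map (Z1 G N) (B1 G N) (\<lambda>z. \<lambda>g\<in>G. f (z g))"

definition H1_smul :: "gal set \<Rightarrow> ('r, 'm) gmod \<Rightarrow> 'r \<Rightarrow> (gal \<Rightarrow> 'm) set \<Rightarrow> (gal \<Rightarrow> 'm) set" where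
  "H1_smul G M r = H1_map G M (smul M r)"

definition H1_res :: "gal set \<Rightarrow> ('r, 'm) gmod \<Rightarrow> (gal \<Rightarrow> 'm) set \<Rightarrow> (gal \<Rightarrow> 'm) set" where
  "H1_res U M = coset_map (Z1 U M) (B1 U M) (\<lambda>z. \<lambda>g\<in>U. z g)"

text \<open>The action of an element \<open>\<sigma>\<close> of a Galois group on the cohomology of a normal subgroup \<open>U\<close>.\<close>

definition H1_conj :: "gal set \<Rightarrow> ('r, 'm) gmod \<Rightarrow> gal \<Rightarrow> (gal \<Rightarrow> 'm) set \<Rightarrow> (gal \<Rightarrow> 'm) set" where
  "H1_conj U M \<sigma> = coset_map (Z1 U M) (B1 U M) (\<lambda>z. \<lambda>g\<in>U. gact M \<sigma> (z (ginv \<sigma> \<circ> g \<circ> \<sigma>)))"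

text \<open>Corestriction from \<open>U\<close> to \<open>V \<supseteq> U\<close>: the transfer formula on cocycles, with respect to
  representatives \<open>r C\<close> of the left cosets \<open>C\<close> of \<open>U\<close> in \<open>V\<close>.\<close>

definition H1_cores :: "gal set \<Rightarrow> gal set \<Rightarrow> ('r, 'm) gmod \<Rightarrow> (gal \<Rightarrow> 'm) set \<Rightarrow> (gal \<Rightarrow> 'm) set" where
  "H1_cores U V M = (let r = (\<lambda>C. SOME v. v \<in> C) in
     coset_map (Z1 V M) (B1 V M) (\<lambda>z. \<lambda>g\<in>V.
       finprod M (\<lambda>C. gact M (r ((\<circ>) g ` C)) (z (ginv (r ((\<circ>) g ` C)) \<circ> g \<circ> r C)))
         ((\<lambda>v. (\<circ>) v ` U) ` V)))"

definition quotient_top :: "'a topology \<Rightarrow> 'a set set \<Rightarrow> 'a set topology" where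
  "quotient_top X Q = topology (\<lambda>U. U \<subseteq> Q \<and> openin X (\<Union>U))"

definition quot_gmod :: "('r, 'm) gmod \<Rightarrow> 'm set \<Rightarrow> ('r, 'm set) gmod" where
  "quot_gmod M N = \<lparr> carrier = carrier (M Mod N), mult = mult (M Mod N), one = one (M Mod N),
     gact = (\<lambda>g. coset_map M N (gact M g)), smul = (\<lambda>r. coset_map M N (smul M r)),
     mtop = quotient_top (mtop M) (carrier (M Mod N)) \<rparr>"

definition ideal_mult :: "'r set \<Rightarrow> ('r, 'm) gmod \<Rightarrow> 'm set" where
  "ideal_mult I M = generate M {smul M r x | r x. r \<in> I \<and> x \<in> carrier M}"

definition twist :: "('r, 'm) gmod \<Rightarrow> (gal \<Rightarrow> 'r) \<Rightarrow> ('r, 'm) gmod" where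
  "twist M \<alpha> = M \<lparr> gact := (\<lambda>g x. smul M (\<alpha> g) (gact M g x)) \<rparr>"


section \<open>The Tate module and the abelian variety attached to a newform\<close>

text \<open>The coefficient ring acts through \<open>End(A) \<otimes> \<int>\<^sub>p\<close>: on \<open>p^j\<close>-torsion, an element acts as any
  endomorphism congruent to it modulo \<open>p^j\<close>.\<close>

definition tate :: "nat \<Rightarrow> nat \<Rightarrow> pt monoid \<Rightarrow> ((pt \<Rightarrow> pt) \<Rightarrow> 'o::comm_ring_1) \<Rightarrow> ('o, nat \<Rightarrow> pt) gmod" where
  "tate p d A e = (let T = {t. \<forall>j. t j \<in> points_over A qbar \<and> t j [^]\<^bsub>A\<^esub> (p ^ j) = \<one>\<^bsub>A\<^esub> \<and> t (Suc j) [^]\<^bsub>A\<^esub> p = t j} in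
     \<lparr> carrier = T, mult = (\<lambda>s t j. s j \<otimes>\<^bsub>A\<^esub> t j), one = (\<lambda>j. \<one>\<^bsub>A\<^esub>),
       gact = (\<lambda>\<sigma> t j. pact \<sigma> (t j)),
       smul = (\<lambda>a t j. (SOME \<phi>. \<phi> \<in> carrier (End_ring d A) \<and> of_nat p ^ j dvd e \<phi> - a) (t j)),
       mtop = subtopology (product_topology (\<lambda>_. discrete_topology UNIV) UNIV) T \<rparr>)"

definition kummer :: "nat \<Rightarrow> nat \<Rightarrow> pt monoid \<Rightarrow> ((pt \<Rightarrow> pt) \<Rightarrow> 'o::comm_ring_1) \<Rightarrow> complex set \<Rightarrow> pt
    \<Rightarrow> (gal \<Rightarrow> nat \<Rightarrow> pt) set" where
  "kummer p d A e L x = {z \<in> carrier (Z1 (gal L) (tate p d A e)).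
     \<exists>y. y 0 = x \<and> (\<forall>j. y j \<in> points_over A qbar \<and> y (Suc j) [^]\<^bsub>A\<^esub> p = y j)
       \<and> (\<forall>g\<in>gal L. \<forall>j. z g j = pact g (y j) \<otimes>\<^bsub>A\<^esub> inv\<^bsub>A\<^esub> (y j))}"

text \<open>The Tate module is free of rank two over the coefficient ring and, for \<open>l\<close> prime to \<open>N p\<close>,
  a Frobenius at \<open>l\<close> acts on it with trace \<open>a\<^sub>l\<close> and determinant \<open>l\<close>.\<close>

definition attached_GL2_variety :: "nat \<Rightarrow> nat \<Rightarrow> (nat \<Rightarrow> complex) \<Rightarrow> (complex \<Rightarrow> 'o)
    \<Rightarrow> nat \<Rightarrow> pt monoid \<Rightarrow> ((pt \<Rightarrow> pt) \<Rightarrow> 'o::comm_ring_1) \<Rightarrow> bool" where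
  "attached_GL2_variety p N a emb d A e \<longleftrightarrow> abelian_variety d A \<and> End_padic_iso p d A e
     \<and> (let T = tate p d A e in
        \<exists>b1\<in>carrier T. \<exists>b2\<in>carrier T.
          (\<forall>t\<in>carrier T. \<exists>!xy. t = smul T (fst xy) b1 \<otimes>\<^bsub>T\<^esub> smul T (snd xy) b2)
          \<and> (\<forall>l Q \<sigma>. prime l \<and> \<not> l dvd N * p \<and> frobenius l Q \<sigma> \<longrightarrow>
               (\<exists>x y u v. gact T \<sigma> b1 = smul T x b1 \<otimes>\<^bsub>T\<^esub> smul T y b2
                  \<and> gact T \<sigma> b2 = smul T u b1 \<otimes>\<^bsub>T\<^esub> smul T v b2
                  \<and> x + v = emb (a l) \<and> x * v - u * y = of_nat l)))"


section \<open>Anticyclotomic extension and Iwasawa modules\<close>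

text \<open>\<open>L k\<close> is the \<open>k\<close>-th layer of a \<open>\<int>\<^sub>p\<close>-extension of the fixed field of \<open>G\<close>, and \<open>\<gamma>\<close> lifts a
  topological generator of its Galois group.\<close>

definition zp_tower :: "nat \<Rightarrow> gal set \<Rightarrow> (nat \<Rightarrow> complex set) \<Rightarrow> gal \<Rightarrow> bool" where
  "zp_tower p G L \<gamma> \<longleftrightarrow> \<gamma> \<in> G \<and> (\<forall>k. L k \<subseteq> L (Suc k)) \<and>
     (\<forall>k. \<forall>g\<in>G. \<exists>!i. i < p ^ k \<and> agree (L k) g (\<gamma> ^^ i))"

definition anticyclotomic :: "int \<Rightarrow> nat \<Rightarrow> (nat \<Rightarrow> complex set) \<Rightarrow> gal \<Rightarrow> bool" where
  "anticyclotomic D p L \<gamma> \<longleftrightarrow> zp_tower p (gal (quad_field D)) L \<gamma> \<and> L 0 = quad_field D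
     \<and> (\<forall>k. is_subfield (L k) \<and> L k \<subseteq> qbar \<and> (\<forall>\<sigma>\<in>gal \<rat>. \<sigma> ` L k = L k))
     \<and> (\<forall>k. \<forall>g\<in>gal (quad_field D). \<forall>x\<in>L k. cnj (g (cnj x)) = ginv g x)"

text \<open>The group-like element of \<open>\<O>[[X]]\<close> attached to \<open>g\<close>: if \<open>g\<close> acts as \<open>\<gamma>\<^sup>s\<close> with \<open>s \<in> \<int>\<^sub>p\<close> this is
  \<open>(1+X)\<^sup>s\<close>, the coefficientwise limit of \<open>(1+X)\<^sup>i\<close> for integers \<open>i\<close> tending to \<open>s\<close>.\<close>

definition iw_char :: "'o::comm_ring_1 \<Rightarrow> (nat \<Rightarrow> complex set) \<Rightarrow> gal \<Rightarrow> gal \<Rightarrow> 'o fps" where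
  "iw_char w L \<gamma> g = (THE u. \<forall>n j. \<exists>k. \<forall>i. agree (L k) g (\<gamma> ^^ i) \<longrightarrow>
     w ^ j dvd fps_nth u n - of_nat (i choose n))"

definition ser_smul :: "('o::comm_ring_1, 'm) gmod \<Rightarrow> 'o fps \<Rightarrow> (nat \<Rightarrow> 'm) \<Rightarrow> nat \<Rightarrow> 'm" where
  "ser_smul M u x n = finprod M (\<lambda>i. smul M (fps_nth u i) (x (n - i))) {..n}"

text \<open>\<open>M \<otimes> \<Lambda>\<^sup>\<iota>\<close> for \<open>M\<close> free of finite rank over \<open>\<O>\<close> and \<open>\<Lambda> = \<O>[[X]]\<close>, \<open>X = \<gamma> - 1\<close>: sequences of
  coefficients of power series over \<open>M\<close>.  The group acts on \<open>\<Lambda>\<^sup>\<iota>\<close> through inversion.\<close>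

definition iwasawa :: "'o::comm_ring_1 \<Rightarrow> (nat \<Rightarrow> complex set) \<Rightarrow> gal \<Rightarrow> ('o, 'm) gmod \<Rightarrow> ('o, nat \<Rightarrow> 'm) gmod" where
  "iwasawa w L \<gamma> M = (let S = {x. \<forall>i. x i \<in> carrier M} in
     \<lparr> carrier = S, mult = (\<lambda>x y i. x i \<otimes>\<^bsub>M\<^esub> y i), one = (\<lambda>i. \<one>\<^bsub>M\<^esub>),
       gact = (\<lambda>g x. ser_smul M (iw_char w L \<gamma> (ginv g)) (\<lambda>i. gact M g (x i))),
       smul = (\<lambda>r x i. smul M r (x i)),
       mtop = subtopology (product_topology (\<lambda>_. mtop M) UNIV) S \<rparr>)"

text \<open>Evaluation of a power series over \<open>M\<close> at \<open>X = b\<close>, as the limit of the partial sums.\<close>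

definition ser_eval :: "('o::comm_ring_1, 'm) gmod \<Rightarrow> 'o \<Rightarrow> (nat \<Rightarrow> 'm) \<Rightarrow> 'm" where
  "ser_eval M b x = (THE s. s \<in> carrier M \<and> (\<forall>n. \<exists>r\<in>carrier M.
     s = finprod M (\<lambda>i. smul M (b ^ i) (x i)) {..<n} \<otimes>\<^bsub>M\<^esub> smul M (b ^ n) r))"

text \<open>The map on series over \<open>M\<close> given by substituting for \<open>X\<close> a series \<open>b\<close> without constant term.\<close>

definition ser_subst :: "('o::comm_ring_1, 'm) gmod \<Rightarrow> 'o fps \<Rightarrow> (nat \<Rightarrow> 'm) \<Rightarrow> nat \<Rightarrow> 'm" where
  "ser_subst M b x n = finprod M (\<lambda>i. smul M (fps_nth (b ^ i) n) (x i)) {..n}"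

text \<open>The coefficient at the identity of the image of \<open>x\<close> in
  \<open>M \<otimes> \<O>[\<langle>\<gamma>\<rangle>/\<gamma>^(p^k)] = M \<otimes> \<O>[[X]]/((1+X)^(p^k) - 1)\<close>: write that image as the sum of
  \<open>t i \<otimes> \<gamma>^i\<close> over \<open>i < p^k\<close> and take \<open>t 0\<close>.\<close>

definition level_coeff :: "nat \<Rightarrow> ('o::comm_ring_1, 'm) gmod \<Rightarrow> nat \<Rightarrow> (nat \<Rightarrow> 'm) \<Rightarrow> 'm" where
  "level_coeff p M k x = (THE t0. \<exists>t y. t 0 = t0 \<and> (\<forall>i. t i \<in> carrier M) \<and> (\<forall>i. y i \<in> carrier M) \<and>
     (\<forall>n. x n = finprod M (\<lambda>i. t i [^]\<^bsub>M\<^esub> (i choose n)) {..<p ^ k}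
            \<otimes>\<^bsub>M\<^esub> ser_smul M ((1 + fps_X) ^ (p ^ k) - 1) y n))"

text \<open>Characters of \<open>\<Gamma>\<close> are continuous; they are regarded as functions on the absolute Galois
  group.\<close>

definition gamma_character :: "int \<Rightarrow> (nat \<Rightarrow> complex set) \<Rightarrow> 'o::comm_ring_1 \<Rightarrow> (gal \<Rightarrow> 'o) \<Rightarrow> bool" where
  "gamma_character D L w \<alpha> \<longleftrightarrow>
     (\<forall>g\<in>gal (quad_field D). \<alpha> g dvd 1)
     \<and> (\<forall>g\<in>gal (quad_field D). \<forall>h\<in>gal (quad_field D). \<alpha> (g \<circ> h) = \<alpha> g * \<alpha> h)
     \<and> (\<forall>j. \<exists>k. \<forall>g\<in>gal (quad_field D). agree (L k) g id \<longrightarrow> w ^ j dvd \<alpha> g - 1)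
     \<and> (\<forall>g\<in>gal (quad_field D). (\<forall>k. agree (L k) g id) \<longrightarrow> \<alpha> g = 1)"


section \<open>Kolyvagin primes\<close>

definition kol_depth :: "(nat \<Rightarrow> complex) \<Rightarrow> 'o::comm_ring_1 \<Rightarrow> (complex \<Rightarrow> 'o) \<Rightarrow> nat \<Rightarrow> enat" where
  "kol_depth a w emb l = min (ord_w w (of_nat (l + 1))) (ord_w w (emb (a l)))"

definition kol_primes :: "int \<Rightarrow> nat \<Rightarrow> nat \<Rightarrow> (nat \<Rightarrow> complex) \<Rightarrow> 'o::comm_ring_1 \<Rightarrow> (complex \<Rightarrow> 'o) \<Rightarrow> nat set" where
  "kol_primes D p N a w emb = {l. prime l \<and> \<not> l dvd N * p \<and> inert_in D l \<and> kol_depth a w emb l > 0}"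

definition kol_numbers :: "int \<Rightarrow> nat \<Rightarrow> nat \<Rightarrow> (nat \<Rightarrow> complex) \<Rightarrow> 'o::comm_ring_1 \<Rightarrow> (complex \<Rightarrow> 'o) \<Rightarrow> nat set" where
  "kol_numbers D p N a w emb = {n. squarefree n \<and> prime_factors n \<subseteq> kol_primes D p N a w emb}"

text \<open>The infimum over the empty set is infinite, which gives the zero ideal for \<open>n = 1\<close>.\<close>

definition kol_ideal :: "(nat \<Rightarrow> complex) \<Rightarrow> 'o::comm_ring_1 \<Rightarrow> (complex \<Rightarrow> 'o) \<Rightarrow> nat \<Rightarrow> 'o set" where
  "kol_ideal a w emb n =
     {x. \<forall>k. enat k \<le> (INF l\<in>prime_factors n. kol_depth a w emb l) \<longrightarrow> w ^ k dvd x}"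


section \<open>Shimura curves and Heegner points\<close>

definition Z_basis :: "(real^2^2) set \<Rightarrow> (4 \<Rightarrow> real^2^2) \<Rightarrow> bool" where
  "Z_basis R b \<longleftrightarrow> inj b \<and> independent (range b) \<and>
     R = {\<Sum>i\<in>UNIV. of_int (c i) *\<^sub>R b i | c :: 4 \<Rightarrow> int. True}"

text \<open>Orders in quaternion algebras over \<open>\<rat>\<close> that are split at the real place, embedded in
  \<open>M\<^sub>2(\<real>)\<close>; the reduced trace is the trace.\<close>

definition quat_order :: "(real^2^2) set \<Rightarrow> bool" where
  "quat_order R \<longleftrightarrow> (\<exists>b. Z_basis R b) \<and> mat 1 \<in> R \<and> (\<forall>x\<in>R. \<forall>y\<in>R. x ** y \<in> R)"

definition maximal_quat_order :: "(real^2^2) set \<Rightarrow> bool" where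
  "maximal_quat_order R \<longleftrightarrow> quat_order R \<and> (\<forall>R'. quat_order R' \<and> R \<subseteq> R' \<longrightarrow> R' = R)"

definition reduced_disc :: "(real^2^2) set \<Rightarrow> nat \<Rightarrow> bool" where
  "reduced_disc R D \<longleftrightarrow> (\<exists>b. Z_basis R b \<and>
     \<bar>det ((\<chi> i j. trace (b i ** b j)) :: real^4^4)\<bar> = (of_nat D)\<^sup>2)"

text \<open>Eichler orders of level \<open>Np\<close> in a quaternion algebra of discriminant \<open>Nm\<close>: intersections of
  two maximal orders of that algebra.  The discriminant of the algebra is the reduced
  discriminant of a maximal order, and an Eichler order of level \<open>Np\<close> has index \<open>Np\<close> in it.\<close>

definition eichler_order :: "nat \<Rightarrow> nat \<Rightarrow> (real^2^2) set \<Rightarrow> bool" where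
  "eichler_order Np Nm R \<longleftrightarrow> quat_order R \<and> reduced_disc R (Np * Nm) \<and>
     (\<exists>R1 R2. maximal_quat_order R1 \<and> maximal_quat_order R2 \<and>
        (\<forall>x\<in>R1. \<exists>m::nat. m > 0 \<and> of_nat m *\<^sub>R x \<in> R2) \<and>
        reduced_disc R1 Nm \<and> R = R1 \<inter> R2)"

text \<open>\<open>g\<close> is the image of \<open>x\<close> under the embedding of the complex numbers in \<open>M\<^sub>2(\<real>)\<close> normalized at
  its fixed point \<open>\<tau>\<close>, that is, \<open>g (\<tau>,1) = x (\<tau>,1)\<close>.\<close>

definition cm_image :: "complex \<Rightarrow> complex \<Rightarrow> real^2^2 \<Rightarrow> bool" where
  "cm_image \<tau> x g \<longleftrightarrow> of_real (g$1$1) * \<tau> + of_real (g$1$2) = x * \<tau> \<and> of_real (g$2$1) * \<tau> + of_real (g$2$2) = x"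

definition cm_point :: "(real^2^2) set \<Rightarrow> int \<Rightarrow> nat \<Rightarrow> complex \<Rightarrow> bool" where
  "cm_point R D c \<tau> \<longleftrightarrow> \<tau> \<in> upper_half \<and> {x. \<exists>g\<in>R. cm_image \<tau> x g} = quad_order D c"

definition holo_to_proj :: "complex set \<Rightarrow> nat \<Rightarrow> (complex \<Rightarrow> pt) \<Rightarrow> bool" where
  "holo_to_proj U d \<phi> \<longleftrightarrow> (\<forall>z\<in>U. \<exists>r>0. \<exists>F. ball z r \<subseteq> U \<and> (\<forall>i\<le>d. F i holomorphic_on ball z r) \<and>
     (\<forall>v\<in>ball z r. (\<exists>i\<le>d. F i v \<noteq> 0) \<and> \<phi> v = pnormalize d (\<lambda>i. if i \<le> d then F i v else 0)))"

text \<open>A nonconstant morphism over \<open>\<rat>\<close> from the Shimura curve of \<open>R\<close> to \<open>A\<close>, pulled back to the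
  upper half plane.  The complex points of the curve are the quotient of the upper half plane
  by the norm one units of \<open>R\<close>, compactified by cusps if there are any; at a cusp of width
  \<open>h\<close> the morphism is holomorphic in the local parameter \<open>exp(2\<pi>iz/h)\<close>.  The \<open>\<rat>\<close>-structure of
  the canonical model is characterized by Shimura's reciprocity law at the CM points of all
  imaginary quadratic fields: arithmetic Frobenius at a prime \<open>\<qq>\<close> of degree one maps the
  image of \<open>b \<tau>\<close> to that of \<open>\<tau>\<close>, where \<open>b\<close> generates the left ideal of \<open>R\<close> spanned by the image of
  \<open>\<qq>\<close> (for \<open>M\<^sub>2(\<int>)\<close>: \<open>b \<tau>\<close> has lattice \<open>\<qq> (\<int> \<tau> + \<int>)\<close>).  As \<open>b\<close> has norm \<open>q\<close>, containment of
  \<open>\<qq>\<close> in \<open>R b\<close> is enough.\<close>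

definition shimura_parametrization :: "(real^2^2) set \<Rightarrow> nat \<Rightarrow> nat \<Rightarrow> pt monoid \<Rightarrow> (complex \<Rightarrow> pt) \<Rightarrow> bool" where
  "shimura_parametrization R N d A \<phi> \<longleftrightarrow>
     holo_to_proj upper_half d \<phi> \<and> \<phi> ` upper_half \<subseteq> carrier A
     \<and> (\<forall>g\<in>R. det g = 1 \<longrightarrow> (\<forall>z\<in>upper_half. \<phi> (moebius g z) = \<phi> z))
     \<and> (\<forall>g h. det g = 1 \<and> h > 0 \<and> g ** vector [vector [1, h], vector [0, 1]] ** matrix_inv g \<in> R \<longrightarrow>
          (\<exists>r>0. \<exists>\<Phi>. holo_to_proj (ball 0 r) d \<Phi> \<and>
             (\<forall>z\<in>upper_half. norm (exp (2 * pi * \<i> * z / of_real h)) < r \<longrightarrow>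
                \<phi> (moebius g z) = \<Phi> (exp (2 * pi * \<i> * z / of_real h)))))
     \<and> (\<exists>z\<in>upper_half. \<exists>z'\<in>upper_half. \<phi> z \<noteq> \<phi> z')
     \<and> (\<forall>D c \<tau> q Q \<sigma> b.
          imag_quad_disc D \<and> c > 0 \<and> cm_point R D c \<tau> \<and>
          prime q \<and> \<not> q dvd c * N * nat \<bar>D\<bar> \<and>
          (\<forall>x\<in>quad_order D c. \<exists>i::int. x - of_int i \<in> Q) \<and>
          \<sigma> \<in> gal (quad_field D) \<and> frobenius q Q \<sigma> \<and>
          b \<in> R \<and> det b = of_nat q \<and>
          (\<forall>x\<in>quad_order D c \<inter> Q. \<exists>g\<in>R. cm_image \<tau> x (g ** b))
          \<longrightarrow> pact \<sigma> (\<phi> (moebius b \<tau>)) = \<phi> \<tau>)"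

definition heegner_class :: "int \<Rightarrow> nat \<Rightarrow> nat \<Rightarrow> pt monoid \<Rightarrow> ((pt \<Rightarrow> pt) \<Rightarrow> 'o::comm_ring_1)
    \<Rightarrow> (complex \<Rightarrow> pt) \<Rightarrow> (nat \<Rightarrow> complex) \<Rightarrow> nat \<Rightarrow> (gal \<Rightarrow> nat \<Rightarrow> pt) set" where
  "heegner_class D p d A e \<phi> \<tau> c = kummer p d A e (ring_class_field D c) (\<phi> (\<tau> c))"

text \<open>\<open>\<tau> c\<close> is the CM point of conductor \<open>c\<close>, for \<open>c = n p^k\<close> with \<open>n\<close> a Kolyvagin number.
  Compatibility: points whose conductors differ by a prime factor \<open>q\<close> are neighbours for the
  Hecke correspondence at \<open>q\<close>, and the trace relations hold.  The first trace relation is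
  required for \<open>n p^k > 1\<close> only: for \<open>n p^k = 1\<close> it would need the factor \<open>[\<O>\<^sub>K\<^sup>\<times> : \<int>\<^sup>\<times>]\<close> when
  \<open>K\<close> has extra units.\<close>

definition compatible_cm_points :: "int \<Rightarrow> nat \<Rightarrow> nat \<Rightarrow> (nat \<Rightarrow> complex) \<Rightarrow> 'o::comm_ring_1 \<Rightarrow> (complex \<Rightarrow> 'o)
    \<Rightarrow> nat \<Rightarrow> pt monoid \<Rightarrow> ((pt \<Rightarrow> pt) \<Rightarrow> 'o) \<Rightarrow> (real^2^2) set \<Rightarrow> (complex \<Rightarrow> pt) \<Rightarrow> (nat \<Rightarrow> complex) \<Rightarrow> bool" where
  "compatible_cm_points D p N a w emb d A e R \<phi> \<tau> \<longleftrightarrow>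
     (let T = tate p d A e; U = (\<lambda>c. gal (ring_class_field D c)); P = heegner_class D p d A e \<phi> \<tau> in
      \<forall>n\<in>kol_numbers D p N a w emb. \<forall>k.
        cm_point R D (n * p ^ k) (\<tau> (n * p ^ k))
        \<and> \<phi> (\<tau> (n * p ^ k)) \<in> points_over A (ring_class_field D (n * p ^ k))
        \<and> (\<forall>q. q = p \<or> (q \<in> kol_primes D p N a w emb \<and> \<not> q dvd n) \<longrightarrow>
             (\<exists>b\<in>R. det b = of_nat q \<and> \<tau> (q * (n * p ^ k)) = moebius b (\<tau> (n * p ^ k))))
        \<and> (\<forall>l\<in>kol_primes D p N a w emb. \<not> l dvd n \<and> n * p ^ k > 1 \<longrightarrow>
             H1_cores (U (l * n * p ^ k)) (U (n * p ^ k)) T (P (l * n * p ^ k))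
               = H1_smul (U (n * p ^ k)) T (emb (a l)) (P (n * p ^ k)))
        \<and> (k \<ge> 1 \<longrightarrow>
             H1_cores (U (n * p ^ Suc k)) (U (n * p ^ k)) T (P (n * p ^ Suc k))
               = H1_smul (U (n * p ^ k)) T (emb (a p)) (P (n * p ^ k))
                 \<otimes>\<^bsub>H1 (U (n * p ^ k)) T\<^esub>
                   inv\<^bsub>H1 (U (n * p ^ k)) T\<^esub> (H1_res (U (n * p ^ k)) T (P (n * p ^ (k - 1))))))"


section \<open>Signed Heegner classes and their derivatives\<close>

datatype signed = Sharp | Flat

text \<open>The action of \<open>C\<^sub>j\<close>, and then of \<open>H\<^sub>k = C\<^sub>k \<cdots> C\<^sub>1\<close>, on pairs of classes over a layer with Galois
  group \<open>U\<close>.  \<open>\<Phi>\<^sub>j\<close> is the sum of \<open>(1+X)^(i p^(j-1))\<close> over \<open>i < p\<close>, and \<open>1+X\<close> acts as \<open>\<gamma>\<close>.\<close>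

definition C_op :: "nat \<Rightarrow> gal set \<Rightarrow> ('o, 'm) gmod \<Rightarrow> gal \<Rightarrow> 'o \<Rightarrow> nat
    \<Rightarrow> (gal \<Rightarrow> 'm) set \<times> (gal \<Rightarrow> 'm) set \<Rightarrow> (gal \<Rightarrow> 'm) set \<times> (gal \<Rightarrow> 'm) set" where
  "C_op p U M \<gamma> ap j v =
     (H1_smul U M ap (fst v) \<otimes>\<^bsub>H1 U M\<^esub> snd v,
      inv\<^bsub>H1 U M\<^esub> (finprod (H1 U M) (\<lambda>i. H1_conj U M (\<gamma> ^^ (i * p ^ (j - 1))) (fst v)) {..<p}))"

fun H_op :: "nat \<Rightarrow> gal set \<Rightarrow> ('o, 'm) gmod \<Rightarrow> gal \<Rightarrow> 'o \<Rightarrow> nat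
    \<Rightarrow> (gal \<Rightarrow> 'm) set \<times> (gal \<Rightarrow> 'm) set \<Rightarrow> (gal \<Rightarrow> 'm) set \<times> (gal \<Rightarrow> 'm) set" where
  "H_op p U M \<gamma> ap 0 v = v"
| "H_op p U M \<gamma> ap (Suc j) v = C_op p U M \<gamma> ap (Suc j) (H_op p U M \<gamma> ap j v)"

definition np_layer :: "int \<Rightarrow> nat \<Rightarrow> nat \<Rightarrow> nat \<Rightarrow> complex set" where
  "np_layer D p n k = ring_class_field D (n * p ^ Suc k)"

text \<open>The projection \<open>H\<^sup>1(K[np], M \<otimes> \<Lambda>\<^sup>\<iota>) \<rightarrow> H\<^sup>1(K[np^(k+1)], M)\<close> given by Shapiro's lemma.  It turns
  multiplication by \<open>1+X\<close> into the conjugation action of \<open>\<gamma>\<close>.\<close>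

definition level_proj :: "int \<Rightarrow> nat \<Rightarrow> nat \<Rightarrow> ('o::comm_ring_1, 'm) gmod \<Rightarrow> nat
    \<Rightarrow> (gal \<Rightarrow> nat \<Rightarrow> 'm) set \<Rightarrow> (gal \<Rightarrow> 'm) set" where
  "level_proj D p n M k = coset_map (Z1 (gal (np_layer D p n k)) M) (B1 (gal (np_layer D p n k)) M)
     (\<lambda>z. \<lambda>g\<in>gal (np_layer D p n k). level_coeff p M k (z g))"

text \<open>The pair of \<open>\<Lambda>\<close>-adic classes of Heegner points over \<open>K[np]\<close>.  The classes at level \<open>k\<close> are
  defined modulo \<open>ker H\<^sub>k\<close>, that is, they form the fibre of \<open>H\<^sub>k\<close> over the given
  pair; the \<open>\<Lambda>\<close>-adic pair is the one projecting into these fibres for all \<open>k \<ge> 1\<close>.  \<open>\<delta>\<close> is a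
  lift of the generator of \<open>Gal(K[np\<^sup>\<infinity>]/K[np])\<close>.\<close>

definition signed_pair :: "int \<Rightarrow> nat \<Rightarrow> 'o::comm_ring_1 \<Rightarrow> 'o \<Rightarrow> ('o, 'm) gmod
    \<Rightarrow> (nat \<Rightarrow> (gal \<Rightarrow> 'm) set) \<Rightarrow> nat \<Rightarrow> gal \<Rightarrow> (signed \<Rightarrow> (gal \<Rightarrow> nat \<Rightarrow> 'm) set) \<Rightarrow> bool" where
  "signed_pair D p w ap T P n \<delta> X \<longleftrightarrow>
     zp_tower p (gal (ring_class_field D (n * p))) (np_layer D p n) \<delta>
     \<and> (\<forall>s. X s \<in> carrier (H1 (gal (ring_class_field D (n * p))) (iwasawa w (np_layer D p n) \<delta> T)))
     \<and> (\<forall>k\<ge>1. let U = gal (np_layer D p n k) in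
          H_op p U T \<delta> ap k (level_proj D p n T k (X Sharp), level_proj D p n T k (X Flat))
            = (P (n * p ^ Suc k), inv\<^bsub>H1 U T\<^esub> (H1_res U T (P (n * p ^ k)))))"

text \<open>\<open>rho l\<close> lifts the generator of \<open>G(l)\<close>, viewed in \<open>G(n)\<close> as the factor acting trivially on
  \<open>K[n/l]\<close>.\<close>

definition ring_class_generator :: "int \<Rightarrow> nat \<Rightarrow> (nat \<Rightarrow> gal) \<Rightarrow> bool" where
  "ring_class_generator D n rho \<longleftrightarrow> (\<forall>l\<in>prime_factors n.
     rho l \<in> gal (ring_class_field D (n div l)) \<inter> gal (ring_class_field D 1) \<and>
     (\<forall>g\<in>gal (ring_class_field D 1). \<exists>j. agree (ring_class_field D l) g (rho l ^^ j)))"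

definition kol_derivative :: "gal set \<Rightarrow> ('r, 'm) gmod \<Rightarrow> nat \<Rightarrow> (nat \<Rightarrow> gal) \<Rightarrow> (gal \<Rightarrow> 'm) set \<Rightarrow> (gal \<Rightarrow> 'm) set" where
  "kol_derivative U M n rho x = foldr
     (\<lambda>l c. finprod (H1 U M) (\<lambda>j. H1_conj U M (rho l ^^ j) c [^]\<^bsub>H1 U M\<^esub> j) {1..l})
     (sorted_list_of_set (prime_factors n)) x"

definition coset_reps :: "gal set \<Rightarrow> gal set \<Rightarrow> gal set \<Rightarrow> bool" where
  "coset_reps G U S \<longleftrightarrow> finite S \<and> S \<subseteq> G \<and> (\<forall>g\<in>G. \<exists>!s. s \<in> S \<and> ginv s \<circ> g \<in> U)"

text \<open>\<open>\<kappa>\<close> is the class \<open>\<kappa>\<^sub>n\<close> of the given sign in \<open>H\<^sup>1(K, \<T>/I\<^sub>n\<T>)\<close>, built from a pair \<open>X\<close> as above, from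
  generators \<open>rho l\<close> and from representatives \<open>S\<close> of \<open>\<G>(n)/G(n)\<close>.  Since \<open>\<delta>\<close> maps to the group-like
  element \<open>iw_char w L \<gamma> \<delta>\<close> of \<open>\<Lambda>\<close>, the map \<open>\<O>[[\<Gamma>^(np)]] \<rightarrow> \<Lambda>\<close> substitutes \<open>iw_char w L \<gamma> \<delta> - 1\<close> for \<open>X\<close>.\<close>

definition signed_kolyvagin_class :: "int \<Rightarrow> nat \<Rightarrow> 'o::comm_ring_1 \<Rightarrow> 'o \<Rightarrow> ('o, 'm) gmod
    \<Rightarrow> (nat \<Rightarrow> (gal \<Rightarrow> 'm) set) \<Rightarrow> (nat \<Rightarrow> complex set) \<Rightarrow> gal \<Rightarrow> nat \<Rightarrow> 'o set
    \<Rightarrow> gal \<Rightarrow> (signed \<Rightarrow> (gal \<Rightarrow> nat \<Rightarrow> 'm) set) \<Rightarrow> (nat \<Rightarrow> gal) \<Rightarrow> gal set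
    \<Rightarrow> signed \<Rightarrow> (gal \<Rightarrow> (nat \<Rightarrow> 'm) set) set \<Rightarrow> bool" where
  "signed_kolyvagin_class D p w ap T P L \<gamma> n I \<delta> X rho S s \<kappa> \<longleftrightarrow>
     signed_pair D p w ap T P n \<delta> X
     \<and> ring_class_generator D n rho
     \<and> coset_reps (gal (quad_field D)) (gal (ring_class_field D 1)) S
     \<and> (let TT = iwasawa w L \<gamma> T;
            J = ideal_mult I TT;
            U = gal (ring_class_field D n);
            V = gal (ring_class_field D (n * p));
            Pn = H1_cores V U TT (H1_map V TT (ser_subst T (iw_char w L \<gamma> \<delta> - 1)) (X s));
            \<kappa>' = finprod (H1 U TT) (\<lambda>\<sigma>. H1_conj U TT \<sigma> (kol_derivative U TT n rho Pn)) S
        in \<kappa> \<in> carrier (H1 (gal (quad_field D)) (quot_gmod TT J))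
           \<and> H1_res U (quot_gmod TT J) \<kappa> = H1_map U (quot_gmod TT J) (\<lambda>x. J #>\<^bsub>TT\<^esub> x) \<kappa>')"

text \<open>\<open>H\<^sup>1(K, T\<^sub>\<alpha>/I T\<^sub>\<alpha>)\<close> and the map \<open>\<pi>\<^sub>\<alpha>\<close> to it, induced by the specialization \<open>\<T> \<rightarrow> T\<^sub>\<alpha>\<close>,
  \<open>\<gamma> \<mapsto> \<alpha>\<^sup>-\<^sup>1(\<gamma>)\<close>.\<close>

definition twist_quot :: "('o, 'm) gmod \<Rightarrow> 'o set \<Rightarrow> (gal \<Rightarrow> 'o) \<Rightarrow> ('o, 'm set) gmod" where
  "twist_quot T I \<alpha> = quot_gmod (twist T \<alpha>) (ideal_mult I (twist T \<alpha>))"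

definition specialize :: "int \<Rightarrow> gal \<Rightarrow> ('o::comm_ring_1, 'm) gmod \<Rightarrow> 'o set \<Rightarrow> (gal \<Rightarrow> 'o)
    \<Rightarrow> (gal \<Rightarrow> (nat \<Rightarrow> 'm) set) set \<Rightarrow> (gal \<Rightarrow> 'm set) set" where
  "specialize D \<gamma> T I \<alpha> = H1_map (gal (quad_field D)) (twist_quot T I \<alpha>)
     (coset_map (twist T \<alpha>) (ideal_mult I (twist T \<alpha>)) (ser_eval T (\<alpha> (ginv \<gamma>) - 1)))"


section \<open>The arithmetic setting\<close>

definition heegner_levels :: "int \<Rightarrow> nat \<Rightarrow> nat \<Rightarrow> nat \<Rightarrow> nat \<Rightarrow> bool" where
  "heegner_levels D p N Np Nm \<longleftrightarrow> imag_quad_disc D \<and> prime p \<and> p \<ge> 5 \<and> \<not> ramified_in D p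
     \<and> N > 0 \<and> \<not> p dvd N \<and> coprime (int N) D \<and> N = Np * Nm
     \<and> (\<forall>q\<in>prime_factors Np. split_in D q) \<and> (\<forall>q\<in>prime_factors Nm. inert_in D q)
     \<and> squarefree Nm \<and> even (card (prime_factors Nm))"

text \<open>Good reduction at \<open>p\<close> of the attached variety holds because \<open>p\<close> does not divide the level;
  it is non-ordinary by the divisibility of \<open>a\<^sub>p\<close>.\<close>

definition nonordinary_heegner_setting :: "int \<Rightarrow> nat \<Rightarrow> nat \<Rightarrow> nat \<Rightarrow> nat \<Rightarrow> (complex \<Rightarrow> complex)
    \<Rightarrow> (nat \<Rightarrow> complex) \<Rightarrow> 'o::{idom,ring_char_0} \<Rightarrow> (complex \<Rightarrow> 'o) \<Rightarrow> nat \<Rightarrow> pt monoid \<Rightarrow> ((pt \<Rightarrow> pt) \<Rightarrow> 'o) \<Rightarrow> bool" where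
  "nonordinary_heegner_setting D p N Np Nm f a w emb d A e \<longleftrightarrow>
     heegner_levels D p N Np Nm \<and> newform2 N f a \<and> local_hecke_field p a w emb
     \<and> attached_GL2_variety p N a emb d A e
     \<and> w dvd emb (a p)
     \<and> (inert_in D p \<longrightarrow> proj_curve d (carrier A) \<and> a p = 0)"

end

theory Submission
  imports Defs "HOL-Library.Function_Algebras"
begin

text \<open>Choosing a basis of \<open>T\<close>, an element of \<open>\<T>\<close> is a power series with coefficients in \<open>\<O>\<^sup>2\<close>, and
  \<open>I\<^sub>n = c\<O>\<close> is principal.  Represent \<open>\<kappa>\<close> by a cocycle \<open>z\<close>.  At the trivial character the
  specialization map takes the constant coefficient, so the vanishing of \<open>\<kappa>(1)\<close> says that modulo \<open>c\<close>
  this coefficient is the coboundary of some \<open>t \<in> T\<close>.  Subtracting the coboundary of the constant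
  series \<open>t\<close> leaves a cocycle \<open>X y\<close>, and \<open>y\<close> is again a continuous cocycle since \<open>X\<close> is injective
  modulo \<open>c\<close>.  As \<open>X = \<gamma> - 1\<close> specializes to \<open>\<alpha>\<^sup>-\<^sup>1(\<gamma>) - 1 \<in> w\<^sup>m\<O>\<close>, the class \<open>\<kappa>(\<alpha>)\<close> is a multiple of
  \<open>w\<^sup>m\<close> times the class of the specialization of \<open>y\<close>.\<close>

section \<open>Continuous cohomology of a quotient module through lifts\<close>

text \<open>A class in the cohomology of \<open>quot_gmod\<close> is a set of functions into cosets
  of sequences of points, a form in which shifting coefficients is clumsy. Hence every module gets
  coordinates in an additive type, and a cocycle of a quotient is handled through an arbitrary lift
  to coordinates that satisfies continuity and the cocycle identity only modulo the submodule.
  Subtracting a coboundary and dividing by X are then operations on plain functions. Two points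
  govern the rest. The action on \<Lambda>^\<iota> multiplies by the group-like series of g^-1,
  whose coefficients are limits of binomial coefficients; at X = \<alpha>(\<gamma>^-1) - 1 this
  series takes the value \<alpha>(g), which is why specialization lands in the twist by \<alpha>.
  And the coordinates of the Tate module must be shown to carry a linear continuous Galois action,
  although an element of \<open>gal\<close> respects the field operations on algebraic numbers only;
  everything about the abelian variety is therefore done on points with algebraic
  coordinates.\<close>

lemma openin_finite_agreement:
  fixes S :: "('a \<Rightarrow> 'b) set"
  shows "openin (subtopology (product_topology (\<lambda>_. discrete_topology UNIV) UNIV) S) V \<longleftrightarrow>
    V \<subseteq> S \<and> (\<forall>x\<in>V. \<exists>F. finite F \<and> (\<forall>y\<in>S. (\<forall>i\<in>F. y i = x i) \<longrightarrow> y \<in> V))"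
    (is "?L \<longleftrightarrow> ?R")
proof
  assume ?L
  then obtain W where W: "openin (product_topology (\<lambda>_. discrete_topology UNIV) UNIV) W" "V = W \<inter> S"
    by (auto simp: openin_subtopology)
  have "\<exists>F. finite F \<and> (\<forall>y\<in>S. (\<forall>i\<in>F. y i = x i) \<longrightarrow> y \<in> V)" if "x \<in> V" for x
  proof -
    from that W obtain U where U: "finite {i. U i \<noteq> (UNIV :: 'b set)}" "x \<in> Pi\<^sub>E UNIV U" "Pi\<^sub>E UNIV U \<subseteq> W"
      by (auto simp: openin_product_topology_alt)
    have "y \<in> V" if "y \<in> S" "\<forall>i\<in>{i. U i \<noteq> UNIV}. y i = x i" for y
    proof -
      have "y i \<in> U i" for i
        using that U(2) by (cases "U i = UNIV") (auto simp: PiE_iff)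
      then show ?thesis using U(3) W that by (auto simp: PiE_iff)
    qed
    with U(1) show ?thesis by blast
  qed
  with W show ?R by auto
next
  assume R: ?R
  have "\<exists>W. openin (product_topology (\<lambda>_. discrete_topology UNIV) UNIV) W \<and> x \<in> W \<and> W \<inter> S \<subseteq> V" if "x \<in> V" for x
  proof -
    obtain F where F: "finite F" "\<And>y. y \<in> S \<Longrightarrow> \<forall>i\<in>F. y i = x i \<Longrightarrow> y \<in> V"
      using bspec[OF conjunct2[OF R] \<open>x \<in> V\<close>] by metis
    have sub: "{i. i \<in> F} \<supseteq> {i \<in> UNIV. (if i \<in> F then {x i} else UNIV) \<noteq> topspace (discrete_topology (UNIV::'b set))}"
      by auto
    then have "openin (product_topology (\<lambda>_. discrete_topology UNIV) UNIV) (Pi\<^sub>E UNIV (\<lambda>i. if i \<in> F then {x i} else UNIV))"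
      using F(1) by (intro product_topology_basis) (auto intro: finite_subset)
    then show ?thesis
    proof (intro exI conjI)
      show "Pi\<^sub>E UNIV (\<lambda>i. if i \<in> F then {x i} else UNIV) \<inter> S \<subseteq> V"
      proof
        fix y assume y: "y \<in> Pi\<^sub>E UNIV (\<lambda>i. if i \<in> F then {x i} else UNIV) \<inter> S"
        then have "y i \<in> (if i \<in> F then {x i} else UNIV)" for i by (simp add: PiE_iff)
        then have "\<forall>i\<in>F. y i = x i" by (metis singletonD)
        with y F(2) show "y \<in> V" by simp
      qed
    qed (simp_all add: PiE_iff)
  qed
  then obtain W where W: "\<And>x. x \<in> V \<Longrightarrow> openin (product_topology (\<lambda>_. discrete_topology UNIV) UNIV) (W x) \<and> x \<in> W x \<and> W x \<inter> S \<subseteq> V"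
    by metis
  have "V = (\<Union>x\<in>V. W x) \<inter> S" using W R by blast
  moreover have "openin (product_topology (\<lambda>_. discrete_topology UNIV) UNIV) (\<Union>x\<in>V. W x)"
    using W by blast
  ultimately show ?L by (auto simp: openin_subtopology)
qed

lemma openin_krull:
  "openin (krull G) V \<longleftrightarrow> V \<subseteq> G \<and>
     (\<forall>g\<in>V. \<exists>F. finite F \<and> (\<forall>h\<in>G. agree F h g \<longrightarrow> h \<in> V))"
  unfolding krull_def agree_def by (rule openin_finite_agreement)

lemma topspace_krull [simp]: "topspace (krull G) = G"
  unfolding krull_def by (simp add: PiE_UNIV_domain)

text \<open>\<open>quotient_top\<close> applies \<open>topology\<close> to a bare predicate, so
  nothing can be said about its open sets until that predicate is shown to be a topology.
  Disjointness of the cosets enters for intersections: it makes the union of the common part equal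
  to the intersection of the unions.\<close>

lemma openin_quotient_top:
  "openin (quotient_top X Q) U \<longleftrightarrow> U \<subseteq> Q \<and> openin X (\<Union>U)" if "\<And>A B. A \<in> Q \<Longrightarrow> B \<in> Q \<Longrightarrow> A \<noteq> B \<Longrightarrow> A \<inter> B = {}"
proof -
  have "istopology (\<lambda>U. U \<subseteq> Q \<and> openin X (\<Union>U))"
    unfolding istopology_def
  proof (intro conjI allI impI)
    fix S T assume S: "S \<subseteq> Q \<and> openin X (\<Union>S)" and T: "T \<subseteq> Q \<and> openin X (\<Union>T)"
    have "\<Union>(S \<inter> T) = \<Union>S \<inter> \<Union>T"
    proof
      show "\<Union>S \<inter> \<Union>T \<subseteq> \<Union>(S \<inter> T)"
      proof
        fix x assume "x \<in> \<Union>S \<inter> \<Union>T"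
        then obtain A B where "A \<in> S" "B \<in> T" "x \<in> A" "x \<in> B" by blast
        moreover from this have "A = B" using that[of A B] S T by blast
        ultimately show "x \<in> \<Union>(S \<inter> T)" by blast
      qed
    qed auto
    with S T show "openin X (\<Union>(S \<inter> T))" by auto
    show "S \<inter> T \<subseteq> Q" using S by blast
  next
    fix \<K> assume K: "\<forall>U\<in>\<K>. U \<subseteq> Q \<and> openin X (\<Union>U)"
    then show "\<Union>\<K> \<subseteq> Q" by blast
    have "\<Union>(\<Union>\<K>) = (\<Union>U\<in>\<K>. \<Union>U)" by blast
    with K show "openin X (\<Union>(\<Union>\<K>))" by auto
  qed
  then show ?thesis unfolding quotient_top_def by (simp add: topology_inverse')
qed

lemma continuous_map_krull:
  "continuous_map (krull G) Y z \<longleftrightarrow> (\<forall>g\<in>G. z g \<in> topspace Y) \<and>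
     (\<forall>U. openin Y U \<longrightarrow> (\<forall>g\<in>G. z g \<in> U \<longrightarrow>
        (\<exists>F. finite F \<and> (\<forall>h\<in>G. agree F h g \<longrightarrow> z h \<in> U))))"
  unfolding continuous_map by (auto simp: openin_krull)

text \<open>Coordinates for a topological module: \<open>tt\<close> passes from an additive type to
  the multiplicatively written group, \<open>act\<close> and \<open>sc\<close> are the transported
  actions, and the \<open>Fil j\<close> serve as a neighbourhood base of 0. T, its twists and the
  Iwasawa module all fit this interface, so cohomology is treated once.\<close>

locale gmod_model =
  fixes M :: "('r, 'm) gmod" and tt :: "'v::ab_group_add \<Rightarrow> 'm" and Fil :: "nat \<Rightarrow> 'v set"
    and act :: "gal \<Rightarrow> 'v \<Rightarrow> 'v" and sc :: "'r \<Rightarrow> 'v \<Rightarrow> 'v" and G :: "gal set"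
  assumes tt_bij: "bij_betw tt UNIV (carrier M)"
    and tt_add: "tt (u + v) = tt u \<otimes>\<^bsub>M\<^esub> tt v"
    and tt_zero: "\<one>\<^bsub>M\<^esub> = tt 0"
    and tt_act: "g \<in> G \<Longrightarrow> gact M g (tt v) = tt (act g v)"
    and tt_sc: "smul M r (tt v) = tt (sc r v)"
    and act_add: "g \<in> G \<Longrightarrow> act g (u + v) = act g u + act g v"
    and sc_add: "sc r (u + v) = sc r u + sc r v"
    and Fil_add: "u \<in> Fil j \<Longrightarrow> v \<in> Fil j \<Longrightarrow> u + v \<in> Fil j"
    and Fil_zero: "0 \<in> Fil j"
    and Fil_minus: "u \<in> Fil j \<Longrightarrow> - u \<in> Fil j"
    and open_tt: "openin (mtop M) V \<longleftrightarrow> V \<subseteq> carrier M \<and> (\<forall>v. tt v \<in> V \<longrightarrow> (\<exists>j. \<forall>u\<in>Fil j. tt (v + u) \<in> V))"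
begin

lemma tt_inj: "tt u = tt v \<longleftrightarrow> u = v"
  using tt_bij by (auto simp: bij_betw_def inj_on_def)

lemma carrier_tt: "carrier M = range tt"
  using tt_bij by (auto simp: bij_betw_def)

lemma tt_in [simp]: "tt v \<in> carrier M"
  by (simp add: carrier_tt)

lemma act_zero: "g \<in> G \<Longrightarrow> act g 0 = 0"
  using act_add[of g 0 0] by simp

lemma act_minus: "g \<in> G \<Longrightarrow> act g (- u) = - act g u"
  using act_add[of g u "- u"] act_zero by (simp add: eq_neg_iff_add_eq_0 add.commute)

lemma act_diff: "g \<in> G \<Longrightarrow> act g (u - v) = act g u - act g v"
  using act_add[of g u "- v"] act_minus by simp

lemma sc_zero: "sc r 0 = 0"
  using sc_add[of r 0 0] by simp

lemma sc_minus: "sc r (- u) = - sc r u"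
  using sc_add[of r u "- u"] sc_zero by (simp add: eq_neg_iff_add_eq_0 add.commute)

lemma sc_diff: "sc r (u - v) = sc r u - sc r v"
  using sc_add[of r u "- v"] sc_minus by simp

lemma comm_group_M: "comm_group M"
proof (rule comm_groupI)
  fix x y z assume "x \<in> carrier M" "y \<in> carrier M" "z \<in> carrier M"
  then obtain u v s where [simp]: "x = tt u" "y = tt v" "z = tt s" by (auto simp: carrier_tt)
  show "x \<otimes>\<^bsub>M\<^esub> y \<in> carrier M" "\<one>\<^bsub>M\<^esub> \<otimes>\<^bsub>M\<^esub> x = x"
    "x \<otimes>\<^bsub>M\<^esub> y \<otimes>\<^bsub>M\<^esub> z = x \<otimes>\<^bsub>M\<^esub> (y \<otimes>\<^bsub>M\<^esub> z)" "x \<otimes>\<^bsub>M\<^esub> y = y \<otimes>\<^bsub>M\<^esub> x"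
    by (simp_all flip: tt_add add: tt_zero algebra_simps)
  show "\<exists>y\<in>carrier M. y \<otimes>\<^bsub>M\<^esub> x = \<one>\<^bsub>M\<^esub>"
    by (rule bexI[of _ "tt (- u)"]) (simp_all flip: tt_add add: tt_zero)
qed (simp add: tt_zero)

lemma inv_tt: "inv\<^bsub>M\<^esub> (tt v) = tt (- v)"
proof -
  interpret comm_group M by (rule comm_group_M)
  show ?thesis by (rule inv_equality) (simp_all flip: tt_add add: tt_zero)
qed

lemma finprod_tt: "finite A \<Longrightarrow> finprod M (\<lambda>i. tt (f i)) A = tt (sum f A)"
proof (induction A rule: finite_induct)
  case empty
  interpret comm_group M by (rule comm_group_M)
  show ?case by (simp add: tt_zero)
next
  case (insert x A)
  interpret comm_group M by (rule comm_group_M)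
  show ?case using insert by (subst finprod_insert) (auto simp: tt_add)
qed

text \<open>\<open>ideal_mult\<close> is the subgroup generated by products. When the products
  already form a group, as they do for a principal ideal, generation adds nothing and the submodule
  is known exactly.\<close>

lemma ideal_mult_tt:
  assumes "K = {sc r v | r v. r \<in> I}" and "0 \<in> K"
    and "\<And>u v. u \<in> K \<Longrightarrow> v \<in> K \<Longrightarrow> u + v \<in> K" and "\<And>u. u \<in> K \<Longrightarrow> - u \<in> K"
  shows "ideal_mult I M = tt ` K"
proof -
  interpret comm_group M by (rule comm_group_M)
  have 1: "{smul M r x |r x. r \<in> I \<and> x \<in> carrier M} = tt ` K"
  proof (intro equalityI subsetI)
    fix y assume "y \<in> {smul M r x |r x. r \<in> I \<and> x \<in> carrier M}"
    then obtain r v where "r \<in> I" "y = tt (sc r v)" by (auto simp: carrier_tt tt_sc)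
    then show "y \<in> tt ` K" unfolding assms(1) by blast
  next
    fix y assume "y \<in> tt ` K"
    then obtain r v where "r \<in> I" "y = smul M r (tt v)" by (auto simp: assms(1) tt_sc)
    then show "y \<in> {smul M r x |r x. r \<in> I \<and> x \<in> carrier M}" using tt_in by blast
  qed
  have "subgroup (tt ` K) M"
    by (rule subgroupI) (use assms(2-) in \<open>auto simp: inv_tt simp flip: tt_add\<close>)
  then show ?thesis unfolding ideal_mult_def 1
    using generate_subgroup_incl[of "tt ` K" "tt ` K"] generate.incl[of _ "tt ` K" M] by blast
qed

lemma twist_model:
  assumes "\<And>g. g \<in> G \<Longrightarrow> act' g = (\<lambda>v. sc (\<alpha> g) (act g v))"
  shows "gmod_model (twist M \<alpha>) tt Fil act' sc G"
proof -
  have *: "mtop (twist M \<alpha>) = mtop M" "carrier (twist M \<alpha>) = carrier M" "smul (twist M \<alpha>) = smul M"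
    "mult (twist M \<alpha>) = mult M" "one (twist M \<alpha>) = one M"
    "gact (twist M \<alpha>) = (\<lambda>g x. smul M (\<alpha> g) (gact M g x))"
    by (simp_all add: twist_def)
  show ?thesis
    by (rule gmod_model.intro)
      (simp_all add: * assms tt_bij tt_add tt_zero tt_act tt_sc act_add sc_add Fil_add Fil_zero Fil_minus open_tt)
qed

end

locale gmod_quot_model = gmod_model M tt Fil act sc G
  for M :: "('r, 'm) gmod" and tt :: "'v::ab_group_add \<Rightarrow> 'm" and Fil :: "nat \<Rightarrow> 'v set"
    and act :: "gal \<Rightarrow> 'v \<Rightarrow> 'v" and sc :: "'r \<Rightarrow> 'v \<Rightarrow> 'v" and G :: "gal set" +
  fixes K :: "'v set" and N :: "'m set"
  assumes N: "N = tt ` K"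
    and K_add: "u \<in> K \<Longrightarrow> v \<in> K \<Longrightarrow> u + v \<in> K"
    and K_zero: "0 \<in> K"
    and K_minus: "u \<in> K \<Longrightarrow> - u \<in> K"
    and K_act: "g \<in> G \<Longrightarrow> u \<in> K \<Longrightarrow> act g u \<in> K"
    and K_sc: "u \<in> K \<Longrightarrow> sc r u \<in> K"
begin

definition cls :: "'v \<Rightarrow> 'm set" where
  "cls v = tt ` {u. u - v \<in> K}"

lemma K_diff: "u \<in> K \<Longrightarrow> v \<in> K \<Longrightarrow> u - v \<in> K"
  using K_add[of u "- v"] K_minus by simp

lemma tt_in_cls [simp]: "tt u \<in> cls v \<longleftrightarrow> u - v \<in> K"
  by (auto simp: cls_def tt_inj)

lemma cls_eq: "cls u = cls v \<longleftrightarrow> u - v \<in> K"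
proof
  assume "cls u = cls v"
  then have "tt u \<in> cls v" using K_zero by (auto simp flip: \<open>cls u = cls v\<close>)
  then show "u - v \<in> K" by simp
next
  assume a: "u - v \<in> K"
  have "s - u \<in> K \<longleftrightarrow> s - v \<in> K" for s
    using K_add[OF _ a, of "s - u"] K_diff[OF _ a, of "s - v"] by (auto simp: algebra_simps)
  then show "cls u = cls v" by (auto simp: cls_def)
qed

lemma coset_tt: "N #>\<^bsub>M\<^esub> tt v = cls v"
proof -
  have "N #>\<^bsub>M\<^esub> tt v = (\<lambda>u. tt (u + v)) ` K"
    by (auto simp: r_coset_def N tt_add)
  also have "\<dots> = cls v"
  proof (intro equalityI subsetI)
    fix x assume "x \<in> cls v"
    then obtain u where "x = tt ((u - v) + v)" "u - v \<in> K" by (auto simp: cls_def)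
    then show "x \<in> (\<lambda>u. tt (u + v)) ` K" by blast
  qed auto
  finally show ?thesis .
qed

lemma carrier_quot: "carrier (quot_gmod M N) = range cls"
  by (auto simp: quot_gmod_def FactGroup_def RCOSETS_def carrier_tt coset_tt)

lemma one_quot: "\<one>\<^bsub>quot_gmod M N\<^esub> = cls 0"
  by (simp add: quot_gmod_def FactGroup_def N cls_def)

lemma mult_quot: "cls u \<otimes>\<^bsub>quot_gmod M N\<^esub> cls v = cls (u + v)"
proof -
  have "cls u <#>\<^bsub>M\<^esub> cls v = (\<Union>s\<in>{s. s - u \<in> K}. \<Union>t\<in>{t. t - v \<in> K}. {tt (s + t)})"
    by (auto simp: set_mult_def cls_def tt_add)
  also have "\<dots> = cls (u + v)"
  proof (intro equalityI subsetI)
    fix x assume "x \<in> cls (u + v)"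
    then obtain s where s: "x = tt s" "s - (u + v) \<in> K" by (auto simp: cls_def)
    then show "x \<in> (\<Union>s\<in>{s. s - u \<in> K}. \<Union>t\<in>{t. t - v \<in> K}. {tt (s + t)})"
      by (intro UN_I[of "s - v"] UN_I[of v]) (auto simp: K_zero algebra_simps)
  next
    fix x assume "x \<in> (\<Union>s\<in>{s. s - u \<in> K}. \<Union>t\<in>{t. t - v \<in> K}. {tt (s + t)})"
    then obtain s t where s: "x = tt (s + t)" "s - u \<in> K" "t - v \<in> K" by auto
    then show "x \<in> cls (u + v)" using K_add[OF s(2,3)] by (simp add: algebra_simps)
  qed
  finally show ?thesis by (simp add: quot_gmod_def FactGroup_def)
qed

text \<open>\<open>coset_map\<close> takes the union of the target cosets over all representatives.
  They coincide because \<open>f'\<close> respects differences and carries \<open>K\<close> into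
  \<open>K2\<close>, so the union is a single coset.\<close>

lemma coset_map_cls:
  fixes M2 :: "('r, 'm2) gmod"
  assumes "gmod_quot_model M2 tt2 Fil2 act2 sc2 G K2 N2"
    and f: "\<And>v. f (tt v) = tt2 (f' v)" and f': "\<And>u v. f' (u - v) = f' u - f' v" "\<And>u. u \<in> K \<Longrightarrow> f' u \<in> K2"
  shows "coset_map M2 N2 f (cls v) = gmod_quot_model.cls tt2 K2 (f' v)"
proof -
  interpret Q: gmod_quot_model M2 tt2 Fil2 act2 sc2 G K2 N2 by fact
  have "coset_map M2 N2 f (cls v) = (\<Union>u\<in>{u. u - v \<in> K}. Q.cls (f' u))"
    by (auto simp: coset_map_def cls_def f Q.coset_tt)
  also have "\<dots> = (\<Union>u\<in>{u. u - v \<in> K}. Q.cls (f' v))"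
    by (intro SUP_cong refl) (use f' in \<open>auto simp: Q.cls_eq simp flip: f'(1)\<close>)
  also have "\<dots> = Q.cls (f' v)" proof -
    have "v \<in> {u. u - v \<in> K}" by (simp add: K_zero)
    then show ?thesis by blast
  qed
  finally show ?thesis .
qed

lemma gact_quot: "g \<in> G \<Longrightarrow> gact (quot_gmod M N) g (cls v) = cls (act g v)"
  using coset_map_cls[OF gmod_quot_model_axioms, of "gact M g" "act g"]
  by (simp add: quot_gmod_def tt_act act_diff K_act)

lemma smul_quot: "smul (quot_gmod M N) r (cls v) = cls (sc r v)"
  using coset_map_cls[OF gmod_quot_model_axioms, of "smul M r" "sc r"]
  by (simp add: quot_gmod_def tt_sc sc_diff K_sc)

lemma inv_quot: "inv\<^bsub>quot_gmod M N\<^esub> (cls v) = cls (- v)"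
proof -
  have "comm_group (quot_gmod M N)"
  proof (rule comm_groupI, goal_cases)
    case (6 x)
    then obtain u where "x = cls u" by (auto simp: carrier_quot)
    then show ?case by (intro bexI[of _ "cls (- u)"]) (auto simp: carrier_quot mult_quot one_quot)
  qed (auto simp: carrier_quot mult_quot one_quot algebra_simps)
  then interpret comm_group "quot_gmod M N" .
  show ?thesis by (rule inv_equality) (auto simp: mult_quot one_quot carrier_quot)
qed

lemma cls_disjoint: "A \<in> range cls \<Longrightarrow> B \<in> range cls \<Longrightarrow> A \<noteq> B \<Longrightarrow> A \<inter> B = {}"
proof (rule ccontr)
  assume A: "A \<in> range cls" "B \<in> range cls" "A \<noteq> B" "A \<inter> B \<noteq> {}"
  then obtain a b where [simp]: "A = cls a" "B = cls b" by blast
  from A obtain u where "tt u \<in> A" "tt u \<in> B" by (auto simp: cls_def)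
  then have "cls u = cls a" "cls u = cls b" by (auto simp: cls_eq)
  with A show False by simp
qed

text \<open>The union of a set of cosets contains all or nothing of each coset, so the openness test
  on points of \<open>M\<close> becomes a test on classes.\<close>

lemma open_quot:
  "openin (mtop (quot_gmod M N)) U \<longleftrightarrow> U \<subseteq> range cls \<and>
     (\<forall>v. cls v \<in> U \<longrightarrow> (\<exists>j. \<forall>u\<in>Fil j. cls (v + u) \<in> U))"
proof -
  have 1: "openin (mtop (quot_gmod M N)) U \<longleftrightarrow> U \<subseteq> range cls \<and> openin (mtop M) (\<Union>U)"
    using carrier_quot openin_quotient_top[of "range cls" "mtop M" U, OF cls_disjoint]
    by (simp add: quot_gmod_def)
  have 2: "tt v \<in> \<Union>U \<longleftrightarrow> cls v \<in> U" if "U \<subseteq> range cls" for v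
  proof
    assume "tt v \<in> \<Union>U"
    then obtain A where "A \<in> U" "tt v \<in> A" by blast
    with that obtain u where "A = cls u" by blast
    with \<open>tt v \<in> A\<close> have "cls v = A" by (simp add: cls_eq)
    with \<open>A \<in> U\<close> show "cls v \<in> U" by simp
  next
    assume "cls v \<in> U"
    moreover have "tt v \<in> cls v" by (simp add: K_zero)
    ultimately show "tt v \<in> \<Union>U" by blast
  qed
  have 3: "\<Union>U \<subseteq> carrier M" if "U \<subseteq> range cls"
    using that by (fastforce simp: cls_def)
  show ?thesis unfolding 1 open_tt using 2 3 by (metis (no_types, lifting))
qed

text \<open>Continuity into the quotient sees a lift only modulo \<open>K\<close>: for each
  \<open>j\<close> the lift must be locally constant modulo \<open>Fil j\<close> together with
  \<open>K\<close>. Inside \<open>K\<close> it may jump arbitrarily.\<close>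

lemma continuous_cls:
  "continuous_map (krull G) (mtop (quot_gmod M N)) (\<lambda>g\<in>G. cls (z g)) \<longleftrightarrow>
     (\<forall>g\<in>G. \<forall>j. \<exists>F. finite F \<and> (\<forall>h\<in>G. agree F h g \<longrightarrow> (\<exists>u\<in>Fil j. z h - z g - u \<in> K)))"
    (is "?L \<longleftrightarrow> ?R")
proof -
  have ts: "topspace (mtop (quot_gmod M N)) = range cls"
  proof -
    have "openin (mtop (quot_gmod M N)) (range cls)" unfolding open_quot by simp
    moreover have "U \<subseteq> range cls" if "openin (mtop (quot_gmod M N)) U" for U
      using that unfolding open_quot by simp
    ultimately show ?thesis
      by (meson openin_subset openin_topspace subset_antisym)
  qed
  show ?thesis
  proof
    assume L: ?L
    show ?R
    proof (intro ballI allI)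
      fix g j assume g: "g \<in> G"
      let ?U = "cls ` ((\<lambda>u. z g + u) ` Fil j)"
      have "openin (mtop (quot_gmod M N)) ?U"
        unfolding open_quot
      proof (intro conjI allI impI)
        fix v assume "cls v \<in> ?U"
        then obtain u where u: "u \<in> Fil j" "v - (z g + u) \<in> K" by (auto simp: cls_eq)
        have "cls (v + s) \<in> ?U" if "s \<in> Fil j" for s
        proof -
          have "cls (v + s) = cls (z g + (u + s))" using u by (simp add: cls_eq algebra_simps)
          then show ?thesis using Fil_add[OF u(1) that] by blast
        qed
        then show "\<exists>j. \<forall>u\<in>Fil j. cls (v + u) \<in> ?U" by blast
      qed auto
      moreover have "cls (z g) \<in> ?U" using Fil_zero[of j] by (force intro: image_eqI[of _ _ "z g"])
      ultimately obtain F where "finite F" "\<And>h. h \<in> G \<Longrightarrow> agree F h g \<Longrightarrow> cls (z h) \<in> ?U"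
      proof -
        have "\<exists>F. finite F \<and> (\<forall>h\<in>G. agree F h g \<longrightarrow> (\<lambda>g\<in>G. cls (z g)) h \<in> ?U)"
          using L g \<open>openin _ ?U\<close> \<open>cls (z g) \<in> ?U\<close> unfolding continuous_map_krull by simp
        then show ?thesis using that by auto
      qed
      moreover have "\<exists>u\<in>Fil j. z h - z g - u \<in> K" if "cls (z h) \<in> ?U" for h
        using that by (auto simp: cls_eq diff_diff_eq)
      ultimately show "\<exists>F. finite F \<and> (\<forall>h\<in>G. agree F h g \<longrightarrow> (\<exists>u\<in>Fil j. z h - z g - u \<in> K))"
        by blast
    qed
  next
    assume R: ?R
    show ?L unfolding continuous_map_krull
    proof (intro conjI ballI allI impI)
      fix g assume "g \<in> G"
      then show "(\<lambda>g\<in>G. cls (z g)) g \<in> topspace (mtop (quot_gmod M N))" by (simp add: ts)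
    next
      fix U g assume U: "openin (mtop (quot_gmod M N)) U" and g: "g \<in> G" "(\<lambda>g\<in>G. cls (z g)) g \<in> U"
      then have "cls (z g) \<in> U" by simp
      then obtain j where j: "\<And>u. u \<in> Fil j \<Longrightarrow> cls (z g + u) \<in> U"
        proof -
        have "\<exists>j. \<forall>u\<in>Fil j. cls (z g + u) \<in> U"
          using U \<open>cls (z g) \<in> U\<close> unfolding open_quot by simp
        then show ?thesis using that by metis
      qed
      from bspec[OF R g(1)] obtain F where F: "finite F" "\<And>h. h \<in> G \<Longrightarrow> agree F h g \<Longrightarrow> \<exists>u\<in>Fil j. z h - z g - u \<in> K" by metis
      have "cls (z h) \<in> U" if "h \<in> G" "agree F h g" for h
      proof -
        from F(2)[OF that] obtain u where u: "u \<in> Fil j" "z h - z g - u \<in> K" by blast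
        then have "cls (z h) = cls (z g + u)" by (simp add: cls_eq algebra_simps)
        with j[OF u(1)] show ?thesis by simp
      qed
      with F(1) show "\<exists>F. finite F \<and> (\<forall>h\<in>G. agree F h g \<longrightarrow> (\<lambda>g\<in>G. cls (z g)) h \<in> U)" by auto
    qed
  qed
qed

text \<open>A lift of a continuous cocycle of the quotient; as both conditions hold modulo
  \<open>K\<close>, \<open>z\<close> need not be a cocycle of \<open>M\<close>.\<close>

definition cocycle :: "(gal \<Rightarrow> 'v) \<Rightarrow> bool" where
  "cocycle z \<longleftrightarrow>
     (\<forall>g\<in>G. \<forall>j. \<exists>F. finite F \<and> (\<forall>h\<in>G. agree F h g \<longrightarrow> (\<exists>u\<in>Fil j. z h - z g - u \<in> K)))
     \<and> (\<forall>g\<in>G. \<forall>h\<in>G. z (g \<circ> h) - (z g + act g (z h)) \<in> K)"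

text \<open>The coset of \<open>z\<close> modulo coboundaries, which is how \<open>H1\<close>
  represents a class. It makes sense for any cochain, so identities between classes need no proof
  that the cochains are cocycles.\<close>

definition coh_class :: "(gal \<Rightarrow> 'v) \<Rightarrow> (gal \<Rightarrow> 'm set) set" where
  "coh_class z = (\<lambda>v. \<lambda>g\<in>G. cls (z g + (act g v - v))) ` UNIV"

lemma B1_quot: "B1 G (quot_gmod M N) = coh_class (\<lambda>_. 0)"
proof -
  have "(\<lambda>g\<in>G. gact (quot_gmod M N) g (cls v) \<otimes>\<^bsub>quot_gmod M N\<^esub> inv\<^bsub>quot_gmod M N\<^esub> (cls v))
      = (\<lambda>g\<in>G. cls (0 + (act g v - v)))" for v
    by (rule restrict_ext) (simp add: gact_quot inv_quot mult_quot)
  then have "(\<lambda>v. \<lambda>g\<in>G. gact (quot_gmod M N) g (cls v) \<otimes>\<^bsub>quot_gmod M N\<^esub> inv\<^bsub>quot_gmod M N\<^esub> (cls v)) ` UNIV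
      = coh_class (\<lambda>_. 0)" by (simp add: coh_class_def)
  then show ?thesis by (auto simp: B1_def carrier_quot)
qed

lemma coset_coh:
  "B1 G (quot_gmod M N) #>\<^bsub>Z1 G (quot_gmod M N)\<^esub> (\<lambda>g\<in>G. cls (z g)) = coh_class z"
proof -
  have "(\<lambda>g\<in>G. (\<lambda>g\<in>G. cls (0 + (act g v - v))) g \<otimes>\<^bsub>quot_gmod M N\<^esub> (\<lambda>g\<in>G. cls (z g)) g)
      = (\<lambda>g\<in>G. cls (z g + (act g v - v)))" for v
    by (rule restrict_ext) (simp add: mult_quot algebra_simps)
  then show ?thesis by (auto simp: r_coset_def B1_quot coh_class_def Z1_def)
qed

text \<open>Adding the coboundary of \<open>v\<close> merely reindexes the members of a class, s
  becoming s + v, and changes inside \<open>K\<close> are invisible.\<close>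

lemma coh_class_eqI:
  assumes "\<And>g. g \<in> G \<Longrightarrow> z g - z' g - (act g v - v) \<in> K"
  shows "coh_class z = coh_class z'"
proof -
  have 1: "(\<lambda>g\<in>G. cls (z g + (act g s - s))) = (\<lambda>g\<in>G. cls (z' g + (act g (s + v) - (s + v))))" for s
    by (rule restrict_ext) (use assms in \<open>auto simp: cls_eq act_add algebra_simps\<close>)
  show ?thesis unfolding coh_class_def
  proof (intro equalityI subsetI)
    fix x assume "x \<in> range (\<lambda>v. \<lambda>g\<in>G. cls (z' g + (act g v - v)))"
    then obtain s where "x = (\<lambda>g\<in>G. cls (z' g + (act g s - s)))" by blast
    then have "x = (\<lambda>g\<in>G. cls (z g + (act g (s - v) - (s - v))))" using 1[of "s - v"] by simp
    then show "x \<in> range (\<lambda>v. \<lambda>g\<in>G. cls (z g + (act g v - v)))" by blast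
  qed (use 1 in blast)
qed

text \<open>A cochain belongs to its own class, with the coboundary of 0 added. If that class is
  trivial, the cochain is therefore the coboundary of some \<open>v\<close> up to
  \<open>K\<close>.\<close>

lemma coh_class_eq_B1D:
  assumes "coh_class z = coh_class (\<lambda>_. 0)"
  obtains v where "\<And>g. g \<in> G \<Longrightarrow> z g - (act g v - v) \<in> K"
proof -
  have "(\<lambda>g\<in>G. cls (z g)) = (\<lambda>g\<in>G. cls (z g + (act g 0 - 0)))"
    by (rule restrict_ext) (simp add: act_zero)
  then have "(\<lambda>g\<in>G. cls (z g)) \<in> coh_class (\<lambda>_. 0)"
    unfolding assms[symmetric] coh_class_def by blast
  then obtain v where "(\<lambda>g\<in>G. cls (z g)) = (\<lambda>g\<in>G. cls (0 + (act g v - v)))"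
    by (auto simp: coh_class_def)
  then have "cls (z g) = cls (act g v - v)" if "g \<in> G" for g
    using that by (auto dest: fun_cong[of _ _ g])
  then show ?thesis using that by (auto simp: cls_eq)
qed

text \<open>Values in the quotient are lifted by choice, one group element at a time. No
  compatibility between the lifts is asked, because \<open>cocycle\<close> tests them modulo
  \<open>K\<close>.\<close>

lemma Z1_quot:
  "carrier (Z1 G (quot_gmod M N)) = {\<lambda>g\<in>G. cls (z g) | z. cocycle z}" if "\<And>g h. g \<in> G \<Longrightarrow> h \<in> G \<Longrightarrow> g \<circ> h \<in> G"
proof -
  have 1: "(\<lambda>g\<in>G. cls (z g)) \<in> carrier (Z1 G (quot_gmod M N)) \<longleftrightarrow> cocycle z" for z
    using that by (auto simp: Z1_def cocycle_def continuous_cls carrier_quot gact_quot mult_quot cls_eq)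
  show ?thesis
  proof (intro equalityI subsetI)
    fix x assume x: "x \<in> carrier (Z1 G (quot_gmod M N))"
    then have "\<forall>g\<in>G. \<exists>v. x g = cls v" "x \<in> extensional G" 
      by (auto simp: Z1_def carrier_quot PiE_iff image_iff)
    then obtain z where "\<forall>g\<in>G. x g = cls (z g)" by metis
    then have "x = (\<lambda>g\<in>G. cls (z g))"
      using \<open>x \<in> extensional G\<close> by (auto simp: extensional_def restrict_def fun_eq_iff)
    with x 1 show "x \<in> {\<lambda>g\<in>G. cls (z g) | z. cocycle z}" by auto
  qed (use 1 in auto)
qed

lemma H1_quot:
  "carrier (H1 G (quot_gmod M N)) = {coh_class z | z. cocycle z}" if "\<And>g h. g \<in> G \<Longrightarrow> h \<in> G \<Longrightarrow> g \<circ> h \<in> G"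
proof -
  have "carrier (H1 G (quot_gmod M N)) = (\<lambda>x. B1 G (quot_gmod M N) #>\<^bsub>Z1 G (quot_gmod M N)\<^esub> x) ` carrier (Z1 G (quot_gmod M N))"
    by (auto simp: H1_def FactGroup_def RCOSETS_def)
  also have "\<dots> = (\<lambda>z. B1 G (quot_gmod M N) #>\<^bsub>Z1 G (quot_gmod M N)\<^esub> (\<lambda>g\<in>G. cls (z g))) ` {z. cocycle z}"
    by (simp only: Z1_quot[OF that] setcompr_eq_image image_image)
  finally show ?thesis by (auto simp: coset_coh)
qed

lemma one_H1_quot: "\<one>\<^bsub>H1 G (quot_gmod M N)\<^esub> = coh_class (\<lambda>_. 0)"
  by (simp add: H1_def FactGroup_def B1_quot)

text \<open>The members of \<open>coh_class z\<close> differ by coboundaries, which an additive map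
  that is equivariant modulo \<open>K2\<close> sends to coboundaries modulo \<open>K2\<close>. Hence
  the union in \<open>coset_map\<close> is a union of copies of one class.\<close>

lemma H1_map_coh:
  fixes M2 :: "('s, 'm2) gmod"
  assumes "gmod_quot_model M2 tt2 Fil2 act2 sc2 G K2 N2"
    and F: "\<And>v. F (cls v) = gmod_quot_model.cls tt2 K2 (f v)"
    and f: "\<And>u v. f (u + v) = f u + f v"
    and eq: "\<And>g v. g \<in> G \<Longrightarrow> f (act g v) - act2 g (f v) \<in> K2"
  shows "H1_map G (quot_gmod M2 N2) F (coh_class z) = gmod_quot_model.coh_class tt2 act2 G K2 (\<lambda>g. f (z g))"
proof -
  interpret Q: gmod_quot_model M2 tt2 Fil2 act2 sc2 G K2 N2 by fact
  have f0: "f 0 = 0" using f[of 0 0] by simp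
  have fm: "f (- u) = - f u" for u using f[of u "- u"] f0 by (simp add: eq_neg_iff_add_eq_0 add.commute)
  have fd: "f (u - v) = f u - f v" for u v using f[of u "- v"] fm by simp
  have "H1_map G (quot_gmod M2 N2) F (coh_class z) =
     (\<Union>v. B1 G (quot_gmod M2 N2) #>\<^bsub>Z1 G (quot_gmod M2 N2)\<^esub> (\<lambda>g\<in>G. F ((\<lambda>g\<in>G. cls (z g + (act g v - v))) g)))"
    by (simp add: H1_map_def coset_map_def coh_class_def)
  also have "\<dots> = (\<Union>v::'v. Q.coh_class (\<lambda>g. f (z g)))"
  proof (intro SUP_cong refl)
    fix v
    have "(\<lambda>g\<in>G. F ((\<lambda>g\<in>G. cls (z g + (act g v - v))) g)) = (\<lambda>g\<in>G. Q.cls (f (z g + (act g v - v))))"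
      by (rule restrict_ext) (simp add: F)
    then have "B1 G (quot_gmod M2 N2) #>\<^bsub>Z1 G (quot_gmod M2 N2)\<^esub> (\<lambda>g\<in>G. F ((\<lambda>g\<in>G. cls (z g + (act g v - v))) g))
       = Q.coh_class (\<lambda>g. f (z g + (act g v - v)))" by (simp add: Q.coset_coh)
    also have "\<dots> = Q.coh_class (\<lambda>g. f (z g))"
      by (rule Q.coh_class_eqI[of _ _ "f v"]) (use eq in \<open>simp add: f fd algebra_simps\<close>)
    finally show "B1 G (quot_gmod M2 N2) #>\<^bsub>Z1 G (quot_gmod M2 N2)\<^esub> (\<lambda>g\<in>G. F ((\<lambda>g\<in>G. cls (z g + (act g v - v))) g))
       = Q.coh_class (\<lambda>g. f (z g))" .
  qed
  finally show ?thesis by simp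
qed

lemma cocycle_map:
  assumes "gmod_quot_model M2 tt2 Fil2 act2 sc2 G K2 N2"
    and f: "\<And>u v. f (u + v) = f u + f v"
    and K: "\<And>u. u \<in> K \<Longrightarrow> f u \<in> K2"
    and eq: "\<And>g v. g \<in> G \<Longrightarrow> f (act g v) - act2 g (f v) \<in> K2"
    and cont: "\<And>j. \<exists>i. f ` Fil i \<subseteq> Fil2 j"
    and z: "cocycle z"
  shows "gmod_quot_model.cocycle Fil2 act2 G K2 (\<lambda>g. f (z g))"
proof -
  interpret Q: gmod_quot_model M2 tt2 Fil2 act2 sc2 G K2 N2 by fact
  have f0: "f 0 = 0" using f[of 0 0] by simp
  have fm: "f (- u) = - f u" for u using f[of u "- u"] f0 by (simp add: eq_neg_iff_add_eq_0 add.commute)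
  have fd: "f (u - v) = f u - f v" for u v using f[of u "- v"] fm by simp
  show ?thesis unfolding Q.cocycle_def
  proof (intro conjI ballI allI)
    fix g j assume g: "g \<in> G"
    from cont obtain i where i: "f ` Fil i \<subseteq> Fil2 j" by blast
    from z g obtain F where F: "finite F" "\<And>h. h \<in> G \<Longrightarrow> agree F h g \<Longrightarrow> \<exists>u\<in>Fil i. z h - z g - u \<in> K"
      unfolding cocycle_def by blast
    have "\<exists>u\<in>Fil2 j. f (z h) - f (z g) - u \<in> K2" if "h \<in> G" "agree F h g" for h
    proof -
      from F(2)[OF that] obtain u where "u \<in> Fil i" "z h - z g - u \<in> K" by blast
      with K[of "z h - z g - u"] i show ?thesis by (intro bexI[of _ "f u"]) (auto simp: fd)
    qed
    with F(1) show "\<exists>F. finite F \<and> (\<forall>h\<in>G. agree F h g \<longrightarrow> (\<exists>u\<in>Fil2 j. f (z h) - f (z g) - u \<in> K2))" by blast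
  next
    fix g h assume gh: "g \<in> G" "h \<in> G"
    with z have "f (z (g \<circ> h) - (z g + act g (z h))) \<in> K2" unfolding cocycle_def by (intro K) blast
    from Q.K_add[OF this eq[of g "z h"]] gh
    show "f (z (g \<circ> h)) - (f (z g) + act2 g (f (z h))) \<in> K2" by (simp add: fd f algebra_simps)
  qed
qed

end

section \<open>Power series over a free module of rank two\<close>

locale padic =
  fixes p :: nat and w :: "'o::{idom,ring_char_0}"
  assumes padic: "padic_integer_ring p w" and prime_p: "prime p"
begin

lemma w_nz: "w \<noteq> 0" and w_nonunit: "\<not> w dvd 1" and w_dvd_p: "w dvd of_nat p"
  using padic unfolding padic_integer_ring_def by blast+

lemma unit_times_power: "x \<noteq> 0 \<Longrightarrow> \<exists>u k. u dvd 1 \<and> x = u * w ^ k"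
  using padic unfolding padic_integer_ring_def by blast

lemma complete: "(\<And>k. w ^ k dvd s (Suc k) - s k) \<Longrightarrow> \<exists>y. \<forall>k. w ^ k dvd s k - y"
  using padic unfolding padic_integer_ring_def by blast

lemma separated: "x = 0" if "\<And>k. w ^ k dvd x"
proof (rule ccontr)
  assume "x \<noteq> 0"
  then obtain u k where u: "u dvd 1" "x = u * w ^ k" using unit_times_power by blast
  have "w * w ^ k dvd u * w ^ k" using that[of "Suc k"] u by simp
  then have "w dvd u" using w_nz by simp
  then show False using u(1) w_nonunit by (meson dvd_trans)
qed

lemma separated_eq: "x = y" if "\<And>k. w ^ k dvd x - y"
  using separated[of "x - y"] that by simp

lemma dvd_w_power: "x \<noteq> 0 \<Longrightarrow> \<exists>k. x dvd w ^ k"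
proof -
  assume "x \<noteq> 0"
  then obtain u k where u: "u dvd 1" "x = u * w ^ k" using unit_times_power by blast
  then obtain v where "1 = u * v" by (auto simp: dvd_def)
  then have "w ^ k = x * v" using u by (simp add: algebra_simps)
  then show ?thesis by (metis dvd_triv_left)
qed

text \<open>If \<open>x\<close> divides \<open>w ^ e\<close>, dividing by \<open>x\<close> costs at
  most \<open>e\<close> powers of \<open>w\<close>. This will control the denominators n! of
  binomial coefficients.\<close>

lemma cancel_dvd: "x \<noteq> 0 \<Longrightarrow> \<exists>e. \<forall>k y. w ^ (k + e) dvd x * y \<longrightarrow> w ^ k dvd y"
proof -
  assume x: "x \<noteq> 0"
  from dvd_w_power[OF x] obtain e s where e: "w ^ e = x * s" by (auto simp: dvd_def)
  have "w ^ k dvd y" if "w ^ (k + e) dvd x * y" for k y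
  proof -
    from that have "x * (w ^ k * s) dvd x * y" by (simp add: power_add e mult_ac)
    then have "w ^ k * s dvd y" using x by simp
    then show ?thesis by (rule dvd_mult_left)
  qed
  then show ?thesis by blast
qed


lemma p_pos: "p > 0"
  using prime_p by (simp add: prime_gt_0_nat)

lemma w_power_le: "k \<le> l \<Longrightarrow> w ^ l dvd x \<Longrightarrow> w ^ k dvd x"
  by (meson dvd_trans le_imp_power_dvd)

lemma w_power_dvd_p_power: "w ^ k dvd of_nat (p ^ k)"
  using w_dvd_p by (simp add: dvd_power_same)

lemma p_power_dvd_w_power: "\<exists>j. of_nat (p ^ k) dvd w ^ j"
  by (rule dvd_w_power) (use p_pos in simp)

text \<open>As a function of i, the binomial coefficient is an integral polynomial divided by n!.
  Congruent arguments give congruent falling factorials, and dividing by n! loses a bounded power of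
  \<open>w\<close>.\<close>

lemma binomial_continuous:
  "\<exists>k. \<forall>i i'. i mod p ^ k = i' mod p ^ k \<longrightarrow> w ^ j dvd of_nat (i choose n) - of_nat (i' choose n)"
proof -
  obtain e where e: "\<And>k y. w ^ (k + e) dvd of_nat (fact n) * y \<Longrightarrow> w ^ k dvd y"
    using cancel_dvd[of "of_nat (fact n)"] by (auto simp: of_nat_eq_0_iff simp del: of_nat_fact)
  \<comment> \<open>The surplus \<open>e\<close> in the exponent is what the division by n!
    consumes.\<close>
  have "w ^ j dvd of_nat (i choose n) - of_nat (i' choose n)" if i: "i mod p ^ (j + e) = i' mod p ^ (j + e)" for i i'
  proof -
    have fall: "int (fact n) * int (m choose n) = (\<Prod>l=0..<n. int m - int l)" for m
    proof -
      have "real_of_int (int (fact n) * int (m choose n)) = fact n * (of_nat m gchoose n)"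
        by (simp add: binomial_gbinomial)
      also have "\<dots> = real_of_int (\<Prod>l=0..<n. int m - int l)"
        by (simp add: gbinomial_mult_fact)
      finally show ?thesis by (simp only: of_int_eq_iff)
    qed
    let ?q = "int (p ^ (j + e))"
    have "int i mod ?q = int i' mod ?q" using i by (metis of_nat_mod)
    then have "(int i - int l) mod ?q = (int i' - int l) mod ?q" for l by (metis mod_diff_left_eq)
    then have "(\<Prod>l=0..<n. (int i - int l) mod ?q) mod ?q = (\<Prod>l=0..<n. (int i' - int l) mod ?q) mod ?q"
      by simp
    then have "(\<Prod>l=0..<n. int i - int l) mod ?q = (\<Prod>l=0..<n. int i' - int l) mod ?q"
      unfolding mod_prod_eq .
    then have "?q dvd int (fact n) * (int (i choose n) - int (i' choose n))"
      unfolding right_diff_distrib fall mod_eq_dvd_iff .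
    then obtain t where "int (fact n) * (int (i choose n) - int (i' choose n)) = ?q * t" by (auto simp: dvd_def)
    then have "(of_int (int (fact n) * (int (i choose n) - int (i' choose n))) :: 'o) = of_int (?q * t)" by simp
    then have "of_nat (fact n) * (of_nat (i choose n) - of_nat (i' choose n)) = (of_nat (p ^ (j + e)) * of_int t :: 'o)"
      by (simp only: of_int_mult of_int_diff of_int_of_nat_eq)
    then show ?thesis by (rule_tac e) (simp only: dvd_mult2[OF w_power_dvd_p_power])
  qed
  then show ?thesis by blast
qed

text \<open>The value at X = b of the series with coefficients \<open>x\<close>. The sum of the
  first k terms must be correct modulo \<open>w ^ k\<close>, so convergence is stated together with
  its rate; such a value exists when \<open>w\<close> divides b.\<close>

definition evo :: "'o \<Rightarrow> (nat \<Rightarrow> 'o) \<Rightarrow> 'o" where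
  "evo b x = (THE s. \<forall>k. w ^ k dvd s - (\<Sum>i<k. b ^ i * x i))"

lemma evo_unique: "evo b x = s" if "\<And>k. w ^ k dvd s - (\<Sum>i<k. b ^ i * x i)"
  unfolding evo_def
proof (rule the_equality)
  fix t assume t: "\<forall>k. w ^ k dvd t - (\<Sum>i<k. b ^ i * x i)"
  show "t = s"
  proof (rule separated_eq)
    fix k
    have "t - s = (t - (\<Sum>i<k. b ^ i * x i)) - (s - (\<Sum>i<k. b ^ i * x i))" by simp
    with t that show "w ^ k dvd t - s" by (metis dvd_diff)
  qed
qed (use that in blast)

lemma evo:
  assumes "w dvd b"
  shows "w ^ k dvd evo b x - (\<Sum>i<k. b ^ i * x i)"
proof -
  have "w ^ k dvd (\<Sum>i<Suc k. b ^ i * x i) - (\<Sum>i<k. b ^ i * x i)" for k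
    using assms by (simp add: dvd_power_same)
  from complete[OF this] obtain y where y: "\<And>k. w ^ k dvd (\<Sum>i<k. b ^ i * x i) - y" by blast
  have "w ^ k dvd y - (\<Sum>i<k. b ^ i * x i)" for k
    using y[of k] by (metis dvd_minus_iff minus_diff_eq)
  with evo_unique[of y b x] show ?thesis by metis
qed

lemma evo_add: "w dvd b \<Longrightarrow> evo b (\<lambda>i. x i + y i) = evo b x + evo b y"
proof (rule evo_unique)
  fix k assume b: "w dvd b"
  have "evo b x + evo b y - (\<Sum>i<k. b ^ i * (x i + y i)) = (evo b x - (\<Sum>i<k. b ^ i * x i)) + (evo b y - (\<Sum>i<k. b ^ i * y i))"
    by (simp add: algebra_simps sum.distrib)
  then show "w ^ k dvd evo b x + evo b y - (\<Sum>i<k. b ^ i * (x i + y i))"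
    by (simp only: dvd_add[OF evo[OF b] evo[OF b]])
qed

lemma evo_scale: "w dvd b \<Longrightarrow> evo b (\<lambda>i. r * x i) = r * evo b x"
proof (rule evo_unique)
  fix k assume b: "w dvd b"
  have "r * evo b x - (\<Sum>i<k. b ^ i * (r * x i)) = r * (evo b x - (\<Sum>i<k. b ^ i * x i))"
    by (simp add: right_diff_distrib sum_distrib_left mult_ac)
  then show "w ^ k dvd r * evo b x - (\<Sum>i<k. b ^ i * (r * x i))"
    by (simp only: dvd_mult[OF evo[OF b]])
qed

lemma evo_rec: "w dvd b \<Longrightarrow> evo b x = x 0 + b * evo b (\<lambda>i. x (Suc i))"
proof (rule evo_unique)
  fix k assume b: "w dvd b"
  show "w ^ k dvd x 0 + b * evo b (\<lambda>i. x (Suc i)) - (\<Sum>i<k. b ^ i * x i)"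
  proof (cases k)
    case (Suc l)
    have "x 0 + b * evo b (\<lambda>i. x (Suc i)) - (\<Sum>i<k. b ^ i * x i) = b * (evo b (\<lambda>i. x (Suc i)) - (\<Sum>i<l. b ^ i * x (Suc i)))"
      unfolding Suc sum.lessThan_Suc_shift by (simp add: algebra_simps sum_distrib_left)
    then show ?thesis using evo[OF b, of l] b by (simp add: Suc mult_dvd_mono)
  qed simp
qed

end

section \<open>Vectors of rank two and evaluation of series of vectors\<close>

definition sc2 :: "'o::comm_ring_1 \<Rightarrow> 'o \<times> 'o \<Rightarrow> 'o \<times> 'o" where
  "sc2 r v = (r * fst v, r * snd v)"

definition vdvd :: "'o::comm_ring_1 \<Rightarrow> 'o \<times> 'o \<Rightarrow> bool" where
  "vdvd r v \<longleftrightarrow> r dvd fst v \<and> r dvd snd v"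

lemma sc2_simps: "sc2 1 v = v" "sc2 r 0 = 0" "sc2 0 v = 0" "sc2 r (sc2 s v) = sc2 (r * s) v"
  "sc2 (r + s) v = sc2 r v + sc2 s v" "sc2 r (u + v) = sc2 r u + sc2 r v"
  "sc2 (r - s) v = sc2 r v - sc2 s v" "sc2 r (u - v) = sc2 r u - sc2 r v" "sc2 r (- u) = - sc2 r u"
  by (auto simp: sc2_def prod_eq_iff algebra_simps)

lemma sc2_sum: "sc2 r (\<Sum>i\<in>A. f i) = (\<Sum>i\<in>A. sc2 r (f i))"
  by (induction A rule: infinite_finite_induct) (auto simp: sc2_simps)

lemma vdvd_iff: "vdvd r v \<longleftrightarrow> (\<exists>u. v = sc2 r u)"
  by (auto simp: vdvd_def sc2_def prod_eq_iff dvd_def)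

lemma vdvd_simps [simp]: "vdvd r 0" "vdvd r (sc2 r u)" "vdvd r (- v) \<longleftrightarrow> vdvd r v"
  by (auto simp: vdvd_def sc2_def)

lemma vdvd_add: "vdvd r u \<Longrightarrow> vdvd r v \<Longrightarrow> vdvd r (u + v)"
  and vdvd_diff: "vdvd r u \<Longrightarrow> vdvd r v \<Longrightarrow> vdvd r (u - v)"
  and vdvd_sc2: "vdvd r u \<Longrightarrow> vdvd r (sc2 s u)"
  and dvd_sc2: "r dvd s \<Longrightarrow> vdvd r (sc2 s u)"
  and vdvd_trans: "r dvd s \<Longrightarrow> vdvd s u \<Longrightarrow> vdvd r u"
  by (auto simp: vdvd_def sc2_def intro: dvd_trans)

lemma vdvd_sum: "(\<And>i. i \<in> A \<Longrightarrow> vdvd r (f i)) \<Longrightarrow> vdvd r (\<Sum>i\<in>A. f i)"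
  by (induction A rule: infinite_finite_induct) (auto simp: vdvd_add)

definition convol :: "(nat \<Rightarrow> 'o) \<Rightarrow> (nat \<Rightarrow> 'o \<times> 'o) \<Rightarrow> nat \<Rightarrow> 'o::comm_ring_1 \<times> 'o" where
  "convol u x n = (\<Sum>i\<le>n. sc2 (u i) (x (n - i)))"

context padic
begin

lemma vseparated: "u = v" if "\<And>k. vdvd (w ^ k) (u - v)"
  using that by (auto simp: vdvd_def prod_eq_iff intro: separated_eq)

definition ev :: "'o \<Rightarrow> (nat \<Rightarrow> 'o \<times> 'o) \<Rightarrow> 'o \<times> 'o" where
  "ev b x = (evo b (\<lambda>i. fst (x i)), evo b (\<lambda>i. snd (x i)))"

lemma ev_unique: "ev b x = s" if "\<And>k. vdvd (w ^ k) (s - (\<Sum>i<k. sc2 (b ^ i) (x i)))"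
  using that unfolding ev_def
  by (auto simp: vdvd_def prod_eq_iff fst_sum snd_sum sc2_def intro!: evo_unique)

context
  fixes b assumes b: "w dvd b"
begin

lemma ev: "vdvd (w ^ k) (ev b x - (\<Sum>i<k. sc2 (b ^ i) (x i)))"
  using evo[OF b] by (simp add: vdvd_def ev_def fst_sum snd_sum sc2_def)

lemma ev_add: "ev b (\<lambda>i. x i + y i) = ev b x + ev b y"
  by (simp add: ev_def evo_add[OF b])

lemma ev_scale: "ev b (\<lambda>i. sc2 r (x i)) = sc2 r (ev b x)"
  by (simp add: ev_def evo_scale[OF b] sc2_def)

lemma ev_const: "ev b (\<lambda>i. sc2 (u i) v) = sc2 (evo b u) v"
  using evo_scale[OF b, of "fst v" u] evo_scale[OF b, of "snd v" u] by (simp add: ev_def sc2_def mult.commute)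

lemma ev_rec: "ev b x = x 0 + sc2 b (ev b (\<lambda>i. x (Suc i)))"
  using evo_rec[OF b, of "\<lambda>i. fst (x i)"] evo_rec[OF b, of "\<lambda>i. snd (x i)"]
  by (simp add: ev_def sc2_def prod_eq_iff)

lemma ev_vdvd:
  assumes "\<And>i. vdvd c (x i)" shows "vdvd c (ev b x)"
proof -
  from assms obtain y where "x = (\<lambda>i. sc2 c (y i))" unfolding vdvd_iff by metis
  then show ?thesis by (simp add: ev_scale)
qed

text \<open>The first k terms are divisible by assumption, the tail because of the powers of b. Only
  finitely many coefficients matter at each precision, which is continuity for the product
  topology.\<close>

lemma ev_continuous:
  assumes "\<And>i. i < k \<Longrightarrow> vdvd (w ^ k) (x i)" shows "vdvd (w ^ k) (ev b x)"
proof -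
  have "ev b x = (ev b x - (\<Sum>i<k. sc2 (b ^ i) (x i))) + (\<Sum>i<k. sc2 (b ^ i) (x i))" by simp
  moreover have "vdvd (w ^ k) (\<Sum>i<k. sc2 (b ^ i) (x i))"
    using assms by (intro vdvd_sum vdvd_sc2) simp
  ultimately show ?thesis using vdvd_add[OF ev] by metis
qed

text \<open>An additive map commuting with scalars preserves divisibility by \<open>w ^ k\<close>,
  so it passes through the limit.\<close>

lemma ev_linear:
  assumes "\<And>u v. f (u + v) = f u + f v" and "\<And>r v. f (sc2 r v) = sc2 r (f v)"
  shows "ev b (\<lambda>i. f (x i)) = f (ev b x)"
proof (rule ev_unique)
  fix k
  have f0: "f 0 = 0" using assms(1)[of 0 0] by simp
  have fm: "f (u - v) = f u - f v" for u v using assms(1)[of "u - v" v] by (simp add: algebra_simps)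
  have fs: "f (\<Sum>i\<in>A. g i) = (\<Sum>i\<in>A. f (g i))" for A :: "nat set" and g
    by (induction A rule: infinite_finite_induct) (auto simp: f0 assms(1))
  have "f (ev b x) - (\<Sum>i<k. sc2 (b ^ i) (f (x i))) = f (ev b x - (\<Sum>i<k. sc2 (b ^ i) (x i)))"
    by (simp add: fm fs assms(2))
  moreover have "vdvd (w ^ k) (f v)" if "vdvd (w ^ k) v" for v
    using that assms(2) unfolding vdvd_iff by metis
  ultimately show "vdvd (w ^ k) (f (ev b x) - (\<Sum>i<k. sc2 (b ^ i) (f (x i))))"
    using ev by metis
qed

lemma convol_0: "convol u x 0 = sc2 (u 0) (x 0)"
  by (simp add: convol_def)

lemma convol_Suc: "convol u x (Suc n) = convol u (\<lambda>i. x (Suc i)) n + sc2 (u (Suc n)) (x 0)"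
  by (simp add: convol_def Suc_diff_le)

text \<open>A rearrangement of double sums is avoided: the defect \<Delta> of a series equals b
  times the defect of the shifted series, so it is divisible by every power of \<open>w\<close> and
  vanishes.\<close>

lemma ev_convol: "ev b (convol u x) = sc2 (evo b u) (ev b x)"
proof (rule vseparated)
  define \<Delta> where "\<Delta> x = ev b (convol u x) - sc2 (evo b u) (ev b x)" for x
  have step: "\<Delta> x = sc2 b (\<Delta> (\<lambda>i. x (Suc i)))" for x
  proof -
    \<comment> \<open>\<open>?y\<close> is X times the product of u with the shifted series; adding
      u times the constant term gives the whole product.\<close>
    let ?y = "\<lambda>n. if n = 0 then 0 else convol u (\<lambda>i. x (Suc i)) (n - 1)"
    have "convol u x = (\<lambda>n. sc2 (u n) (x 0) + ?y n)"
    proof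
      fix n show "convol u x n = sc2 (u n) (x 0) + ?y n"
        by (cases n) (simp_all add: convol_0 convol_Suc add.commute)
    qed
    then have "ev b (convol u x) = sc2 (evo b u) (x 0) + ev b ?y"
      by (simp only: ev_add ev_const)
    also have "ev b ?y = sc2 b (ev b (convol u (\<lambda>i. x (Suc i))))"
      by (subst ev_rec) simp
    finally show ?thesis
      unfolding \<Delta>_def ev_rec[of x] by (simp add: sc2_simps mult.commute)
  qed
  have "vdvd (w ^ k) (\<Delta> x)" for k x
  proof (induction k arbitrary: x)
    case (Suc k)
    from Suc[of "\<lambda>i. x (Suc i)"] obtain s where "\<Delta> (\<lambda>i. x (Suc i)) = sc2 (w ^ k) s" by (auto simp: vdvd_iff)
    then have "\<Delta> x = sc2 (b * w ^ k) s" using step[of x] by (simp add: sc2_simps)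
    then show ?case using b by (simp add: dvd_sc2 mult_dvd_mono)
  qed (simp add: vdvd_def)
  then show "vdvd (w ^ k) (ev b (convol u x) - sc2 (evo b u) (ev b x))" for k
    unfolding \<Delta>_def .
qed

text \<open>This is the characterization of the limit in \<open>ser_eval\<close>, which uses the ideals generated by
  powers of \<open>b\<close> instead of \<open>w\<close>.\<close>

lemma ev_iff:
  "s = ev b x \<longleftrightarrow> (\<forall>n. vdvd (b ^ n) (s - (\<Sum>i<n. sc2 (b ^ i) (x i))))"
proof
  assume s: "s = ev b x"
  \<comment> \<open>The error after n terms is exactly \<open>b ^ n\<close> times the value of the
    shifted series, so the ideals generated by powers of b can be allowed, including b = 0.\<close>
  have "ev b x - (\<Sum>i<n. sc2 (b ^ i) (x i)) = sc2 (b ^ n) (ev b (\<lambda>i. x (i + n)))" for n x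
  proof (induction n arbitrary: x)
    case (Suc n)
    have "ev b x - (\<Sum>i<Suc n. sc2 (b ^ i) (x i)) = sc2 b (ev b (\<lambda>i. x (Suc i)) - (\<Sum>i<n. sc2 (b ^ i) (x (Suc i))))"
      unfolding sum.lessThan_Suc_shift ev_rec[of x] by (simp add: sc2_simps sc2_sum)
    then show ?case using Suc[of "\<lambda>i. x (Suc i)"] by (simp add: sc2_simps)
  qed (simp add: sc2_simps)
  with s show "\<forall>n. vdvd (b ^ n) (s - (\<Sum>i<n. sc2 (b ^ i) (x i)))" by simp
next
  assume "\<forall>n. vdvd (b ^ n) (s - (\<Sum>i<n. sc2 (b ^ i) (x i)))"
  then have "vdvd (w ^ k) (s - (\<Sum>i<k. sc2 (b ^ i) (x i)))" for k
    using b by (meson dvd_power_same vdvd_trans)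
  from ev_unique[OF this] show "s = ev b x" by simp
qed

end
end

section \<open>Galois groups and characters of a tower\<close>

lemma agree_sym: "agree L g h \<longleftrightarrow> agree L h g"
  by (auto simp: agree_def)

lemma agree_trans: "agree L g h \<Longrightarrow> agree L h k \<Longrightarrow> agree L g k"
  by (auto simp: agree_def)

lemma agree_mono: "agree L g h \<Longrightarrow> L' \<subseteq> L \<Longrightarrow> agree L' g h"
  by (auto simp: agree_def)

lemma gal_id: "id \<in> gal L"
  by (auto simp: gal_def)

lemma gal_comp: "\<sigma> \<in> gal L \<Longrightarrow> \<tau> \<in> gal L \<Longrightarrow> \<sigma> \<circ> \<tau> \<in> gal L"
  unfolding gal_def by (auto intro: bij_comp)

lemma gal_bij: "\<sigma> \<in> gal L \<Longrightarrow> bij \<sigma>"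
  by (simp add: gal_def)

lemma gal_ginv_apply: "\<sigma> \<in> gal L \<Longrightarrow> ginv \<sigma> (\<sigma> x) = x" "\<sigma> \<in> gal L \<Longrightarrow> \<sigma> (ginv \<sigma> x) = x"
  using gal_bij by (auto simp: bij_is_inj bij_is_surj surj_f_inv_f)

text \<open>An element of \<open>gal\<close> permutes all complex numbers and fixes the
  transcendental ones, so the preimage of an algebraic number is algebraic: otherwise it would be
  fixed. The homomorphism laws, assumed on \<open>qbar\<close>, then pass to the inverse.\<close>

lemma gal_ginv: assumes "\<sigma> \<in> gal L" shows "ginv \<sigma> \<in> gal L"
proof -
  have q: "ginv \<sigma> x \<in> qbar" if "x \<in> qbar" for x
  proof (rule ccontr)
    assume "ginv \<sigma> x \<notin> qbar"
    then have "\<sigma> (ginv \<sigma> x) = ginv \<sigma> x" using assms by (simp add: gal_def)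
    with that \<open>ginv \<sigma> x \<notin> qbar\<close> show False by (simp add: gal_ginv_apply[OF assms])
  qed
  have *: "\<sigma> (x + y) = \<sigma> x + \<sigma> y" "\<sigma> (x * y) = \<sigma> x * \<sigma> y" if "x \<in> qbar" "y \<in> qbar" for x y
    using assms that by (auto simp: gal_def)
  show ?thesis unfolding gal_def
  proof (intro CollectI conjI ballI allI impI)
    show "bij (ginv \<sigma>)" using gal_bij[OF assms] by (rule bij_imp_bij_inv)
  next
    fix x assume "x \<notin> qbar"
    then have "\<sigma> x = x" using assms by (simp add: gal_def)
    then show "ginv \<sigma> x = x" using gal_ginv_apply(1)[OF assms, of x] by simp
  next
    fix x assume "x \<in> L"
    then have "\<sigma> x = x" using assms by (simp add: gal_def)
    then show "ginv \<sigma> x = x" using gal_ginv_apply(1)[OF assms, of x] by simp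
  next
    fix x y assume xy: "x \<in> qbar" "y \<in> qbar"
    show "ginv \<sigma> (x + y) = ginv \<sigma> x + ginv \<sigma> y" "ginv \<sigma> (x * y) = ginv \<sigma> x * ginv \<sigma> y"
      using *[OF q q, OF xy] gal_ginv_apply[OF assms] by metis+
  qed (use q in auto)
qed

lemma gal_ginv_comp: "\<sigma> \<in> gal L \<Longrightarrow> \<tau> \<in> gal L \<Longrightarrow> ginv (\<sigma> \<circ> \<tau>) = ginv \<tau> \<circ> ginv \<sigma>"
  by (rule o_inv_distrib) (auto intro: gal_bij)

lemma gal_power: "\<sigma> \<in> gal L \<Longrightarrow> \<sigma> ^^ i \<in> gal L"
  by (induction i) (auto simp: gal_comp gal_id[unfolded id_def] gal_id)

lemma gal_01:
  assumes "\<sigma> \<in> gal L" shows "\<sigma> 0 = 0" "\<sigma> 1 = 1"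
proof -
  have 01: "0 \<in> qbar" "1 \<in> qbar" by (simp_all add: qbar_def)
  have "\<sigma> (0 + 0) = \<sigma> 0 + \<sigma> 0" "\<sigma> (1 * 1) = \<sigma> 1 * \<sigma> 1"
    using assms 01 unfolding gal_def by blast+
  then show "\<sigma> 0 = 0" by simp
  moreover have "\<sigma> 1 \<noteq> \<sigma> 0" using gal_bij[OF assms] by (simp add: bij_is_inj inj_eq)
  ultimately show "\<sigma> 1 = 1" using \<open>\<sigma> (1 * 1) = \<sigma> 1 * \<sigma> 1\<close> by simp
qed

lemma rat_in_qbar: "x \<in> \<rat> \<Longrightarrow> x \<in> qbar"
  by (auto simp: qbar_def rat_imp_algebraic)

context
  fixes \<sigma> L assumes \<sigma>: "\<sigma> \<in> gal L"
begin

lemma gal_qbar: "x \<in> qbar \<Longrightarrow> \<sigma> x \<in> qbar"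
  and gal_add: "x \<in> qbar \<Longrightarrow> y \<in> qbar \<Longrightarrow> \<sigma> (x + y) = \<sigma> x + \<sigma> y"
  and gal_mult: "x \<in> qbar \<Longrightarrow> y \<in> qbar \<Longrightarrow> \<sigma> (x * y) = \<sigma> x * \<sigma> y"
  using \<sigma> by (auto simp: gal_def)

lemma gal_of_nat: "\<sigma> (of_nat n) = of_nat n"
  by (induction n) (use gal_01[OF \<sigma>] in \<open>auto simp: gal_add qbar_def\<close>)

lemma gal_of_int: "\<sigma> (of_int n) = of_int n"
proof -
  have "\<sigma> (of_int n + of_nat (nat (- n))) = \<sigma> (of_int n) + \<sigma> (of_nat (nat (- n)))"
    by (rule gal_add) (auto simp: qbar_def)
  moreover have "of_int n + of_nat (nat (- n)) = (of_nat (nat n) :: complex)" by (cases n rule: int_cases2) auto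
  ultimately show ?thesis by (simp add: gal_of_nat algebra_simps eq_diff_eq)
qed

text \<open>Multiplying by a denominator reduces the claim to integers. It puts every
  \<open>gal L\<close> inside \<open>gal \<rat>\<close> and makes Galois elements fix the
  coefficients of rational polynomials.\<close>

lemma gal_rat: "x \<in> \<rat> \<Longrightarrow> \<sigma> x = x"
proof -
  assume "x \<in> \<rat>"
  then obtain q where q: "x = of_rat q" by (rule Rats_cases)
  obtain a b where "q = of_int a / of_int b" "b > 0" by (metis quotient_of_div quotient_of_denom_pos surj_pair)
  then have *: "of_rat q * of_int b = (of_int a :: complex)" by (simp add: of_rat_divide)
  have "\<sigma> (of_rat q * of_int b) = \<sigma> (of_rat q) * \<sigma> (of_int b)"
    by (rule gal_mult) (auto intro!: rat_in_qbar)
  then have "\<sigma> (of_rat q) * of_int b = of_rat q * of_int b" using * by (metis gal_of_int)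
  then show ?thesis using \<open>b > 0\<close> q by (metis mult_cancel_right of_int_eq_0_iff order_less_irrefl)
qed

end

lemma gal_subset_gal_Rats: "gal L \<subseteq> gal \<rat>"
proof
  fix \<sigma> assume s: "\<sigma> \<in> gal L"
  then show "\<sigma> \<in> gal \<rat>" using gal_rat[OF s] by (simp add: gal_def)
qed

section \<open>The group-like power series attached to elements of a tower\<close>

locale iwasawa_tower = padic p w
  for p :: nat and w :: "'o::{idom,ring_char_0}" +
  fixes k0 :: "complex set" and L :: "nat \<Rightarrow> complex set" and \<gamma> :: gal
  assumes tower: "zp_tower p (gal k0) L \<gamma>"
    and stable: "\<sigma> \<in> gal k0 \<Longrightarrow> \<sigma> ` L k = L k"
begin

abbreviation "G \<equiv> gal k0"

lemma gamma: "\<gamma> \<in> G"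
  using tower by (simp add: zp_tower_def)

lemma L_mono: "k \<le> l \<Longrightarrow> L k \<subseteq> L l"
  by (rule lift_Suc_mono_le[of L]) (use tower in \<open>simp_all add: zp_tower_def\<close>)

lemma ex_power: "g \<in> G \<Longrightarrow> \<exists>i<p ^ k. agree (L k) g (\<gamma> ^^ i)"
  using tower unfolding zp_tower_def by blast

lemma power_unique: "i < p ^ k \<Longrightarrow> j < p ^ k \<Longrightarrow> agree (L k) (\<gamma> ^^ i) (\<gamma> ^^ j) \<Longrightarrow> i = j"
  using tower gal_power[OF gamma, of i] unfolding zp_tower_def by (metis agree_def)

lemma agree_comp:
  "g \<in> G \<Longrightarrow> g' \<in> G \<Longrightarrow> h \<in> G \<Longrightarrow> h' \<in> G \<Longrightarrow> agree (L k) g g' \<Longrightarrow> agree (L k) h h' \<Longrightarrow> agree (L k) (g \<circ> h) (g' \<circ> h')"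
  unfolding agree_def
proof
  fix x assume *: "g \<in> G" "g' \<in> G" "h \<in> G" "h' \<in> G" "\<forall>x\<in>L k. g x = g' x" "\<forall>x\<in>L k. h x = h' x" "x \<in> L k"
  then have "h' x \<in> L k" using stable[of h' k] by blast
  with * show "(g \<circ> h) x = (g' \<circ> h') x" by simp
qed

lemma agree_ginv:
  assumes "g \<in> G" "h \<in> G" "agree (L k) g h" shows "agree (L k) (ginv g) (ginv h)"
  unfolding agree_def
proof
  fix x assume x: "x \<in> L k"
  then have "ginv h x \<in> L k" using stable[OF gal_ginv[OF assms(2)], of k] by blast
  then have "g (ginv h x) = x" using assms by (simp add: agree_def gal_ginv_apply)
  then show "ginv g x = ginv h x" using gal_ginv_apply(1)[OF assms(1)] by metis
qed

lemma agree_cancel: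
  assumes "g \<in> G" "h \<in> G" "f \<in> G" "agree (L k) (g \<circ> f) (h \<circ> f)" shows "agree (L k) g h"
  unfolding agree_def
proof
  fix x assume "x \<in> L k"
  then obtain y where "y \<in> L k" "x = f y" using stable[OF assms(3), of k] by blast
  then show "g x = h x" using assms(4) by (simp add: agree_def)
qed

text \<open>On the layer this power agrees with one of exponent i < p^k; after cancellation the
  exponent p^k - i acts trivially. Were i positive, that exponent would lie strictly between 0 and
  p^k, against uniqueness of exponents.\<close>

lemma power_p: "agree (L k) (\<gamma> ^^ (p ^ k)) id"
proof -
  from ex_power[OF gal_power[OF gamma]] obtain i where i: "i < p ^ k" "agree (L k) (\<gamma> ^^ (p ^ k)) (\<gamma> ^^ i)"
    by blast
  have "\<gamma> ^^ (p ^ k) = \<gamma> ^^ (p ^ k - i) \<circ> \<gamma> ^^ i"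
    using i(1) by (simp flip: funpow_add)
  then have a: "agree (L k) (\<gamma> ^^ (p ^ k - i)) id"
    using i(2) agree_cancel[of "\<gamma> ^^ (p ^ k - i)" id "\<gamma> ^^ i"] gal_power[OF gamma] gal_id by simp
  show ?thesis
  proof (cases "i = 0")
    case False
    then have "p ^ k - i = 0" using i(1) a p_pos by (intro power_unique[of _ k]) (auto simp: id_def)
    with i(1) show ?thesis by simp
  qed (use a in simp)
qed

lemma power_mod: "agree (L k) (\<gamma> ^^ i) (\<gamma> ^^ (i mod p ^ k))"
proof -
  have "agree (L k) (\<gamma> ^^ (p ^ k * j)) id" for j
  proof (induction j)
    case (Suc j)
    have "agree (L k) (\<gamma> ^^ (p ^ k) \<circ> \<gamma> ^^ (p ^ k * j)) (id \<circ> id)"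
      by (intro agree_comp power_p Suc gal_power gamma gal_id)
    then show ?case by (simp add: funpow_add agree_def)
  qed (simp add: agree_def)
  then have "agree (L k) (\<gamma> ^^ (p ^ k * (i div p ^ k)) \<circ> \<gamma> ^^ (i mod p ^ k)) (id \<circ> \<gamma> ^^ (i mod p ^ k))"
    by (intro agree_comp gal_power gamma gal_id) (auto simp: agree_def)
  then show ?thesis by (simp flip: funpow_add)
qed

text \<open>Exponents may be reduced modulo p^k without changing the action on the layer, and
  reduced exponents are unique. This turns agreement on a layer into the congruence that
  \<open>binomial_continuous\<close> asks for.\<close>

lemma power_agree_mod: "i mod p ^ k = j mod p ^ k" if "agree (L k) (\<gamma> ^^ i) (\<gamma> ^^ j)"
proof (rule power_unique)
  show "agree (L k) (\<gamma> ^^ (i mod p ^ k)) (\<gamma> ^^ (j mod p ^ k))"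
    using that power_mod[of k i] power_mod[of k j] by (meson agree_sym agree_trans)
qed (use p_pos in auto)

text \<open>Finitely many elements of \<open>L k\<close> suffice to tell the \<open>p ^ k\<close> automorphisms of \<open>L k\<close> apart.\<close>

lemma agree_finite: "\<exists>F. finite F \<and> (\<forall>g\<in>G. \<forall>h\<in>G. agree F g h \<longrightarrow> agree (L k) g h)"
proof -
  have "\<exists>x\<in>L k. (\<gamma> ^^ i) x \<noteq> (\<gamma> ^^ j) x" if "i < p ^ k" "j < p ^ k" "i \<noteq> j" for i j
    using power_unique[OF that(1,2)] that(3) by (auto simp: agree_def)
  then obtain x where x: "\<And>i j. i < p ^ k \<Longrightarrow> j < p ^ k \<Longrightarrow> i \<noteq> j \<Longrightarrow>
      x i j \<in> L k \<and> (\<gamma> ^^ i) (x i j) \<noteq> (\<gamma> ^^ j) (x i j)" by metis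
  let ?F = "(\<lambda>(i, j). x i j) ` ({..<p ^ k} \<times> {..<p ^ k})"
  have "agree (L k) g h" if gh: "g \<in> G" "h \<in> G" "agree ?F g h" for g h
  proof -
    obtain i j where ij: "i < p ^ k" "agree (L k) g (\<gamma> ^^ i)" "j < p ^ k" "agree (L k) h (\<gamma> ^^ j)"
      using ex_power gh by meson
    have "i = j"
    proof (rule ccontr)
      assume ne: "i \<noteq> j"
      have "x i j \<in> ?F" using ij by force
      then have "g (x i j) = h (x i j)" using gh(3) unfolding agree_def by blast
      then show False using x[OF ij(1,3) ne] ij(2,4) by (simp add: agree_def)
    qed
    with ij show ?thesis by (meson agree_sym agree_trans)
  qed
  then show ?thesis by (intro exI[of _ ?F]) auto
qed

text \<open>The n-th coefficient is the limit of the binomials \<open>I k choose n\<close>, where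
  \<gamma>^(I k) approximates g on layer k. The level \<open>K n j\<close> needed for precision j is
  the same for all g; this uniformity later yields continuity in g.\<close>

lemma iw_char_ex:
  "\<exists>K. \<forall>g\<in>G. \<exists>u :: 'o fps. \<forall>n j i. agree (L (K n j)) g (\<gamma> ^^ i) \<longrightarrow>
     w ^ j dvd fps_nth u n - of_nat (i choose n)"
proof -
  define K0 where "K0 n j = (SOME k. \<forall>i i'. i mod p ^ k = i' mod p ^ k \<longrightarrow>
      w ^ j dvd of_nat (i choose n) - of_nat (i' choose n))" for n j
  have K0: "w ^ j dvd of_nat (i choose n) - of_nat (i' choose n)"
    if "i mod p ^ K0 n j = i' mod p ^ K0 n j" for n j i i'
    using someI_ex[OF binomial_continuous[of j n]] that unfolding K0_def by blast
  \<comment> \<open>Summing over l \<le> j makes the level monotone in j, so that the approximation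
    chosen for \<open>Suc j\<close> is also valid at level \<open>K n j\<close>.\<close>
  define K where "K n j = (\<Sum>l\<le>j. K0 n l)" for n j :: nat
  have K0K: "K0 n j \<le> K n j" for n j unfolding K_def by (rule member_le_sum) auto
  have K: "w ^ j dvd of_nat (i choose n) - of_nat (i' choose n)"
    if "agree (L (K n j)) (\<gamma> ^^ i) (\<gamma> ^^ i')" for i i' n j
    by (rule K0, rule power_agree_mod) (use that agree_mono L_mono K0K in blast)
  have "\<exists>u :: 'o fps. \<forall>n j i. agree (L (K n j)) g (\<gamma> ^^ i) \<longrightarrow> w ^ j dvd fps_nth u n - of_nat (i choose n)"
    if g: "g \<in> G" for g
  proof -
    obtain I where I: "\<And>k. agree (L k) g (\<gamma> ^^ I k)" using ex_power[OF g] by metis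
    have "\<exists>y. \<forall>j. w ^ j dvd of_nat (I (K n j) choose n) - y" for n
    proof (rule complete, rule K)
      fix j
      have "agree (L (K n j)) g (\<gamma> ^^ I (K n (Suc j)))"
        by (rule agree_mono[OF I L_mono]) (simp add: K_def)
      then show "agree (L (K n j)) (\<gamma> ^^ I (K n (Suc j))) (\<gamma> ^^ I (K n j))"
        using I by (meson agree_sym agree_trans)
    qed
    then obtain y where y: "\<And>n j. w ^ j dvd of_nat (I (K n j) choose n) - y n" by metis
    have "w ^ j dvd fps_nth (Abs_fps y) n - of_nat (i choose n)" if "agree (L (K n j)) g (\<gamma> ^^ i)" for n j i
    proof -
      have "agree (L (K n j)) (\<gamma> ^^ I (K n j)) (\<gamma> ^^ i)" using I that by (meson agree_sym agree_trans)
      from dvd_diff[OF K[OF this] y[of j n]] show ?thesis by simp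
    qed
    then show ?thesis by blast
  qed
  then show ?thesis by blast
qed

text \<open>Both series are compared with one exponent that is good at the larger of the two levels.
  This uniqueness gives the definite description in \<open>iw_char\<close> a value.\<close>

lemma fps_eq_of_agree:
  fixes u v :: "'o fps"
  assumes g: "g \<in> G"
    and u: "\<And>n j. \<exists>k. \<forall>i. agree (L k) g (\<gamma> ^^ i) \<longrightarrow> w ^ j dvd fps_nth u n - of_nat (i choose n)"
    and v: "\<And>n j. \<exists>k. \<forall>i. agree (L k) g (\<gamma> ^^ i) \<longrightarrow> w ^ j dvd fps_nth v n - of_nat (i choose n)"
  shows "u = v"
proof (rule fps_ext, rule separated_eq)
  fix n j
  obtain k k' where k: "\<And>i. agree (L k) g (\<gamma> ^^ i) \<Longrightarrow> w ^ j dvd fps_nth u n - of_nat (i choose n)"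
    "\<And>i. agree (L k') g (\<gamma> ^^ i) \<Longrightarrow> w ^ j dvd fps_nth v n - of_nat (i choose n)"
    using u v by metis
  obtain i where i: "agree (L (max k k')) g (\<gamma> ^^ i)" using ex_power[OF g] by blast
  have "agree (L k) g (\<gamma> ^^ i)" "agree (L k') g (\<gamma> ^^ i)"
    by (rule agree_mono[OF i L_mono], simp)+
  from dvd_diff[OF k(1)[OF this(1)] k(2)[OF this(2)]]
  show "w ^ j dvd fps_nth u n - fps_nth v n" by simp
qed

lemma iw_char_uniform:
  "\<exists>K. \<forall>g\<in>G. \<forall>n j i. agree (L (K n j)) g (\<gamma> ^^ i) \<longrightarrow>
     w ^ j dvd fps_nth (iw_char w L \<gamma> g) n - of_nat (i choose n)"
proof -
  obtain K where K: "\<And>g. g \<in> G \<Longrightarrow> \<exists>u :: 'o fps. \<forall>n j i. agree (L (K n j)) g (\<gamma> ^^ i) \<longrightarrow>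
     w ^ j dvd fps_nth u n - of_nat (i choose n)"
    using iw_char_ex by metis
  have "w ^ j dvd fps_nth (iw_char w L \<gamma> g) n - of_nat (i choose n)"
    if g: "g \<in> G" and a: "agree (L (K n j)) g (\<gamma> ^^ i)" for g n j i
  proof -
    obtain u :: "'o fps" where u: "\<forall>n j i. agree (L (K n j)) g (\<gamma> ^^ i) \<longrightarrow> w ^ j dvd fps_nth u n - of_nat (i choose n)"
      using K[OF g] by blast
    have "iw_char w L \<gamma> g = u"
      unfolding iw_char_def
    proof (rule the_equality)
      show "\<forall>n j. \<exists>k. \<forall>i. agree (L k) g (\<gamma> ^^ i) \<longrightarrow> w ^ j dvd fps_nth u n - of_nat (i choose n)"
        using u by blast
      fix v :: "'o fps" assume "\<forall>n j. \<exists>k. \<forall>i. agree (L k) g (\<gamma> ^^ i) \<longrightarrow> w ^ j dvd fps_nth v n - of_nat (i choose n)"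
      then show "v = u" using u by (intro fps_eq_of_agree[OF g]) blast+
    qed
    then show ?thesis using u a by simp
  qed
  then show ?thesis by blast
qed

lemma iw_char_bounded:
  "\<exists>k. \<forall>g l i. g \<in> G \<longrightarrow> l \<le> n \<longrightarrow> agree (L k) g (\<gamma> ^^ i) \<longrightarrow>
     w ^ j dvd fps_nth (iw_char w L \<gamma> g) l - of_nat (i choose l)"
proof -
  obtain K where K: "\<And>g n j i. g \<in> G \<Longrightarrow> agree (L (K n j)) g (\<gamma> ^^ i) \<Longrightarrow>
     w ^ j dvd fps_nth (iw_char w L \<gamma> g) n - of_nat (i choose n)" using iw_char_uniform by blast
  have "w ^ j dvd fps_nth (iw_char w L \<gamma> g) l - of_nat (i choose l)"
    if g: "g \<in> G" "l \<le> n" "agree (L (\<Sum>l\<le>n. K l j)) g (\<gamma> ^^ i)" for g l i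
  proof -
    have "K l j \<le> (\<Sum>l\<le>n. K l j)" using g(2) by (intro member_le_sum) auto
    then have "agree (L (K l j)) g (\<gamma> ^^ i)" using agree_mono[OF g(3) L_mono] by blast
    then show ?thesis by (rule K[OF g(1)])
  qed
  then show ?thesis by blast
qed

lemma iw_char_0: "g \<in> G \<Longrightarrow> fps_nth (iw_char w L \<gamma> g) 0 = 1"
proof (rule separated_eq)
  fix j assume g: "g \<in> G"
  obtain k where k: "\<And>g l i. g \<in> G \<Longrightarrow> l \<le> 0 \<Longrightarrow> agree (L k) g (\<gamma> ^^ i) \<Longrightarrow>
     w ^ j dvd fps_nth (iw_char w L \<gamma> g) l - of_nat (i choose l)" using iw_char_bounded by meson
  obtain i where i: "agree (L k) g (\<gamma> ^^ i)" using ex_power[OF g] by blast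
  show "w ^ j dvd fps_nth (iw_char w L \<gamma> g) 0 - 1" using k[OF g _ i, of 0] by simp
qed

text \<open>Modulo \<open>w ^ j\<close> and up to degree n the two series are those of (1+X)^a and
  (1+X)^b, and exponents add under composition. Vandermonde's identity multiplies the two.\<close>

lemma iw_char_mult:
  assumes g: "g \<in> G" and h: "h \<in> G"
  shows "iw_char w L \<gamma> (g \<circ> h) = iw_char w L \<gamma> g * iw_char w L \<gamma> h"
proof (rule fps_ext, rule separated_eq)
  fix n j
  obtain k where k: "\<And>g l i. g \<in> G \<Longrightarrow> l \<le> n \<Longrightarrow> agree (L k) g (\<gamma> ^^ i) \<Longrightarrow>
     w ^ j dvd fps_nth (iw_char w L \<gamma> g) l - of_nat (i choose l)" using iw_char_bounded by meson
  obtain a b where a: "agree (L k) g (\<gamma> ^^ a)" and b: "agree (L k) h (\<gamma> ^^ b)" using ex_power g h by meson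
  have ab: "agree (L k) (g \<circ> h) (\<gamma> ^^ (a + b))"
    unfolding funpow_add by (intro agree_comp a b g h gal_power gamma)
  let ?u = "\<lambda>g. fps_nth (iw_char w L \<gamma> g)"
  have "w ^ j dvd ?u g l * ?u h (n - l) - of_nat (a choose l) * of_nat (b choose (n - l))" if "l \<le> n" for l
  proof -
    have "?u g l * ?u h (n - l) - of_nat (a choose l) * of_nat (b choose (n - l)) =
       (?u g l - of_nat (a choose l)) * ?u h (n - l) + of_nat (a choose l) * (?u h (n - l) - of_nat (b choose (n - l)))"
      by (simp add: algebra_simps)
    with k[OF g that a] k[OF h _ b, of "n - l"] show ?thesis by simp
  qed
  then have "w ^ j dvd (\<Sum>l\<le>n. ?u g l * ?u h (n - l) - of_nat (a choose l) * of_nat (b choose (n - l)))"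
    by (intro dvd_sum) simp
  moreover have "(\<Sum>l\<le>n. of_nat (a choose l) * of_nat (b choose (n - l))) = (of_nat ((a + b) choose n) :: 'o)"
    unfolding vandermonde[symmetric] by simp
  ultimately have "w ^ j dvd (\<Sum>l\<le>n. ?u g l * ?u h (n - l)) - of_nat ((a + b) choose n)"
    by (simp add: sum_subtractf)
  from dvd_diff[OF k[OF gal_comp[OF g h] order_refl ab] this]
  show "w ^ j dvd ?u (g \<circ> h) n - fps_nth (iw_char w L \<gamma> g * iw_char w L \<gamma> h) n"
    by (simp add: fps_mult_nth atLeast0AtMost)
qed

text \<open>Agreement on a finite set decides agreement on a layer, and the layer determines the
  first coefficients modulo \<open>w ^ j\<close>. The inverses are there because the group acts on
  \<Lambda> through inversion.\<close>

lemma iw_char_continuous: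
  "\<exists>F. finite F \<and> (\<forall>g\<in>G. \<forall>h\<in>G. \<forall>l\<le>n. agree F h g \<longrightarrow>
     w ^ j dvd fps_nth (iw_char w L \<gamma> (ginv h)) l - fps_nth (iw_char w L \<gamma> (ginv g)) l)"
proof -
  obtain k where k: "\<And>g l i. g \<in> G \<Longrightarrow> l \<le> n \<Longrightarrow> agree (L k) g (\<gamma> ^^ i) \<Longrightarrow>
     w ^ j dvd fps_nth (iw_char w L \<gamma> g) l - of_nat (i choose l)" using iw_char_bounded by meson
  obtain F where F: "finite F" "\<And>g h. g \<in> G \<Longrightarrow> h \<in> G \<Longrightarrow> agree F g h \<Longrightarrow> agree (L k) g h"
    using agree_finite by meson
  have "w ^ j dvd fps_nth (iw_char w L \<gamma> (ginv h)) l - fps_nth (iw_char w L \<gamma> (ginv g)) l"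
    if "g \<in> G" "h \<in> G" "l \<le> n" "agree F h g" for g h l
  proof -
    obtain i where i: "agree (L k) (ginv g) (\<gamma> ^^ i)" using ex_power[OF gal_ginv[OF \<open>g \<in> G\<close>]] by blast
    have "agree (L k) (ginv h) (\<gamma> ^^ i)"
      using agree_trans[OF agree_ginv i] F(2) that by blast
    from dvd_diff[OF k[OF gal_ginv that(3) this] k[OF gal_ginv that(3) i]] that show ?thesis by simp
  qed
  with F(1) show ?thesis by blast
qed

text \<open>If g^-1 acts on the tower as \<gamma>^s, its series is (1+X)^s, with value
  \<alpha>(\<gamma>^-1)^s = \<alpha>(g) at X = \<alpha>(\<gamma>^-1) - 1. As s is p-adic, the
  computation is made with an integer i close to s, modulo \<open>w ^ j\<close> for each j.\<close>

lemma evo_iw_char: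
  assumes \<alpha>1: "\<And>g h. g \<in> G \<Longrightarrow> h \<in> G \<Longrightarrow> \<alpha> (g \<circ> h) = \<alpha> g * \<alpha> h"
    and \<alpha>2: "\<And>j. \<exists>k. \<forall>g\<in>G. agree (L k) g id \<longrightarrow> w ^ j dvd \<alpha> g - 1"
    and \<alpha>3: "\<alpha> id = 1"
    and b: "b = \<alpha> (ginv \<gamma>) - 1" "w dvd b" and g: "g \<in> G"
  shows "evo b (fps_nth (iw_char w L \<gamma> (ginv g))) = \<alpha> g"
proof (rule evo_unique)
  fix j
  let ?u = "fps_nth (iw_char w L \<gamma> (ginv g))"
  obtain k where k: "\<And>g l i. g \<in> G \<Longrightarrow> l \<le> j \<Longrightarrow> agree (L k) g (\<gamma> ^^ i) \<Longrightarrow>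
     w ^ j dvd fps_nth (iw_char w L \<gamma> g) l - of_nat (i choose l)" using iw_char_bounded by meson
  obtain k' where k': "\<And>g. g \<in> G \<Longrightarrow> agree (L k') g id \<Longrightarrow> w ^ j dvd \<alpha> g - 1" using \<alpha>2 by blast
  \<comment> \<open>One exponent for two purposes: layer \<open>k\<close> controls the coefficients
    of the series, layer \<open>k'\<close> the character.\<close>
  obtain i where i: "agree (L (max k k')) (ginv g) (\<gamma> ^^ i)" using ex_power gal_ginv[OF g] by blast
  have i1: "agree (L k) (ginv g) (\<gamma> ^^ i)" and i2: "agree (L k') (ginv g) (\<gamma> ^^ i)"
    by (rule agree_mono[OF i L_mono], simp)+
  have "agree (L k') (g \<circ> \<gamma> ^^ i) (g \<circ> ginv g)"
    using i2 by (intro agree_comp g gal_power gamma gal_ginv) (auto simp: agree_def)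
  moreover have "g \<circ> ginv g = id" using gal_ginv_apply(2)[OF g] by auto
  ultimately have "w ^ j dvd \<alpha> (g \<circ> \<gamma> ^^ i) - 1" using g by (intro k') (auto intro: gal_comp gal_power gamma)
  then have 1: "w ^ j dvd \<alpha> g * \<alpha> (\<gamma> ^^ i) - 1" using g by (simp add: \<alpha>1 gal_power gamma)
  \<comment> \<open>1 + b is the value of \<alpha> at the inverse of \<gamma>, so its powers invert
    the values of \<alpha> at powers of \<gamma>.\<close>
  have "\<alpha> (\<gamma> ^^ i) * (1 + b) ^ i = 1"
  proof (induction i)
    case 0
    then show ?case using \<alpha>3 by (simp add: id_def)
  next
    case (Suc i)
    have "\<gamma> \<circ> ginv \<gamma> = id" using gal_ginv_apply(2)[OF gamma] by auto
    then have "\<alpha> \<gamma> * (1 + b) = 1"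
      unfolding b(1) using \<alpha>1[OF gamma gal_ginv[OF gamma]] \<alpha>3 by simp
    have step: "\<alpha> (\<gamma> ^^ Suc i) = \<alpha> \<gamma> * \<alpha> (\<gamma> ^^ i)"
      using \<alpha>1[OF gamma gal_power[OF gamma]] by simp
    have "\<alpha> (\<gamma> ^^ Suc i) * (1 + b) ^ Suc i = (\<alpha> \<gamma> * (1 + b)) * (\<alpha> (\<gamma> ^^ i) * (1 + b) ^ i)"
      unfolding step power_Suc by (simp only: mult_ac)
    then show ?case by (simp only: Suc \<open>\<alpha> \<gamma> * (1 + b) = 1\<close> mult_1)
  qed
  then have "\<alpha> g - (1 + b) ^ i = (\<alpha> g * \<alpha> (\<gamma> ^^ i) - 1) * (1 + b) ^ i"
    by (simp add: algebra_simps)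
  with 1 have 2: "w ^ j dvd \<alpha> g - (1 + b) ^ i" by simp
  \<comment> \<open>The range is extended to i + j, where the extra binomials vanish, so that it
    contains the first j terms even when i < j.\<close>
  have bin: "(1 + b) ^ i = (\<Sum>l\<le>i + j. of_nat (i choose l) * b ^ l)"
  proof -
    have "(1 + b) ^ i = (\<Sum>l\<le>i. of_nat (i choose l) * b ^ l)"
      using binomial_ring[of b 1 i] by (simp add: add.commute)
    also have "\<dots> = (\<Sum>l\<le>i + j. of_nat (i choose l) * b ^ l)"
      by (rule sum.mono_neutral_left) (auto simp: binomial_eq_0)
    finally show ?thesis .
  qed
  also have "\<dots> = (\<Sum>l<j. of_nat (i choose l) * b ^ l) + (\<Sum>l\<in>{j..i + j}. of_nat (i choose l) * b ^ l)"
    by (subst sum.union_disjoint[symmetric]) (auto intro!: sum.cong)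
  finally have "(1 + b) ^ i - (\<Sum>l<j. of_nat (i choose l) * b ^ l) = (\<Sum>l\<in>{j..i + j}. of_nat (i choose l) * b ^ l)"
    by simp
  moreover have "w ^ j dvd (\<Sum>l\<in>{j..i + j}. of_nat (i choose l) * b ^ l)"
  proof (intro dvd_sum dvd_mult)
    fix l assume "l \<in> {j..i + j}"
    then show "w ^ j dvd b ^ l" using b(2) by (meson atLeastAtMost_iff dvd_power_same dvd_trans le_imp_power_dvd)
  qed
  ultimately have 3: "w ^ j dvd (1 + b) ^ i - (\<Sum>l<j. of_nat (i choose l) * b ^ l)" by simp
  have 4: "w ^ j dvd (\<Sum>l<j. (of_nat (i choose l) - ?u l) * b ^ l)"
  proof (intro dvd_sum dvd_mult2)
    fix l assume "l \<in> {..<j}"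
    then have "w ^ j dvd ?u l - of_nat (i choose l)" by (intro k[OF gal_ginv[OF g] _ i1]) simp
    then show "w ^ j dvd of_nat (i choose l) - ?u l" by (metis dvd_minus_iff minus_diff_eq)
  qed
  \<comment> \<open>Three errors add up: replacing \<open>\<alpha> g\<close> by a power of 1 + b,
    truncating the binomial sum, and replacing binomials by the coefficients of the series.\<close>
  have "\<alpha> g - (\<Sum>l<j. b ^ l * ?u l) = (\<alpha> g - (1 + b) ^ i) + ((1 + b) ^ i - (\<Sum>l<j. of_nat (i choose l) * b ^ l))
      + (\<Sum>l<j. (of_nat (i choose l) - ?u l) * b ^ l)"
    by (simp add: left_diff_distrib right_diff_distrib sum_subtractf mult.commute)
  then show "w ^ j dvd \<alpha> g - (\<Sum>l<j. b ^ l * ?u l)"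
    by (simp only: dvd_add[OF dvd_add[OF 2 3] 4])
qed

end

section \<open>Specialization of Iwasawa cohomology\<close>

text \<open>A basic neighbourhood restricts finitely many coefficients, each to some depth. As the
  filtration decreases, a single j can bound both the number of coefficients and the depth.\<close>

lemma open_product_filtration:
  fixes tt :: "'v::ab_group_add \<Rightarrow> 'm"
  assumes bij: "inj tt" and open_tt: "\<And>V. openin X V \<longleftrightarrow> V \<subseteq> range tt \<and> (\<forall>v. tt v \<in> V \<longrightarrow> (\<exists>j. \<forall>u\<in>Fil j. tt (v + u) \<in> V))"
    and Fil_add: "\<And>j u v. u \<in> Fil j \<Longrightarrow> v \<in> Fil j \<Longrightarrow> u + v \<in> Fil j"
    and Fil_mono: "\<And>j k. j \<le> k \<Longrightarrow> Fil k \<subseteq> Fil j" and Fil_zero: "\<And>j. 0 \<in> Fil j"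
  shows "openin (subtopology (product_topology (\<lambda>_. X) UNIV) {x. \<forall>i. x i \<in> range tt}) V \<longleftrightarrow>
    V \<subseteq> {x. \<forall>i. x i \<in> range tt} \<and>
    (\<forall>v. (\<lambda>i. tt (v i)) \<in> V \<longrightarrow> (\<exists>j. \<forall>u\<in>{x. \<forall>i<j. x i \<in> Fil j}. (\<lambda>i::nat. tt ((v + u) i)) \<in> V))"
    (is "?L \<longleftrightarrow> ?R")
proof -
  have "openin X (range tt)" by (subst open_tt) simp
  then have ts: "topspace X = range tt"
    using open_tt openin_subset openin_topspace subset_antisym by metis
  have tp: "topspace (product_topology (\<lambda>_::nat. X) UNIV) = {x. \<forall>i. x i \<in> range tt}"
    by (auto simp: ts PiE_UNIV_domain Pi_iff)
  have "?L \<longleftrightarrow> openin (product_topology (\<lambda>_. X) UNIV) V"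
    using subtopology_topspace[of "product_topology (\<lambda>_::nat. X) UNIV"] unfolding tp by simp
  also have "\<dots> \<longleftrightarrow> ?R"
  proof
    assume L: "openin (product_topology (\<lambda>_. X) UNIV) V"
    have "\<exists>j. \<forall>u\<in>{x. \<forall>i<j. x i \<in> Fil j}. (\<lambda>i. tt ((v + u) i)) \<in> V" if v: "(\<lambda>i. tt (v i)) \<in> V" for v
    proof -
      from L v obtain U where U: "finite {i. U i \<noteq> topspace X}" "\<And>i. openin X (U i)"
        "(\<lambda>i. tt (v i)) \<in> Pi\<^sub>E UNIV U" "Pi\<^sub>E UNIV U \<subseteq> V"
        unfolding openin_product_topology_alt by (auto)
      have "\<exists>j. \<forall>u\<in>Fil j. tt (v i + u) \<in> U i" for i
      proof -
        have "tt (v i) \<in> U i" using U(3) by auto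
        then show ?thesis using U(2)[of i] unfolding open_tt by blast
      qed
      then obtain e where e: "\<And>i u. u \<in> Fil (e i) \<Longrightarrow> tt (v i + u) \<in> U i" by metis
      define S where "S = {i. U i \<noteq> topspace X}"
      \<comment> \<open>\<open>Suc i\<close> puts the index i below j, and \<open>e i\<close> gives
        the depth. If no coefficient is restricted, any value of j will do.\<close>
      define j where "j = Max ((\<lambda>i. max (Suc i) (e i)) ` S)"
      have j: "max (Suc i) (e i) \<le> j" if "i \<in> S" for i
        unfolding j_def using U(1) that by (intro Max_ge) (auto simp: S_def)
      have "(\<lambda>i. tt ((v + u) i)) \<in> V" if u: "\<forall>i<j. u i \<in> Fil j" for u
      proof -
        have "tt (v i + u i) \<in> U i" for i
        proof (cases "i \<in> S")
          case True
          with j[OF True] u have "u i \<in> Fil j" by simp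
          then show ?thesis using Fil_mono[of "e i" j] j[OF True] e by auto
        next
          case False
          then show ?thesis by (simp add: S_def ts)
        qed
        then show ?thesis using U(4) by (auto simp: PiE_UNIV_domain)
      qed
      then show ?thesis by blast
    qed
    moreover have "V \<subseteq> {x. \<forall>i. x i \<in> range tt}" using openin_subset[OF L] unfolding tp .
    ultimately show ?R by blast
  next
    assume R: ?R
    show "openin (product_topology (\<lambda>_. X) UNIV) V"
      unfolding openin_product_topology_alt
    proof (intro ballI)
      fix x assume x: "x \<in> V"
      then obtain v where v: "x = (\<lambda>i. tt (v i))" using R by (fastforce simp: image_iff choice_iff)
      then obtain j where j: "\<And>u. \<forall>i<j. u i \<in> Fil j \<Longrightarrow> (\<lambda>i. tt ((v + u) i)) \<in> V" using R x by blast
      let ?U = "\<lambda>i. if i < j then (\<lambda>u. tt (v i + u)) ` Fil j else range tt"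
      have "openin X (?U i)" for i
      proof -
        have "openin X ((\<lambda>u. tt (v i + u)) ` Fil j)"
          unfolding open_tt
        proof (intro conjI allI impI)
          fix s assume "tt s \<in> (\<lambda>u. tt (v i + u)) ` Fil j"
          then obtain u where u: "s = v i + u" "u \<in> Fil j" using bij by (auto simp: inj_eq)
          have "tt (s + r) \<in> (\<lambda>u. tt (v i + u)) ` Fil j" if "r \<in> Fil j" for r
            using Fil_add[OF u(2) that] u(1) by (auto simp: add.assoc)
          then show "\<exists>k. \<forall>r\<in>Fil k. tt (s + r) \<in> (\<lambda>u. tt (v i + u)) ` Fil j" by blast
        qed auto
        with \<open>openin X (range tt)\<close> show ?thesis by simp
      qed
      moreover have "finite {i. ?U i \<noteq> topspace X}"
        by (rule finite_subset[of _ "{..<j}"]) (auto simp: ts)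
      moreover have "x \<in> Pi\<^sub>E UNIV ?U"
        using Fil_zero[of j] by (auto simp: v PiE_UNIV_domain intro!: image_eqI[of _ _ 0])
      moreover have "Pi\<^sub>E UNIV ?U \<subseteq> V"
      proof
        fix y assume "y \<in> Pi\<^sub>E UNIV ?U"
        then have y: "y i \<in> ?U i" for i by (rule PiE_mem) simp
        have "\<exists>u. y i = tt (v i + u) \<and> (i < j \<longrightarrow> u \<in> Fil j)" for i
        proof (cases "i < j")
          case False
          then obtain s where "y i = tt s" using y[of i] by auto
          with False show ?thesis by (intro exI[of _ "s - v i"]) simp
        qed (use y[of i] in auto)
        then obtain u where u: "\<And>i. y i = tt (v i + u i)" "\<And>i. i < j \<Longrightarrow> u i \<in> Fil j" by metis
        then have "y = (\<lambda>i. tt ((v + u) i))" by auto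
        then show "y \<in> V" using j[of u] u(2) by simp
      qed
      ultimately show "\<exists>U. finite {i \<in> UNIV. U i \<noteq> topspace X} \<and> (\<forall>i\<in>UNIV. openin X (U i)) \<and>
          x \<in> Pi\<^sub>E UNIV U \<and> Pi\<^sub>E UNIV U \<subseteq> V"
        by (intro exI[of _ ?U]) auto
    qed
  qed
  finally show ?thesis .
qed

text \<open>A lattice of rank two in coordinates with a linear continuous action over the tower.
  Continuity is pointwise: the finite set may depend on the vector.\<close>

locale lattice_rep = iwasawa_tower p w k0 L \<gamma>
  for p :: nat and w :: "'o::{idom,ring_char_0}" and k0 :: "complex set"
    and L :: "nat \<Rightarrow> complex set" and \<gamma> :: gal +
  fixes T :: "('o, 'm) gmod" and tt :: "'o \<times> 'o \<Rightarrow> 'm" and act :: "gal \<Rightarrow> 'o \<times> 'o \<Rightarrow> 'o \<times> 'o"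
  assumes model: "gmod_model T tt (\<lambda>j. {v. vdvd (w ^ j) v}) act sc2 (gal k0)"
    and act_sc2: "g \<in> gal k0 \<Longrightarrow> act g (sc2 r v) = sc2 r (act g v)"
    and act_comp: "g \<in> gal k0 \<Longrightarrow> h \<in> gal k0 \<Longrightarrow> act (g \<circ> h) v = act g (act h v)"
    and act_cont: "g \<in> gal k0 \<Longrightarrow>
      \<exists>F. finite F \<and> (\<forall>h\<in>gal k0. agree F h g \<longrightarrow> vdvd (w ^ j) (act h v - act g v))"
begin

sublocale gmod_model T tt "\<lambda>j. {v. vdvd (w ^ j) v}" act sc2 "gal k0"
  by (rule model)

abbreviation (input) iw where "iw g \<equiv> fps_nth (iw_char w L \<gamma> (ginv g))"

definition act1 :: "gal \<Rightarrow> (nat \<Rightarrow> 'o \<times> 'o) \<Rightarrow> nat \<Rightarrow> 'o \<times> 'o" where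
  "act1 g x = convol (iw g) (\<lambda>i. act g (x i))"

definition tt1 :: "(nat \<Rightarrow> 'o \<times> 'o) \<Rightarrow> nat \<Rightarrow> 'm" where
  "tt1 x = (\<lambda>i. tt (x i))"

definition sc1 :: "'o \<Rightarrow> (nat \<Rightarrow> 'o \<times> 'o) \<Rightarrow> nat \<Rightarrow> 'o \<times> 'o" where
  "sc1 r x = (\<lambda>i. sc2 r (x i))"

definition Fil1 :: "nat \<Rightarrow> (nat \<Rightarrow> 'o \<times> 'o) set" where
  "Fil1 j = {x. \<forall>i<j. vdvd (w ^ j) (x i)}"

lemma ser_smul_tt: "ser_smul T u (\<lambda>i. tt (x i)) = (\<lambda>n. tt (convol (fps_nth u) x n))"
  by (rule ext) (simp add: ser_smul_def convol_def tt_sc finprod_tt)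

lemma act_vdvd: "g \<in> gal k0 \<Longrightarrow> vdvd r v \<Longrightarrow> vdvd r (act g v)"
  unfolding vdvd_iff using act_sc2 by metis

lemma iwasawa_model: "gmod_model (iwasawa w L \<gamma> T) tt1 Fil1 act1 sc1 (gal k0)"
proof -
  have top: "openin (mtop (iwasawa w L \<gamma> T)) V \<longleftrightarrow> V \<subseteq> carrier (iwasawa w L \<gamma> T) \<and>
     (\<forall>v. tt1 v \<in> V \<longrightarrow> (\<exists>j. \<forall>u\<in>Fil1 j. tt1 (v + u) \<in> V))" for V
  proof -
    have 1: "carrier (iwasawa w L \<gamma> T) = {x. \<forall>i. x i \<in> range tt}"
      "mtop (iwasawa w L \<gamma> T) = subtopology (product_topology (\<lambda>_. mtop T) UNIV) {x. \<forall>i. x i \<in> range tt}"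
      by (simp_all add: iwasawa_def Let_def carrier_tt)
    have *: "inj tt" using tt_inj by (simp add: inj_def)
    have "openin (subtopology (product_topology (\<lambda>_. mtop T) UNIV) {x. \<forall>i. x i \<in> range tt}) V \<longleftrightarrow>
      V \<subseteq> {x. \<forall>i. x i \<in> range tt} \<and>
      (\<forall>v. (\<lambda>i. tt (v i)) \<in> V \<longrightarrow> (\<exists>j. \<forall>u\<in>{x. \<forall>i<j. x i \<in> {v. vdvd (w ^ j) v}}. (\<lambda>i::nat. tt ((v + u) i)) \<in> V))"
    proof (rule open_product_filtration[OF *])
      show "openin (mtop T) V \<longleftrightarrow> V \<subseteq> range tt \<and>
        (\<forall>v. tt v \<in> V \<longrightarrow> (\<exists>j. \<forall>u\<in>{v. vdvd (w ^ j) v}. tt (v + u) \<in> V))" for V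
        using open_tt unfolding carrier_tt .
      show "{v. vdvd (w ^ k) v} \<subseteq> {v. vdvd (w ^ j) v}" if "j \<le> k" for j k
        using vdvd_trans[OF le_imp_power_dvd[OF that]] by blast
    qed (rule Fil_add Fil_zero; assumption?)+
    then show ?thesis unfolding 1 tt1_def Fil1_def by (simp only: mem_Collect_eq)
  qed
  show ?thesis
  proof (rule gmod_model.intro)
    show "bij_betw tt1 UNIV (carrier (iwasawa w L \<gamma> T))"
    proof (rule bij_betwI')
      fix x y show "tt1 x = tt1 y \<longleftrightarrow> x = y" by (auto simp: tt1_def fun_eq_iff tt_inj)
    next
      fix y assume "y \<in> carrier (iwasawa w L \<gamma> T)"
      then have "\<forall>i. \<exists>v. y i = tt v" by (auto simp: iwasawa_def Let_def carrier_tt image_iff)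
      then obtain x where "\<And>i. y i = tt (x i)" by metis
      then show "\<exists>x\<in>UNIV. y = tt1 x" by (auto simp: tt1_def)
    qed (simp add: iwasawa_def Let_def tt1_def)
    show "tt1 (u + v) = tt1 u \<otimes>\<^bsub>iwasawa w L \<gamma> T\<^esub> tt1 v" for u v
      by (simp add: iwasawa_def Let_def tt1_def tt_add)
    show "\<one>\<^bsub>iwasawa w L \<gamma> T\<^esub> = tt1 0"
      by (simp add: iwasawa_def Let_def tt1_def tt_zero)
    show "gact (iwasawa w L \<gamma> T) g (tt1 v) = tt1 (act1 g v)" if "g \<in> gal k0" for g v
      using that by (simp add: iwasawa_def Let_def tt1_def act1_def tt_act ser_smul_tt)
    show "smul (iwasawa w L \<gamma> T) r (tt1 v) = tt1 (sc1 r v)" for r v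
      by (simp add: iwasawa_def Let_def tt1_def sc1_def tt_sc)
    show "act1 g (u + v) = act1 g u + act1 g v" if "g \<in> gal k0" for g u v
      using that by (simp add: act1_def convol_def fun_eq_iff act_add sc2_simps sum.distrib)
    show "sc1 r (u + v) = sc1 r u + sc1 r v" for r u v
      by (simp add: sc1_def fun_eq_iff sc2_simps)
    show "openin (mtop (iwasawa w L \<gamma> T)) V \<longleftrightarrow> V \<subseteq> carrier (iwasawa w L \<gamma> T) \<and>
     (\<forall>v. tt1 v \<in> V \<longrightarrow> (\<exists>j. \<forall>u\<in>Fil1 j. tt1 (v + u) \<in> V))" for V by (rule top)
  qed (auto simp: Fil1_def intro: vdvd_add)
qed

lemma ser_eval_tt:
  assumes "w dvd b" shows "ser_eval T b (tt1 x) = tt (ev b x)"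
  unfolding ser_eval_def
proof (rule the_equality)
  have *: "(\<exists>r\<in>carrier T. tt s = finprod T (\<lambda>i. smul T (b ^ i) (tt1 x i)) {..<n} \<otimes>\<^bsub>T\<^esub> smul T (b ^ n) r)
      \<longleftrightarrow> vdvd (b ^ n) (s - (\<Sum>i<n. sc2 (b ^ i) (x i)))" for s n
    by (simp add: tt1_def tt_sc finprod_tt carrier_tt tt_inj vdvd_iff algebra_simps flip: tt_add)
  then show "tt (ev b x) \<in> carrier T \<and> (\<forall>n. \<exists>r\<in>carrier T.
      tt (ev b x) = finprod T (\<lambda>i. smul T (b ^ i) (tt1 x i)) {..<n} \<otimes>\<^bsub>T\<^esub> smul T (b ^ n) r)"
    using ev_iff[OF assms, of "ev b x" x] by simp
  fix t assume t: "t \<in> carrier T \<and> (\<forall>n. \<exists>r\<in>carrier T.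
      t = finprod T (\<lambda>i. smul T (b ^ i) (tt1 x i)) {..<n} \<otimes>\<^bsub>T\<^esub> smul T (b ^ n) r)"
  then obtain s where s: "t = tt s" by (auto simp: carrier_tt)
  with t * ev_iff[OF assms, of s x] show "t = tt (ev b x)" by simp
qed

end

text \<open>\<open>b\<close> is the value of X under specialization and \<open>c\<close> generates
  the ideal, c = 0 being allowed. The locale is instantiated at the given character and at the
  trivial one, where b = 0.\<close>

locale specialization = lattice_rep p w k0 L \<gamma> T tt act
  for p :: nat and w :: "'o::{idom,ring_char_0}" and k0 :: "complex set"
    and L :: "nat \<Rightarrow> complex set" and \<gamma> :: gal
    and T :: "('o, 'm) gmod" and tt :: "'o \<times> 'o \<Rightarrow> 'm" and act :: "gal \<Rightarrow> 'o \<times> 'o \<Rightarrow> 'o \<times> 'o" +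
  fixes c :: 'o and I :: "'o set" and \<alpha> :: "gal \<Rightarrow> 'o" and b :: 'o
  assumes I: "I = {r. c dvd r}"
    and \<alpha>_mult: "g \<in> gal k0 \<Longrightarrow> h \<in> gal k0 \<Longrightarrow> \<alpha> (g \<circ> h) = \<alpha> g * \<alpha> h"
    and \<alpha>_cont: "\<exists>k. \<forall>g\<in>gal k0. agree (L k) g id \<longrightarrow> w ^ j dvd \<alpha> g - 1"
    and \<alpha>_id: "\<alpha> id = 1"
    and b: "b = \<alpha> (ginv \<gamma>) - 1" "w dvd b"
begin

abbreviation "TT \<equiv> iwasawa w L \<gamma> T"

definition act\<alpha> :: "gal \<Rightarrow> 'o \<times> 'o \<Rightarrow> 'o \<times> 'o" where
  "act\<alpha> g v = sc2 (\<alpha> g) (act g v)"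

lemma twisted_model: "gmod_model (twist T \<alpha>) tt (\<lambda>j. {v. vdvd (w ^ j) v}) act\<alpha> sc2 (gal k0)"
  by (rule twist_model) (auto simp: act\<alpha>_def)

lemma ideal_mult_twist: "ideal_mult I (twist T \<alpha>) = tt ` {v. vdvd c v}"
proof -
  interpret t: gmod_model "twist T \<alpha>" tt "\<lambda>j. {v. vdvd (w ^ j) v}" act\<alpha> sc2 "gal k0"
    by (rule twisted_model)
  show ?thesis
  proof (rule t.ideal_mult_tt)
    show "{v. vdvd c v} = {sc2 r v |r v. r \<in> I}"
    proof (intro equalityI subsetI)
      fix v assume "v \<in> {v. vdvd c v}"
      then obtain u where "v = sc2 c u" unfolding vdvd_iff by blast
      moreover have "c \<in> I" by (simp add: I)
      ultimately show "v \<in> {sc2 r v |r v. r \<in> I}" by blast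
    next
      fix v assume "v \<in> {sc2 r v |r v. r \<in> I}"
      then obtain r u where "c dvd r" "v = sc2 r u" unfolding I by blast
      then show "v \<in> {v. vdvd c v}" by (simp add: dvd_sc2)
    qed
  qed (simp_all add: vdvd_add)
qed

lemma ideal_mult_iwasawa: "ideal_mult I TT = tt1 ` {x. \<forall>i. vdvd c (x i)}"
proof -
  interpret t: gmod_model TT tt1 Fil1 act1 sc1 "gal k0"
    by (rule iwasawa_model)
  have "{x. \<forall>i. vdvd c (x i)} = {sc1 r v |r v. r \<in> I}"
  proof (intro equalityI subsetI)
    fix x :: "nat \<Rightarrow> 'o \<times> 'o" assume "x \<in> {x. \<forall>i. vdvd c (x i)}"
    then have "\<forall>i. \<exists>u. x i = sc2 c u" by (simp add: vdvd_iff)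
    then obtain y :: "nat \<Rightarrow> 'o \<times> 'o" where "\<And>i. x i = sc2 c (y i)" by metis
    then have "x = sc1 c y" by (auto simp: sc1_def)
    then show "x \<in> {sc1 r v |r v. r \<in> I}" by (auto simp: I)
  qed (auto simp: I sc1_def intro: dvd_sc2)
  then show ?thesis
    by (rule t.ideal_mult_tt) (auto intro: vdvd_add)
qed

sublocale Q: gmod_quot_model TT tt1 Fil1 act1 sc1 "gal k0" "{x. \<forall>i. vdvd c (x i)}" "ideal_mult I TT"
  by (intro gmod_quot_model.intro gmod_quot_model_axioms.intro iwasawa_model ideal_mult_iwasawa)
    (auto simp: act1_def convol_def sc1_def intro!: vdvd_add vdvd_sum vdvd_sc2 act_vdvd)

sublocale Q\<alpha>: gmod_quot_model "twist T \<alpha>" tt "\<lambda>j. {v. vdvd (w ^ j) v}" act\<alpha> sc2 "gal k0"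
    "{v. vdvd c v}" "ideal_mult I (twist T \<alpha>)"
  by (intro gmod_quot_model.intro gmod_quot_model_axioms.intro twisted_model ideal_mult_twist)
    (auto simp: act\<alpha>_def intro!: vdvd_add vdvd_sc2 act_vdvd)

text \<open>The series of the inverse of g factors out of the evaluation and takes the value
  \<open>\<alpha> g\<close>, while \<open>act g\<close>, being linear, passes through it. This turns
  the action on \<Lambda>^\<iota> into the twist by \<alpha>.\<close>

lemma ev_act1: "g \<in> gal k0 \<Longrightarrow> ev b (act1 g x) = act\<alpha> g (ev b x)"
  unfolding act1_def act\<alpha>_def
  by (simp add: ev_convol[OF b(2)] evo_iw_char[OF \<alpha>_mult \<alpha>_cont \<alpha>_id b]
      ev_linear[OF b(2), of "act g"] act_add act_sc2)

lemma ev_plus: "ev b (x + y) = ev b x + ev b y"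
  using ev_add[OF b(2), of x y] by (simp add: plus_fun_def)

lemma ev_minus: "ev b (x - y) = ev b x - ev b y"
  using ev_plus[of "x - y" y] by (simp add: algebra_simps)

definition spec where
  "spec = H1_map (gal k0) (twist_quot T I \<alpha>)
     (coset_map (twist T \<alpha>) (ideal_mult I (twist T \<alpha>)) (ser_eval T b))"

lemma spec_coh_class: "spec (Q.coh_class z) = Q\<alpha>.coh_class (\<lambda>g. ev b (z g))"
  unfolding spec_def twist_quot_def
proof (rule Q.H1_map_coh[OF Q\<alpha>.gmod_quot_model_axioms])
  show "coset_map (twist T \<alpha>) (ideal_mult I (twist T \<alpha>)) (ser_eval T b) (Q.cls v) = Q\<alpha>.cls (ev b v)" for v
    by (rule Q.coset_map_cls[OF Q\<alpha>.gmod_quot_model_axioms])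
      (simp_all add: ser_eval_tt[OF b(2)] ev_minus ev_vdvd[OF b(2)] del: minus_apply)
qed (simp_all add: ev_plus ev_add[OF b(2)] ev_act1)

lemma H1_smul_coh_class:
  "H1_smul (gal k0) (twist_quot T I \<alpha>) r (Q\<alpha>.coh_class z) = Q\<alpha>.coh_class (\<lambda>g. sc2 r (z g))"
  unfolding H1_smul_def twist_quot_def
  by (rule Q\<alpha>.H1_map_coh[OF Q\<alpha>.gmod_quot_model_axioms])
    (simp_all add: Q\<alpha>.smul_quot sc2_simps act\<alpha>_def act_sc2 mult.commute)

text \<open>The division by \<open>X\<close>: a cocycle whose constant coefficients are the coboundary of \<open>t\<close> becomes
  divisible by \<open>X\<close> after subtraction of the coboundary of the constant series \<open>t\<close>.\<close>

lemma cocycle_divided: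
  assumes z: "Q.cocycle z"
    and t: "\<And>g. g \<in> gal k0 \<Longrightarrow> vdvd c (z g 0 - (act g t - t))"
  defines "y \<equiv> \<lambda>g i. z g (Suc i) - sc2 (iw g (Suc i)) (act g t)"
  shows "Q.cocycle y"
    and "\<And>g. g \<in> gal k0 \<Longrightarrow> vdvd c (ev b (z g) - sc2 b (ev b (y g)) - (act\<alpha> g t - t))"
proof -
  have iw0: "iw g 0 = 1" if "g \<in> gal k0" for g
    by (rule iw_char_0) (rule gal_ginv[OF that])
  \<comment> \<open>Inversion reverses the two factors, and commutativity of power series restores
    their order.\<close>
  have iw_comp: "iw (g \<circ> h) n = (\<Sum>i\<le>n. iw g i * iw h (n - i))" if "g \<in> gal k0" "h \<in> gal k0" for g h n
    unfolding gal_ginv_comp[OF that] iw_char_mult[OF gal_ginv[OF that(2)] gal_ginv[OF that(1)]]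
      mult.commute[of "iw_char w L \<gamma> (ginv h)"] fps_mult_nth atLeast0AtMost ..
  show "Q.cocycle y"
    unfolding Q.cocycle_def
  proof (intro conjI ballI allI)
    fix g j assume g: "g \<in> gal k0"
    \<comment> \<open>Depth \<open>Suc j\<close> is taken because coefficient i of y comes from
      coefficient i + 1 of z.\<close>
    obtain F where F: "finite F" "\<And>h. h \<in> gal k0 \<Longrightarrow> agree F h g \<Longrightarrow> \<exists>u\<in>Fil1 (Suc j). z h - z g - u \<in> {x. \<forall>i. vdvd c (x i)}"
      using z g unfolding Q.cocycle_def by meson
    obtain F' where F': "finite F'" "\<And>h. h \<in> gal k0 \<Longrightarrow> agree F' h g \<Longrightarrow> vdvd (w ^ j) (act h t - act g t)"
      using act_cont[OF g] by meson
    obtain F'' where F'': "finite F''" "\<And>h l. h \<in> gal k0 \<Longrightarrow> l \<le> j \<Longrightarrow> agree F'' h g \<Longrightarrow> w ^ j dvd iw h l - iw g l"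
      using iw_char_continuous[of j j] g by meson
    have "\<exists>u\<in>Fil1 j. y h - y g - u \<in> {x. \<forall>i. vdvd c (x i)}" if h: "h \<in> gal k0" "agree (F \<union> F' \<union> F'') h g" for h
    proof -
      from h(2) have ag: "agree F h g" "agree F' h g" "agree F'' h g" by (auto simp: agree_def)
      obtain u where u: "\<And>i. i < Suc j \<Longrightarrow> vdvd (w ^ Suc j) (u i)" "\<And>i. vdvd c (z h i - z g i - u i)"
        using F(2)[OF h(1) ag(1)] by (auto simp: Fil1_def)
      \<comment> \<open>The small part of the variation of y: that of z, shifted, minus the
        variation of the subtracted coboundary, which is small because both the series and the
        action are continuous.\<close>
      define s where "s i = u (Suc i) - (sc2 (iw h (Suc i)) (act h t) - sc2 (iw g (Suc i)) (act g t))" for i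
      have "vdvd (w ^ j) (s i)" if i: "i < j" for i
      proof -
        have "sc2 (iw h (Suc i)) (act h t) - sc2 (iw g (Suc i)) (act g t)
          = sc2 (iw h (Suc i) - iw g (Suc i)) (act h t) + sc2 (iw g (Suc i)) (act h t - act g t)"
          by (simp add: sc2_simps)
        moreover have "vdvd (w ^ j) (u (Suc i))"
          using u(1)[of "Suc i"] i vdvd_trans[OF le_imp_power_dvd[of j "Suc j"]] by simp
        ultimately show ?thesis unfolding s_def
          using F''(2)[OF h(1) _ ag(3), of "Suc i"] F'(2)[OF h(1) ag(2)] i
          by (simp only:) (intro vdvd_diff vdvd_add dvd_sc2[OF F''(2)[OF h(1) _ ag(3)]] vdvd_sc2[OF F'(2)[OF h(1) ag(2)]]; simp)
      qed
      moreover have "y h i - y g i - s i = z h (Suc i) - z g (Suc i) - u (Suc i)" for i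
        by (simp add: y_def s_def)
      ultimately show ?thesis using u(2) by (intro bexI[of _ s]) (auto simp: Fil1_def)
    qed
    then show "\<exists>F. finite F \<and> (\<forall>h\<in>gal k0. agree F h g \<longrightarrow> (\<exists>u\<in>Fil1 j. y h - y g - u \<in> {x. \<forall>i. vdvd c (x i)}))"
      using F(1) F'(1) F''(1) by (intro exI[of _ "F \<union> F' \<union> F''"]) auto
  next
    fix g h assume g: "g \<in> gal k0" and h: "h \<in> gal k0"
    have "vdvd c (y (g \<circ> h) n - (y g n + act1 g (y h) n))" for n
    proof -
      \<comment> \<open>\<open>A i\<close> is the i-th summand in coefficient \<open>Suc n\<close>
        of g acting on \<open>z h\<close>. The last one contains the constant coefficient of
        \<open>z h\<close>, which has no counterpart in y.\<close>
      define A where "A i = sc2 (iw g i) (act g (z h (Suc n - i)))" for i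
      have zc: "vdvd c (z (g \<circ> h) (Suc n) - (z g (Suc n) + act1 g (z h) (Suc n)))"
        using z g h unfolding Q.cocycle_def by auto
      have "act1 g (z h) (Suc n) = (\<Sum>i\<le>n. A i) + A (Suc n)"
        by (simp add: act1_def convol_def A_def)
      moreover have "act1 g (y h) n = (\<Sum>i\<le>n. A i) - (\<Sum>i\<le>n. sc2 (iw g i * iw h (Suc n - i)) (act g (act h t)))"
        using g by (simp add: act1_def convol_def A_def y_def Suc_diff_le act_diff act_sc2 sc2_simps sum_subtractf)
      moreover have "sc2 (iw (g \<circ> h) (Suc n)) (act (g \<circ> h) t)
          = (\<Sum>i\<le>n. sc2 (iw g i * iw h (Suc n - i)) (act g (act h t))) + sc2 (iw g (Suc n)) (act g (act h t))"
        using g h by (simp add: iw_comp act_comp iw0 sc2_simps sc2_def fst_sum snd_sum prod_eq_iff sum_distrib_right distrib_right)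
      ultimately have "y (g \<circ> h) n - (y g n + act1 g (y h) n)
          = z (g \<circ> h) (Suc n) - (z g (Suc n) + act1 g (z h) (Suc n))
            + (A (Suc n) - sc2 (iw g (Suc n)) (act g (act h t)) + sc2 (iw g (Suc n)) (act g t))"
        by (simp add: y_def algebra_simps)
      \<comment> \<open>The leftover terms combine to a multiple of the constant coefficient of
        \<open>z h\<close> minus the coboundary of t at h, which \<open>c\<close> divides by
        hypothesis.\<close>
      moreover have "A (Suc n) - sc2 (iw g (Suc n)) (act g (act h t)) + sc2 (iw g (Suc n)) (act g t)
          = sc2 (iw g (Suc n)) (act g (z h 0 - (act h t - t)))"
        using g by (simp add: A_def act_diff sc2_simps)
      moreover have "vdvd c (sc2 (iw g (Suc n)) (act g (z h 0 - (act h t - t))))"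
        by (intro vdvd_sc2 act_vdvd g t h)
      ultimately show ?thesis using vdvd_add[OF zc] by simp
    qed
    then show "y (g \<circ> h) - (y g + act1 g (y h)) \<in> {x. \<forall>i. vdvd c (x i)}" by simp
  qed
  show "vdvd c (ev b (z g) - sc2 b (ev b (y g)) - (act\<alpha> g t - t))" if g: "g \<in> gal k0" for g
  proof -
    \<comment> \<open>These are the coefficients of g acting on the constant series t. Evaluating
      them gives the twisted action, and Horner's rule separates the constant term.\<close>
    have "ev b (\<lambda>i. sc2 (iw g i) (act g t)) = act\<alpha> g t"
      by (simp add: ev_const[OF b(2)] evo_iw_char[OF \<alpha>_mult \<alpha>_cont \<alpha>_id b g] act\<alpha>_def)
    then have 1: "act\<alpha> g t = act g t + sc2 b (ev b (\<lambda>i. sc2 (iw g (Suc i)) (act g t)))"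
      using ev_rec[OF b(2), of "\<lambda>i. sc2 (iw g i) (act g t)"] g by (simp add: iw0 sc2_simps)
    have "ev b (y g) = ev b (\<lambda>i. z g (Suc i)) - ev b (\<lambda>i. sc2 (iw g (Suc i)) (act g t))"
      using ev_minus[of "\<lambda>i. z g (Suc i)" "\<lambda>i. sc2 (iw g (Suc i)) (act g t)"]
      by (simp add: y_def fun_diff_def)
    then have 2: "sc2 b (ev b (y g)) = sc2 b (ev b (\<lambda>i. z g (Suc i))) - sc2 b (ev b (\<lambda>i. sc2 (iw g (Suc i)) (act g t)))"
      by (simp only: sc2_simps)
    have "ev b (z g) - sc2 b (ev b (y g)) - (act\<alpha> g t - t) = z g 0 - (act g t - t)"
      unfolding 1 2 ev_rec[OF b(2), of "z g"] by (simp add: algebra_simps)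
    then show ?thesis by (simp only: t[OF g])
  qed
qed

text \<open>Modulo \<open>c\<close> and the twisted coboundary of t, the evaluation of z is b times
  that of y. With b = r d, the cofactor d is put into the class, so that exactly r remains
  outside.\<close>

lemma spec_divisible:
  assumes \<kappa>: "\<kappa> = Q.coh_class z" "Q.cocycle z"
    and t: "\<And>g. g \<in> gal k0 \<Longrightarrow> vdvd c (z g 0 - (act g t - t))"
    and r: "b = r * d"
  shows "spec \<kappa> \<in> H1_smul (gal k0) (twist_quot T I \<alpha>) r ` carrier (H1 (gal k0) (twist_quot T I \<alpha>))"
proof -
  define y where "y g i = z g (Suc i) - sc2 (iw g (Suc i)) (act g t)" for g i
  have y: "Q.cocycle y" and y2: "\<And>g. g \<in> gal k0 \<Longrightarrow> vdvd c (ev b (z g) - sc2 b (ev b (y g)) - (act\<alpha> g t - t))"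
    using cocycle_divided[OF \<kappa>(2) t] unfolding y_def by blast+
  have "Q\<alpha>.cocycle (\<lambda>g. sc2 d (ev b (y g)))"
  proof (rule Q.cocycle_map[OF Q\<alpha>.gmod_quot_model_axioms, where f = "\<lambda>x. sc2 d (ev b x)" and z = y])
    show "\<exists>i. (\<lambda>x. sc2 d (ev b x)) ` Fil1 i \<subseteq> {v. vdvd (w ^ j) v}" for j
      by (rule exI[of _ j]) (auto simp: Fil1_def intro!: vdvd_sc2 ev_continuous[OF b(2)])
  qed (use y in \<open>auto simp: ev_plus sc2_simps ev_act1 act\<alpha>_def act_sc2 mult.commute intro!: vdvd_sc2 ev_vdvd[OF b(2)]\<close>)
  then have "Q\<alpha>.coh_class (\<lambda>g. sc2 d (ev b (y g))) \<in> carrier (H1 (gal k0) (twist_quot T I \<alpha>))"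
    unfolding twist_quot_def using Q\<alpha>.H1_quot gal_comp by blast
  moreover have "spec \<kappa> = H1_smul (gal k0) (twist_quot T I \<alpha>) r (Q\<alpha>.coh_class (\<lambda>g. sc2 d (ev b (y g))))"
    unfolding \<kappa>(1) spec_coh_class H1_smul_coh_class
    by (rule Q\<alpha>.coh_class_eqI[of _ _ t]) (use y2 r in \<open>simp add: sc2_simps\<close>)
  ultimately show ?thesis by blast
qed

end


section \<open>From vanishing at the trivial character to divisibility at \<alpha>\<close>

context lattice_rep
begin

text \<open>The quotient of the Iwasawa module does not depend on the character, so one lift z
  serves both interpretations: the one at the trivial character, with X = 0, produces t, and the one
  at \<alpha> consumes it.\<close>

lemma vanishing_imp_divisible:
  assumes I: "I = {r. c dvd r}"
    and \<alpha>_mult: "\<And>g h. g \<in> gal k0 \<Longrightarrow> h \<in> gal k0 \<Longrightarrow> \<alpha> (g \<circ> h) = \<alpha> g * \<alpha> h"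
    and \<alpha>_cont: "\<And>j. \<exists>k. \<forall>g\<in>gal k0. agree (L k) g id \<longrightarrow> w ^ j dvd \<alpha> g - 1"
    and \<alpha>_id: "\<alpha> id = 1"
    and b: "b = \<alpha> (ginv \<gamma>) - 1" "w dvd b" "b = r * d"
    and \<kappa>: "\<kappa> \<in> carrier (H1 (gal k0) (quot_gmod (iwasawa w L \<gamma> T) (ideal_mult I (iwasawa w L \<gamma> T))))"
    and vanishing: "H1_map (gal k0) (twist_quot T I (\<lambda>_. 1))
      (coset_map (twist T (\<lambda>_. 1)) (ideal_mult I (twist T (\<lambda>_. 1))) (ser_eval T 0)) \<kappa>
      = \<one>\<^bsub>H1 (gal k0) (twist_quot T I (\<lambda>_. 1))\<^esub>"
  shows "H1_map (gal k0) (twist_quot T I \<alpha>)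
      (coset_map (twist T \<alpha>) (ideal_mult I (twist T \<alpha>)) (ser_eval T b)) \<kappa>
    \<in> H1_smul (gal k0) (twist_quot T I \<alpha>) r ` carrier (H1 (gal k0) (twist_quot T I \<alpha>))"
proof -
  interpret S1: specialization p w k0 L \<gamma> T tt act c I "\<lambda>_. 1" 0
    by unfold_locales (simp_all add: I)
  interpret S: specialization p w k0 L \<gamma> T tt act c I \<alpha> b
    by unfold_locales (fact assms)+
  obtain z where z: "\<kappa> = S1.Q.coh_class z" "S1.Q.cocycle z"
    using \<kappa> S1.Q.H1_quot gal_comp by blast
  have "S1.Q\<alpha>.coh_class (\<lambda>g. ev 0 (z g)) = S1.Q\<alpha>.coh_class (\<lambda>_. 0)"
    using vanishing S1.Q\<alpha>.one_H1_quot S1.spec_coh_class[of z]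
    unfolding z(1) S1.spec_def twist_quot_def by simp
  then obtain t where t: "\<And>g. g \<in> gal k0 \<Longrightarrow> vdvd c (ev 0 (z g) - (S1.act\<alpha> g t - t))"
    by (rule S1.Q\<alpha>.coh_class_eq_B1D) auto
  \<comment> \<open>At b = 0 evaluation is the constant coefficient, and the twist by 1 is the
    original action.\<close>
  have "vdvd c (z g 0 - (act g t - t))" if "g \<in> gal k0" for g
    using t[OF that] ev_rec[of 0 "z g"] by (simp add: S1.act\<alpha>_def sc2_simps)
  from S.spec_divisible[OF z this b(3)] show ?thesis
    unfolding S.spec_def by simp
qed

end

section \<open>Galois action on points of projective varieties\<close>

text \<open>Multiplication by x keeps the span, so all powers of x lie in it. More powers than there
  are generators must be dependent over the rationals, and a relation is a polynomial with root
  x.\<close>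

lemma algebraic_if_finite_span:
  fixes x :: complex and B :: "complex set"
  defines "sp \<equiv> module.span (\<lambda>(q::rat) (x::complex). of_rat q * x)"
  assumes B: "finite B" and x: "\<And>v. v \<in> sp B \<Longrightarrow> x * v \<in> sp B" and one: "1 \<in> sp B"
  shows "algebraic x"
proof -
  interpret Q: vector_space "\<lambda>(q::rat) (x::complex). of_rat q * x"
    by unfold_locales (auto simp: algebra_simps of_rat_add of_rat_mult)
  have pow: "x ^ k \<in> Q.span B" for k
    by (induction k) (use x one in \<open>auto simp: sp_def\<close>)
  show ?thesis
  \<comment> \<open>Dependence is a notion for sets, so coinciding powers are handled apart: they
    give the polynomial X^i - X^j directly.\<close>
  proof (cases "inj (\<lambda>k. x ^ k)")
    case True
    let ?S = "(\<lambda>k. x ^ k) ` {..card B}"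
    have "card ?S = Suc (card B)" using True by (subst card_image) (auto simp: inj_on_def)
    then have "\<not> Q.independent ?S" using Q.independent_span_bound[OF B, of ?S] pow by auto
    then obtain u where u: "\<exists>v\<in>?S. u v \<noteq> 0" "(\<Sum>v\<in>?S. of_rat (u v) * v) = 0"
      by (subst (asm) Q.dependent_finite) auto
    define P where "P = (\<Sum>k\<le>card B. monom (of_rat (u (x ^ k)) :: complex) k)"
    have coeff: "coeff P i = (if i \<le> card B then of_rat (u (x ^ i)) else 0)" for i
      by (simp add: P_def coeff_sum if_distrib[of "\<lambda>t. t = _"] sum.delta)
    have "poly P x = (\<Sum>k\<le>card B. of_rat (u (x ^ k)) * x ^ k)"
      by (simp add: P_def poly_sum poly_monom)
    also have "\<dots> = (\<Sum>v\<in>?S. of_rat (u v) * v)"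
      by (subst sum.reindex) (use True in \<open>auto simp: inj_on_def\<close>)
    finally have "poly P x = 0" using u by simp
    moreover have "P \<noteq> 0"
    proof -
      from u(1) obtain k where "k \<le> card B" "u (x ^ k) \<noteq> 0" by auto
      then have "coeff P k \<noteq> 0" by (simp add: coeff)
      then show ?thesis by auto
    qed
    moreover have "coeff P i \<in> \<rat>" for i by (simp add: coeff)
    ultimately show ?thesis by (intro algebraicI') auto
  next
    case False
    then obtain i j where ij: "x ^ i = x ^ j" "i \<noteq> j" by (auto simp: inj_def)
    let ?P = "monom 1 i - monom 1 j :: complex poly"
    have "coeff ?P i \<noteq> 0" using ij(2) by simp
    then have "?P \<noteq> 0" by (metis coeff_0)
    moreover have "poly ?P x = 0" using ij by (simp add: poly_monom)
    ultimately show ?thesis by (intro algebraicI'[of ?P]) auto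
  qed
qed

lemma algebraic_power_eq:
  assumes "algebraic (x :: complex)"
  obtains m c where "m > 0" "x ^ m = (\<Sum>k<m. of_rat (c k) * x ^ k)"
proof -
  obtain P where P: "\<And>i. coeff P i \<in> \<rat>" "P \<noteq> 0" "poly P x = 0"
    using assms by (auto simp: algebraic_altdef)
  have "\<forall>i. \<exists>q. coeff P i = of_rat q" using P(1) by (simp add: Rats_def image_iff)
  then obtain q where q: "\<And>i. coeff P i = of_rat (q i)" by (auto dest: choice)
  let ?m = "degree P"
  have qm: "q ?m \<noteq> 0" using P(2) q[of ?m] by (metis leading_coeff_0_iff of_rat_0)
  have "?m > 0"
  proof (rule ccontr)
    assume "\<not> ?m > 0"
    then obtain a where "P = [:a:]" by (metis degree_eq_zeroE gr0I)
    with P(2,3) show False by simp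
  qed
  have "0 = (\<Sum>k<?m. of_rat (q k) * x ^ k) + of_rat (q ?m) * x ^ ?m"
    using P(3) by (simp add: poly_altdef q lessThan_Suc_atMost[symmetric])
  then have "of_rat (q ?m) * x ^ ?m = - (\<Sum>k<?m. of_rat (q k) * x ^ k)"
    by (metis add_eq_0_iff)
  moreover have "(of_rat (q ?m) :: complex) \<noteq> 0" using qm by simp
  ultimately have "x ^ ?m = - (\<Sum>k<?m. of_rat (q k) * x ^ k) / of_rat (q ?m)"
    by (metis nonzero_mult_div_cancel_left)
  also have "\<dots> = (\<Sum>k<?m. of_rat (q k) * x ^ k) * of_rat (- inverse (q ?m))"
    by (simp add: of_rat_minus of_rat_inverse divide_inverse)
  also have "\<dots> = (\<Sum>k<?m. of_rat (- q k * inverse (q ?m)) * x ^ k)"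
    by (simp add: sum_distrib_left sum_distrib_right of_rat_minus of_rat_mult mult_ac sum_negf)
  finally show ?thesis by (rule that[OF \<open>?m > 0\<close>])
qed

text \<open>The span of the monomials x^i y^j, with exponents below the degrees of the relations for
  x and y, is stable under both: an exponent that reaches the degree is rewritten by the relation.
  Closure of \<open>qbar\<close> is needed since Galois elements respect the field operations
  there.\<close>

lemma algebraic_add_mult:
  fixes x y :: complex
  assumes "algebraic x" "algebraic y"
  shows "algebraic (x + y)" "algebraic (x * y)"
proof -
  interpret Q: vector_space "\<lambda>(q::rat) (x::complex). of_rat q * x"
    by unfold_locales (auto simp: algebra_simps of_rat_add of_rat_mult)
  obtain m c where m: "m > 0" "x ^ m = (\<Sum>k<m. of_rat (c k) * x ^ k)" using assms(1) by (rule algebraic_power_eq)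
  obtain n d where n: "n > 0" "y ^ n = (\<Sum>k<n. of_rat (d k) * y ^ k)" using assms(2) by (rule algebraic_power_eq)
  define B where "B = (\<lambda>(i, j). x ^ i * y ^ j) ` ({..<m} \<times> {..<n})"
  have inB: "x ^ i * y ^ j \<in> Q.span B" if "i < m" "j < n" for i j
    by (rule Q.span_base) (use that in \<open>force simp: B_def\<close>)
  have mulx: "x * v \<in> Q.span B" if "v \<in> Q.span B" for v
    using that
  proof (induction rule: Q.span_induct_alt)
    case (step q v u)
    then obtain i j where ij: "v = x ^ i * y ^ j" "i < m" "j < n" by (auto simp: B_def)
    have "x * v \<in> Q.span B"
    proof (cases "Suc i < m")
      case False
      then have "Suc i = m" using ij by simp
      then have "x * v = x ^ m * y ^ j" using ij by auto
      also have "\<dots> = (\<Sum>k<m. of_rat (c k) * (x ^ k * y ^ j))"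
        by (simp add: m(2) sum_distrib_left sum_distrib_right mult_ac)
      finally show ?thesis using inB ij by (auto intro!: Q.span_sum Q.span_scale)
    qed (use ij inB[of "Suc i" j] in \<open>simp add: mult_ac\<close>)
    then have "of_rat q * (x * v) + x * u \<in> Q.span B" by (intro Q.span_add Q.span_scale step)
    then show ?case by (simp add: algebra_simps)
  qed (simp add: Q.span_zero)
  have muly: "y * v \<in> Q.span B" if "v \<in> Q.span B" for v
    using that
  proof (induction rule: Q.span_induct_alt)
    case (step q v u)
    then obtain i j where ij: "v = x ^ i * y ^ j" "i < m" "j < n" by (auto simp: B_def)
    have "y * v \<in> Q.span B"
    proof (cases "Suc j < n")
      case False
      then have "Suc j = n" using ij by simp
      then have "y * v = x ^ i * y ^ n" using ij by auto
      also have "\<dots> = (\<Sum>k<n. of_rat (d k) * (x ^ i * y ^ k))"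
        by (simp add: n(2) sum_distrib_left mult_ac)
      finally show ?thesis using inB ij by (auto intro!: Q.span_sum Q.span_scale)
    qed (use ij inB[of i "Suc j"] in \<open>simp add: mult_ac\<close>)
    then have "of_rat q * (y * v) + y * u \<in> Q.span B" by (intro Q.span_add Q.span_scale step)
    then show ?case by (simp add: algebra_simps)
  qed (simp add: Q.span_zero)
  have fin: "finite B" by (simp add: B_def)
  have one: "1 \<in> Q.span B" using inB[of 0 0] m n by simp
  show "algebraic (x + y)"
    by (rule algebraic_if_finite_span[OF fin _ one]) (simp add: distrib_right Q.span_add mulx muly)
  show "algebraic (x * y)"
    by (rule algebraic_if_finite_span[OF fin _ one]) (simp add: mult.assoc mulx muly)
qed

lemma qbar_add: "x \<in> qbar \<Longrightarrow> y \<in> qbar \<Longrightarrow> x + y \<in> qbar"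
  and qbar_mult: "x \<in> qbar \<Longrightarrow> y \<in> qbar \<Longrightarrow> x * y \<in> qbar"
  and qbar_inverse: "x \<in> qbar \<Longrightarrow> inverse x \<in> qbar"
  by (auto simp: qbar_def algebraic_add_mult)

lemma qbar_01: "0 \<in> qbar" "1 \<in> qbar"
  by (simp_all add: qbar_def)

lemma qbar_divide: "x \<in> qbar \<Longrightarrow> y \<in> qbar \<Longrightarrow> x / y \<in> qbar"
  by (simp add: divide_inverse qbar_mult qbar_inverse)

lemma qbar_sum: "(\<And>i. i \<in> S \<Longrightarrow> f i \<in> qbar) \<Longrightarrow> sum f S \<in> qbar"
  by (induction S rule: infinite_finite_induct) (auto simp: qbar_01 qbar_add)

lemma qbar_prod: "(\<And>i. i \<in> S \<Longrightarrow> f i \<in> qbar) \<Longrightarrow> prod f S \<in> qbar"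
  by (induction S rule: infinite_finite_induct) (auto simp: qbar_01 qbar_mult)

lemma qbar_power: "x \<in> qbar \<Longrightarrow> x ^ n \<in> qbar"
  by (induction n) (auto simp: qbar_01 qbar_mult)

section \<open>Galois equivariance of rational polynomials and morphisms\<close>

context
  fixes \<sigma> L assumes \<sigma>: "\<sigma> \<in> gal L"
begin

lemma gal_sum: "(\<And>i. i \<in> S \<Longrightarrow> f i \<in> qbar) \<Longrightarrow> \<sigma> (sum f S) = (\<Sum>i\<in>S. \<sigma> (f i))"
  by (induction S rule: infinite_finite_induct) (auto simp: gal_01[OF \<sigma>] gal_add[OF \<sigma>] qbar_sum)

lemma gal_prod: "(\<And>i. i \<in> S \<Longrightarrow> f i \<in> qbar) \<Longrightarrow> \<sigma> (prod f S) = (\<Prod>i\<in>S. \<sigma> (f i))"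
  by (induction S rule: infinite_finite_induct) (auto simp: gal_01[OF \<sigma>] gal_mult[OF \<sigma>] qbar_prod)

lemma gal_power_apply: "x \<in> qbar \<Longrightarrow> \<sigma> (x ^ n) = \<sigma> x ^ n"
  by (induction n) (auto simp: gal_01[OF \<sigma>] gal_mult[OF \<sigma>] qbar_power)

lemma gal_eq_0: "\<sigma> x = 0 \<longleftrightarrow> x = 0"
  using gal_01(1)[OF \<sigma>] gal_bij[OF \<sigma>] by (metis bij_is_inj inj_eq)

lemma gal_divide: "x \<in> qbar \<Longrightarrow> y \<in> qbar \<Longrightarrow> \<sigma> (x / y) = \<sigma> x / \<sigma> y"
proof (cases "y = 0")
  case False
  assume xy: "x \<in> qbar" "y \<in> qbar"
  have "\<sigma> (x / y * y) = \<sigma> (x / y) * \<sigma> y" by (rule gal_mult[OF \<sigma>]) (auto simp: xy qbar_divide)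
  then show ?thesis using False gal_eq_0[of y] by (simp add: field_simps)
qed (simp add: gal_01[OF \<sigma>])

lemma peval_gal:
  assumes "rational_poly P" "\<And>i. x i \<in> qbar"
  shows "peval P x \<in> qbar" "peval P (pact \<sigma> x) = \<sigma> (peval P x)"
proof -
  have c: "Poly_Mapping.lookup P m \<in> qbar" "\<sigma> (Poly_Mapping.lookup P m) = Poly_Mapping.lookup P m" for m
    using assms(1) gal_rat[OF \<sigma>] by (auto simp: rational_poly_def rat_in_qbar)
  show "peval P x \<in> qbar"
    unfolding peval_def by (intro qbar_sum qbar_mult qbar_prod qbar_power c assms)
  show "peval P (pact \<sigma> x) = \<sigma> (peval P x)"
    unfolding peval_def pact_def
    by (subst gal_sum) (auto intro!: qbar_mult qbar_prod qbar_power c assms sum.cong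
        simp: gal_mult[OF \<sigma>] c gal_prod gal_power_apply assms qbar_prod qbar_power)
qed

text \<open>A Galois element sends only 0 to 0, so the first nonzero coordinate keeps its position
  and normalization commutes with the action.\<close>

lemma pnormalize_gal:
  assumes "\<And>i. v i \<in> qbar"
  shows "pnormalize d v i \<in> qbar" "pnormalize d (\<lambda>i. \<sigma> (v i)) = pact \<sigma> (pnormalize d v)"
  by (auto simp: pnormalize_def pact_def gal_eq_0 gal_divide assms qbar_divide qbar_01 gal_01[OF \<sigma>])

lemma proj_variety_gal:
  assumes V: "proj_variety d V" and x: "x \<in> V" "\<And>i. x i \<in> qbar"
  shows "pact \<sigma> x \<in> V"
proof -
  obtain S where S: "\<forall>P\<in>S. rational_poly P \<and> (\<exists>e. homogeneous d e P)"
    "V = {x \<in> proj_space d. \<forall>P\<in>S. peval P x = 0}"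
    using V unfolding proj_variety_def by blast
  have "pact \<sigma> x \<in> proj_space d"
    using x S by (auto simp: proj_space_def pact_def gal_eq_0 gal_01[OF \<sigma>])
  moreover have "peval P (pact \<sigma> x) = 0" if "P \<in> S" for P
    using peval_gal[of P x] x S that gal_01[OF \<sigma>] by auto
  ultimately show ?thesis using S by blast
qed

text \<open>The polynomials describing f near x are rational. Not all of them vanish at x, hence not
  all vanish at its conjugate, so the same formula is valid there.\<close>

lemma proj_morphism_gal:
  assumes f: "proj_morphism d V d' f" and x: "x \<in> V" "\<And>i. x i \<in> qbar" "pact \<sigma> x \<in> V"
  shows "f x i \<in> qbar" "f (pact \<sigma> x) = pact \<sigma> (f x)"
proof -
  obtain e F where F: "\<And>i. i \<le> d' \<Longrightarrow> rational_poly (F i)" "\<exists>i\<le>d'. peval (F i) x \<noteq> 0"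
    "\<And>y. y \<in> V \<Longrightarrow> \<exists>i\<le>d'. peval (F i) y \<noteq> 0 \<Longrightarrow> f y = pnormalize d' (\<lambda>i. if i \<le> d' then peval (F i) y else 0)"
    using bspec[OF f[unfolded proj_morphism_def] x(1)] by blast
  let ?v = "\<lambda>i. if i \<le> d' then peval (F i) x else 0"
  have v: "?v i \<in> qbar" for i using peval_gal(1)[OF F(1) x(2)] by (simp add: qbar_01)
  have 1: "f x = pnormalize d' ?v" by (rule F(3)[OF x(1) F(2)])
  have 2: "f (pact \<sigma> x) = pnormalize d' (\<lambda>i. if i \<le> d' then peval (F i) (pact \<sigma> x) else 0)"
    using F(2) by (intro F(3) x(3)) (auto simp: peval_gal(2)[OF F(1) x(2)] gal_eq_0)
  have "(\<lambda>i. if i \<le> d' then peval (F i) (pact \<sigma> x) else 0) = (\<lambda>i. \<sigma> (?v i))"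
    by (auto simp: peval_gal(2)[OF F(1) x(2)] gal_01[OF \<sigma>])
  with 2 pnormalize_gal(2)[OF v] 1 show "f (pact \<sigma> x) = pact \<sigma> (f x)" by simp
  show "f x i \<in> qbar" unfolding 1 by (rule pnormalize_gal(1)[OF v])
qed

end

section \<open>The Tate module\<close>

locale tate_setting =
  fixes p d :: nat and A :: "pt monoid" and e :: "(pt \<Rightarrow> pt) \<Rightarrow> 'o::comm_ring_1" and k0 :: "complex set"
  assumes A: "abelian_variety d A" and e: "End_padic_iso p d A e"
begin

abbreviation "T \<equiv> tate p d A e"
abbreviation "Aq \<equiv> points_over A qbar"

sublocale A: comm_group A
  using A by (simp add: abelian_variety_def)

lemma Aq_carrier: "x \<in> Aq \<Longrightarrow> x \<in> carrier A"
  and Aq_qbar: "x \<in> Aq \<Longrightarrow> x i \<in> qbar"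
  by (auto simp: points_over_def)

text \<open>This makes the Galois action on a single point depend on finitely many complex numbers,
  as continuity will require.\<close>

lemma Aq_beyond: "x \<in> carrier A \<Longrightarrow> i > d \<Longrightarrow> x i = 0"
proof -
  obtain S where "carrier A = {x \<in> proj_space d. \<forall>P\<in>S. peval P x = 0}"
    using A unfolding abelian_variety_def proj_variety_def by blast
  then show "x \<in> carrier A \<Longrightarrow> i > d \<Longrightarrow> x i = 0" by (simp add: proj_space_def)
qed

lemma pact_Aq: "\<sigma> \<in> gal k0 \<Longrightarrow> x \<in> Aq \<Longrightarrow> pact \<sigma> x \<in> Aq"
  using proj_variety_gal[of \<sigma> k0 d "carrier A" x] A gal_qbar[of \<sigma> k0]
  by (auto simp: points_over_def abelian_variety_def pact_def)

lemma pact_id: "pact id x = x" and pact_comp: "pact (\<sigma> \<circ> \<tau>) x = pact \<sigma> (pact \<tau> x)"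
  by (auto simp: pact_def)

lemma segre_mult:
  obtains \<mu> where "proj_morphism (Suc d * Suc d - 1) {segre d x y | x y. x \<in> carrier A \<and> y \<in> carrier A} d \<mu>"
    "\<And>x y. x \<in> carrier A \<Longrightarrow> y \<in> carrier A \<Longrightarrow> \<mu> (segre d x y) = x \<otimes>\<^bsub>A\<^esub> y"
  using A unfolding abelian_variety_def by blast

text \<open>The group law is a rational morphism on the Segre image, and the Segre map, given by
  products of coordinates, commutes with Galois elements on algebraic points.\<close>

lemma mult_Aq:
  assumes \<sigma>: "\<sigma> \<in> gal k0" and x: "x \<in> Aq" and y: "y \<in> Aq"
  shows "x \<otimes>\<^bsub>A\<^esub> y \<in> Aq" "pact \<sigma> (x \<otimes>\<^bsub>A\<^esub> y) = pact \<sigma> x \<otimes>\<^bsub>A\<^esub> pact \<sigma> y"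
proof -
  obtain \<mu> where \<mu>: "proj_morphism (Suc d * Suc d - 1) {segre d x y | x y. x \<in> carrier A \<and> y \<in> carrier A} d \<mu>"
    "\<And>x y. x \<in> carrier A \<Longrightarrow> y \<in> carrier A \<Longrightarrow> \<mu> (segre d x y) = x \<otimes>\<^bsub>A\<^esub> y" using segre_mult by blast
  have xy: "x \<in> carrier A" "y \<in> carrier A" "pact \<sigma> x \<in> carrier A" "pact \<sigma> y \<in> carrier A"
    using x y pact_Aq[OF \<sigma>] Aq_carrier by blast+
  have s: "segre d x y i \<in> qbar" for i
    unfolding segre_def by (intro qbar_mult Aq_qbar x y)
  have s2: "pact \<sigma> (segre d x y) = segre d (pact \<sigma> x) (pact \<sigma> y)"
    unfolding segre_def pact_def by (rule ext, rule gal_mult[OF \<sigma>]) (intro Aq_qbar x y)+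
  have in1: "segre d x y \<in> {segre d x y | x y. x \<in> carrier A \<and> y \<in> carrier A}"
    and in2: "pact \<sigma> (segre d x y) \<in> {segre d x y | x y. x \<in> carrier A \<and> y \<in> carrier A}"
    unfolding s2 using xy by blast+
  note m = proj_morphism_gal[OF \<sigma> \<mu>(1) in1 s in2]
  show "x \<otimes>\<^bsub>A\<^esub> y \<in> Aq"
    using m(1) xy unfolding \<mu>(2)[OF xy(1,2)] by (simp add: points_over_def)
  show "pact \<sigma> (x \<otimes>\<^bsub>A\<^esub> y) = pact \<sigma> x \<otimes>\<^bsub>A\<^esub> pact \<sigma> y"
    using m(2) unfolding s2 \<mu>(2)[OF xy(1,2)] \<mu>(2)[OF xy(3,4)] by simp
qed

lemma mult_Aq': "x \<in> Aq \<Longrightarrow> y \<in> Aq \<Longrightarrow> x \<otimes>\<^bsub>A\<^esub> y \<in> Aq"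
  using mult_Aq(1)[OF gal_id] .

lemma one_Aq: "\<one>\<^bsub>A\<^esub> \<in> Aq" and pact_one: "\<sigma> \<in> gal k0 \<Longrightarrow> pact \<sigma> \<one>\<^bsub>A\<^esub> = \<one>\<^bsub>A\<^esub>"
proof -
  have r: "\<one>\<^bsub>A\<^esub> i \<in> \<rat>" for i using A by (simp add: abelian_variety_def)
  then show "\<one>\<^bsub>A\<^esub> \<in> Aq" by (simp add: points_over_def rat_in_qbar)
  show "\<sigma> \<in> gal k0 \<Longrightarrow> pact \<sigma> \<one>\<^bsub>A\<^esub> = \<one>\<^bsub>A\<^esub>"
    using r gal_rat[of \<sigma> k0] by (auto simp: pact_def)
qed

lemma pow_Aq: "x \<in> Aq \<Longrightarrow> x [^]\<^bsub>A\<^esub> (n::nat) \<in> Aq"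
  by (induction n) (auto simp: one_Aq mult_Aq')

lemma pact_pow: "\<sigma> \<in> gal k0 \<Longrightarrow> x \<in> Aq \<Longrightarrow> pact \<sigma> (x [^]\<^bsub>A\<^esub> (n::nat)) = pact \<sigma> x [^]\<^bsub>A\<^esub> n"
  by (induction n) (auto simp: pact_one mult_Aq pow_Aq)

abbreviation "EndA \<equiv> End_ring d A"

sublocale E: ring_hom_ring EndA type_ring e
  using e by (simp add: End_padic_iso_def)

lemma End_hom: "\<phi> \<in> carrier EndA \<Longrightarrow> \<phi> \<in> hom A A"
  by (simp add: End_ring_def)

text \<open>Elements of \<open>End_ring\<close> are given by rational polynomials, so they commute
  with the Galois action; hence that action will be linear over the coefficient ring.\<close>

lemma End_Aq: "\<phi> \<in> carrier EndA \<Longrightarrow> x \<in> Aq \<Longrightarrow> \<phi> x \<in> Aq"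
  and End_pact: "\<phi> \<in> carrier EndA \<Longrightarrow> \<sigma> \<in> gal k0 \<Longrightarrow> x \<in> Aq \<Longrightarrow> \<phi> (pact \<sigma> x) = pact \<sigma> (\<phi> x)"
proof -
  assume \<phi>: "\<phi> \<in> carrier EndA" and x: "x \<in> Aq"
  then have m: "proj_morphism d (carrier A) d \<phi>" by (simp add: End_ring_def)
  show "\<phi> x \<in> Aq"
    using proj_morphism_gal(1)[OF gal_id m Aq_carrier[OF x] Aq_qbar[OF x]] Aq_carrier[OF x]
      hom_in_carrier[OF End_hom[OF \<phi>] Aq_carrier[OF x]] by (simp add: points_over_def pact_id)
  show "\<phi> (pact \<sigma> x) = pact \<sigma> (\<phi> x)" if "\<sigma> \<in> gal k0"
    by (rule proj_morphism_gal(2)[OF that m Aq_carrier[OF x] Aq_qbar[OF x]])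
      (rule Aq_carrier[OF pact_Aq[OF that x]])
qed

lemma End_pow: "\<phi> \<in> carrier EndA \<Longrightarrow> x \<in> carrier A \<Longrightarrow> \<phi> (x [^]\<^bsub>A\<^esub> (n::nat)) = \<phi> x [^]\<^bsub>A\<^esub> n"
  using End_hom hom_nat_pow[of \<phi> A A x n] A.is_group by blast

lemma End_mult: "\<phi> \<in> carrier EndA \<Longrightarrow> x \<in> carrier A \<Longrightarrow> y \<in> carrier A \<Longrightarrow> \<phi> (x \<otimes>\<^bsub>A\<^esub> y) = \<phi> x \<otimes>\<^bsub>A\<^esub> \<phi> y"
  by (rule hom_mult[OF End_hom])

lemma End_one: "\<phi> \<in> carrier EndA \<Longrightarrow> \<phi> \<one>\<^bsub>A\<^esub> = \<one>\<^bsub>A\<^esub>"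
  using End_hom hom_one[of \<phi> A A] A.is_group by blast

lemma End_add_apply: "x \<in> carrier A \<Longrightarrow> (\<phi> \<oplus>\<^bsub>EndA\<^esub> \<psi>) x = \<phi> x \<otimes>\<^bsub>A\<^esub> \<psi> x"
  and End_mult_apply: "x \<in> carrier A \<Longrightarrow> (\<phi> \<otimes>\<^bsub>EndA\<^esub> \<psi>) x = \<phi> (\<psi> x)"
  and End_one_apply: "x \<in> carrier A \<Longrightarrow> \<one>\<^bsub>EndA\<^esub> x = x"
  by (simp_all add: End_ring_def compose_def)

lemma type_ring_simps [simp]: "x \<oplus>\<^bsub>type_ring\<^esub> y = x + y" "x \<otimes>\<^bsub>type_ring\<^esub> y = x * y" "\<one>\<^bsub>type_ring\<^esub> = 1"
  by (simp_all add: type_ring_def)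

lemma e_add: "\<phi> \<in> carrier EndA \<Longrightarrow> \<psi> \<in> carrier EndA \<Longrightarrow> e (\<phi> \<oplus>\<^bsub>EndA\<^esub> \<psi>) = e \<phi> + e \<psi>"
  and e_mult: "\<phi> \<in> carrier EndA \<Longrightarrow> \<psi> \<in> carrier EndA \<Longrightarrow> e (\<phi> \<otimes>\<^bsub>EndA\<^esub> \<psi>) = e \<phi> * e \<psi>"
  and e_one: "e \<one>\<^bsub>EndA\<^esub> = 1"
  using E.hom_add[of \<phi> \<psi>] E.hom_mult[of \<phi> \<psi>] E.hom_one by simp_all

text \<open>The difference of \<phi> and \<psi> has \<open>e\<close>-value divisible by p^j, hence
  is p^j times an endomorphism and kills p^j-torsion. So the choice made in the scalar action of
  \<open>tate\<close> is immaterial.\<close>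

lemma End_torsion_eq:
  assumes \<phi>: "\<phi> \<in> carrier EndA" and \<psi>: "\<psi> \<in> carrier EndA" and dv: "of_nat p ^ j dvd e \<phi> - e \<psi>"
    and x: "x \<in> carrier A" "x [^]\<^bsub>A\<^esub> (p ^ j) = \<one>\<^bsub>A\<^esub>"
  shows "\<phi> x = \<psi> x"
proof -
  define \<eta> where "\<eta> = \<phi> \<ominus>\<^bsub>EndA\<^esub> \<psi>"
  have \<eta>: "\<eta> \<in> carrier EndA" unfolding \<eta>_def using \<phi> \<psi> by simp
  have sum: "\<eta> \<oplus>\<^bsub>EndA\<^esub> \<psi> = \<phi>"
    unfolding \<eta>_def using \<phi> \<psi> by (simp add: a_minus_def E.R.a_assoc E.R.l_neg)
  then have "e \<phi> = e \<eta> + e \<psi>" using e_add[OF \<eta> \<psi>] by simp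
  then have "of_nat p ^ j dvd e \<eta>" using dv by simp
  then obtain \<theta> where \<theta>: "\<theta> \<in> carrier EndA" "\<And>x. x \<in> carrier A \<Longrightarrow> \<eta> x = \<theta> x [^]\<^bsub>A\<^esub> (p ^ j)"
    using e[unfolded End_padic_iso_def, THEN conjunct2, THEN conjunct2, rule_format, OF \<eta>] by metis
  have "\<eta> x = \<one>\<^bsub>A\<^esub>"
    using \<theta>(2)[OF x(1)] End_pow[OF \<theta>(1) x(1), of "p ^ j"] x(2) End_one[OF \<theta>(1)] by simp
  moreover have "\<phi> x = \<eta> x \<otimes>\<^bsub>A\<^esub> \<psi> x" using End_add_apply[OF x(1), of \<eta> \<psi>] sum by simp
  ultimately show ?thesis using hom_in_carrier[OF End_hom[OF \<psi>] x(1)] by simp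
qed

lemma carrier_T: "t \<in> carrier T \<longleftrightarrow> (\<forall>j. t j \<in> Aq \<and> t j [^]\<^bsub>A\<^esub> (p ^ j) = \<one>\<^bsub>A\<^esub> \<and> t (Suc j) [^]\<^bsub>A\<^esub> p = t j)"
  and mult_T: "s \<otimes>\<^bsub>T\<^esub> t = (\<lambda>j. s j \<otimes>\<^bsub>A\<^esub> t j)" and one_T: "\<one>\<^bsub>T\<^esub> = (\<lambda>j. \<one>\<^bsub>A\<^esub>)"
  and gact_T: "gact T \<sigma> t = (\<lambda>j. pact \<sigma> (t j))"
  and mtop_T: "mtop T = subtopology (product_topology (\<lambda>_. discrete_topology UNIV) UNIV) (carrier T)"
  by (simp_all add: tate_def Let_def)

lemma T_Aq: "t \<in> carrier T \<Longrightarrow> t j \<in> Aq" and T_tors: "t \<in> carrier T \<Longrightarrow> t j [^]\<^bsub>A\<^esub> (p ^ j) = \<one>\<^bsub>A\<^esub>"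
  and T_Suc: "t \<in> carrier T \<Longrightarrow> t (Suc j) [^]\<^bsub>A\<^esub> p = t j" and T_A: "t \<in> carrier T \<Longrightarrow> t j \<in> carrier A"
  unfolding carrier_T using Aq_carrier by blast+

lemma smul_T:
  assumes "t \<in> carrier T" "\<phi> \<in> carrier EndA" "of_nat p ^ j dvd e \<phi> - a"
  shows "smul T a t j = \<phi> (t j)"
proof -
  let ?\<psi> = "SOME \<phi>. \<phi> \<in> carrier EndA \<and> of_nat p ^ j dvd e \<phi> - a"
  have \<psi>: "?\<psi> \<in> carrier EndA \<and> of_nat p ^ j dvd e ?\<psi> - a"
    by (rule someI[of "\<lambda>\<phi>. \<phi> \<in> carrier EndA \<and> of_nat p ^ j dvd e \<phi> - a"]) (use assms in blast)
  note dvd_diff[OF conjunct2[OF \<psi>] assms(3)]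
  then have "of_nat p ^ j dvd e ?\<psi> - e \<phi>" by simp
  then have "?\<psi> (t j) = \<phi> (t j)"
    by (intro End_torsion_eq[OF conjunct1[OF \<psi>] assms(2) _ T_A[OF assms(1)] T_tors[OF assms(1)]])
  then show ?thesis by (simp add: tate_def Let_def)
qed

lemma approx: obtains \<phi> where "\<phi> \<in> carrier EndA" "of_nat p ^ j dvd e \<phi> - a"
  using e unfolding End_padic_iso_def by blast

lemma smul_closed:
  assumes t: "t \<in> carrier T" shows "smul T a t \<in> carrier T"
  unfolding carrier_T
proof (intro allI conjI)
  fix j
  \<comment> \<open>Precision \<open>Suc j\<close> lets one endomorphism represent \<open>a\<close>
    at the two levels to be compared.\<close>
  obtain \<phi> where \<phi>: "\<phi> \<in> carrier EndA" "of_nat p ^ Suc j dvd e \<phi> - a" by (rule approx)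
  then have \<phi>': "of_nat p ^ j dvd e \<phi> - a" by (auto intro: dvd_mult_right)
  note [simp] = smul_T[OF t \<phi>(1) \<phi>'] smul_T[OF t \<phi>]
  show "smul T a t j \<in> Aq" using End_Aq[OF \<phi>(1) T_Aq[OF t]] by simp
  show "smul T a t j [^]\<^bsub>A\<^esub> p ^ j = \<one>\<^bsub>A\<^esub>"
    using End_pow[OF \<phi>(1) T_A[OF t], of j "p ^ j"] T_tors[OF t] End_one[OF \<phi>(1)] by simp
  show "smul T a t (Suc j) [^]\<^bsub>A\<^esub> p = smul T a t j"
    using End_pow[OF \<phi>(1) T_A[OF t], of "Suc j" p] T_Suc[OF t] by simp
qed

lemma mult_T_closed: "s \<in> carrier T \<Longrightarrow> t \<in> carrier T \<Longrightarrow> s \<otimes>\<^bsub>T\<^esub> t \<in> carrier T"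
  unfolding mult_T by (subst carrier_T) (simp add: mult_Aq' T_Aq T_tors T_Suc T_A A.pow_mult_distrib A.m_comm)

lemma smul_mult: "s \<in> carrier T \<Longrightarrow> t \<in> carrier T \<Longrightarrow> smul T a (s \<otimes>\<^bsub>T\<^esub> t) = smul T a s \<otimes>\<^bsub>T\<^esub> smul T a t"
proof
  fix j assume st: "s \<in> carrier T" "t \<in> carrier T"
  obtain \<phi> where \<phi>: "\<phi> \<in> carrier EndA" "of_nat p ^ j dvd e \<phi> - a" by (rule approx)
  show "smul T a (s \<otimes>\<^bsub>T\<^esub> t) j = (smul T a s \<otimes>\<^bsub>T\<^esub> smul T a t) j"
    using smul_T[OF mult_T_closed[OF st] \<phi>] smul_T[OF st(1) \<phi>] smul_T[OF st(2) \<phi>]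
      End_mult[OF \<phi>(1) T_A T_A, OF st] by (simp add: mult_T)
qed

lemma smul_add: "t \<in> carrier T \<Longrightarrow> smul T (a + b) t = smul T a t \<otimes>\<^bsub>T\<^esub> smul T b t"
proof
  fix j assume t: "t \<in> carrier T"
  obtain \<phi> where \<phi>: "\<phi> \<in> carrier EndA" "of_nat p ^ j dvd e \<phi> - a" by (rule approx)
  obtain \<psi> where \<psi>: "\<psi> \<in> carrier EndA" "of_nat p ^ j dvd e \<psi> - b" by (rule approx)
  have "e (\<phi> \<oplus>\<^bsub>EndA\<^esub> \<psi>) - (a + b) = (e \<phi> - a) + (e \<psi> - b)" by (simp add: e_add \<phi> \<psi>)
  then have "of_nat p ^ j dvd e (\<phi> \<oplus>\<^bsub>EndA\<^esub> \<psi>) - (a + b)" by (simp only: dvd_add[OF \<phi>(2) \<psi>(2)])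
  from smul_T[OF t _ this] show "smul T (a + b) t j = (smul T a t \<otimes>\<^bsub>T\<^esub> smul T b t) j"
    by (simp add: \<phi> \<psi> mult_T smul_T[OF t \<phi>] smul_T[OF t \<psi>] End_add_apply T_A[OF t])
qed

lemma smul_smul: "t \<in> carrier T \<Longrightarrow> smul T (a * b) t = smul T a (smul T b t)"
proof
  fix j assume t: "t \<in> carrier T"
  obtain \<phi> where \<phi>: "\<phi> \<in> carrier EndA" "of_nat p ^ j dvd e \<phi> - a" by (rule approx)
  obtain \<psi> where \<psi>: "\<psi> \<in> carrier EndA" "of_nat p ^ j dvd e \<psi> - b" by (rule approx)
  have "e (\<phi> \<otimes>\<^bsub>EndA\<^esub> \<psi>) - a * b = (e \<phi> - a) * e \<psi> + a * (e \<psi> - b)"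
    by (simp add: e_mult \<phi> \<psi> algebra_simps)
  then have "of_nat p ^ j dvd e (\<phi> \<otimes>\<^bsub>EndA\<^esub> \<psi>) - a * b"
    by (simp only: dvd_add[OF dvd_mult2[OF \<phi>(2)] dvd_mult[OF \<psi>(2)]])
  from smul_T[OF t _ this] show "smul T (a * b) t j = smul T a (smul T b t) j"
    by (simp add: \<phi> \<psi> smul_T[OF smul_closed[OF t] \<phi>] smul_T[OF t \<psi>] End_mult_apply T_A[OF t])
qed

lemma smul_one: "t \<in> carrier T \<Longrightarrow> smul T 1 t = t"
proof
  fix j assume t: "t \<in> carrier T"
  show "smul T 1 t j = t j"
    using smul_T[OF t, of "\<one>\<^bsub>EndA\<^esub>" j 1] by (simp add: e_one End_one_apply T_A[OF t])
qed

lemma smul_zero: "t \<in> carrier T \<Longrightarrow> smul T 0 t = \<one>\<^bsub>T\<^esub>"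
proof
  fix j assume t: "t \<in> carrier T"
  have "smul T (0 + 0) t j = smul T 0 t j \<otimes>\<^bsub>A\<^esub> smul T 0 t j" unfolding smul_add[OF t] mult_T ..
  then show "smul T 0 t j = \<one>\<^bsub>T\<^esub> j" using T_A[OF smul_closed[OF t]] by (simp add: one_T A.r_cancel_one')
qed

lemma smul_of_nat: "t \<in> carrier T \<Longrightarrow> smul T (of_nat n) t j = t j [^]\<^bsub>A\<^esub> n"
proof (induction n)
  case (Suc n)
  then show ?case by (simp add: smul_add smul_one mult_T A.m_comm T_A smul_zero add.commute)
qed (simp add: smul_zero one_T)

lemma gact_closed: "\<sigma> \<in> gal k0 \<Longrightarrow> t \<in> carrier T \<Longrightarrow> gact T \<sigma> t \<in> carrier T"
  unfolding gact_T by (subst carrier_T) (simp add: pact_Aq T_Aq T_tors T_Suc pact_one flip: pact_pow)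

lemma gact_mult: "\<sigma> \<in> gal k0 \<Longrightarrow> s \<in> carrier T \<Longrightarrow> t \<in> carrier T \<Longrightarrow>
    gact T \<sigma> (s \<otimes>\<^bsub>T\<^esub> t) = gact T \<sigma> s \<otimes>\<^bsub>T\<^esub> gact T \<sigma> t"
  by (simp add: gact_T mult_T mult_Aq T_Aq)

lemma gact_smul: "\<sigma> \<in> gal k0 \<Longrightarrow> t \<in> carrier T \<Longrightarrow> gact T \<sigma> (smul T a t) = smul T a (gact T \<sigma> t)"
proof
  fix j assume t: "\<sigma> \<in> gal k0" "t \<in> carrier T"
  obtain \<phi> where \<phi>: "\<phi> \<in> carrier EndA" "of_nat p ^ j dvd e \<phi> - a" by (rule approx)
  show "gact T \<sigma> (smul T a t) j = smul T a (gact T \<sigma> t) j"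
    unfolding smul_T[OF gact_closed[OF t] \<phi>]
    by (simp add: gact_T smul_T[OF t(2) \<phi>] End_pact[OF \<phi>(1) t(1) T_Aq[OF t(2)]])
qed

text \<open>The witness is the sequence shifted by n: triviality at level n is its torsion
  condition, and the transition maps show that its p^n-th power is t.\<close>

lemma divisible_if_trivial:
  assumes t: "t \<in> carrier T" "t n = \<one>\<^bsub>A\<^esub>"
  obtains t' where "t' \<in> carrier T" "t = smul T (of_nat (p ^ n)) t'"
proof
  have low: "t (j + k) [^]\<^bsub>A\<^esub> (p ^ k) = t j" for j k
  proof (induction k)
    case (Suc k)
    have "t (j + Suc k) [^]\<^bsub>A\<^esub> (p ^ Suc k) = (t (Suc (j + k)) [^]\<^bsub>A\<^esub> p) [^]\<^bsub>A\<^esub> (p ^ k)"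
      by (simp add: A.nat_pow_pow T_A[OF t(1)])
    then show ?case using T_Suc[OF t(1)] Suc by simp
  qed (simp add: T_A[OF t(1)])
  show t': "(\<lambda>j. t (j + n)) \<in> carrier T"
    unfolding carrier_T using T_Aq[OF t(1)] T_Suc[OF t(1)] low[of n] t(2) by (simp add: add.commute)
  show "t = smul T (of_nat (p ^ n)) (\<lambda>j. t (j + n))"
    by (rule ext) (simp only: smul_of_nat[OF t'] low)
qed

end

section \<open>Coordinates on the Tate module and continuity of the Galois action\<close>

locale tate_lattice = iwasawa_tower p w k0 L \<gamma> + tate_setting p d A e k0
  for p d :: nat and w :: "'o::{idom,ring_char_0}" and k0 :: "complex set"
    and L :: "nat \<Rightarrow> complex set" and \<gamma> :: gal and A :: "pt monoid" and e :: "(pt \<Rightarrow> pt) \<Rightarrow> 'o" +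
  fixes b1 b2 :: "nat \<Rightarrow> pt"
  assumes b1: "b1 \<in> carrier (tate p d A e)" and b2: "b2 \<in> carrier (tate p d A e)"
    and basis: "t \<in> carrier (tate p d A e) \<Longrightarrow>
      \<exists>!xy. t = smul (tate p d A e) (fst xy) b1 \<otimes>\<^bsub>tate p d A e\<^esub> smul (tate p d A e) (snd xy) b2"
begin

definition tt :: "'o \<times> 'o \<Rightarrow> nat \<Rightarrow> pt" where
  "tt v = smul T (fst v) b1 \<otimes>\<^bsub>T\<^esub> smul T (snd v) b2"

definition act :: "gal \<Rightarrow> 'o \<times> 'o \<Rightarrow> 'o \<times> 'o" where
  "act g v = inv_into UNIV tt (gact T g (tt v))"

lemma tt_closed: "tt v \<in> carrier T"
  unfolding tt_def by (intro mult_T_closed smul_closed b1 b2)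

lemma tt_eq: "tt u = tt v \<longleftrightarrow> u = v"
  using basis[OF tt_closed[of v]] unfolding tt_def by metis

lemma tt_surj: "t \<in> carrier T \<Longrightarrow> \<exists>v. t = tt v"
  using basis unfolding tt_def by blast

lemma tt_plus: "tt (u + v) = tt u \<otimes>\<^bsub>T\<^esub> tt v"
  by (rule ext) (simp add: tt_def smul_add b1 b2 mult_T A.m_ac T_A smul_closed)

lemma tt_scale: "smul T r (tt v) = tt (sc2 r v)"
  by (simp add: tt_def smul_mult smul_smul smul_closed b1 b2 sc2_def)

lemma tt_0: "\<one>\<^bsub>T\<^esub> = tt 0"
  by (rule ext) (simp add: tt_def smul_zero b1 b2 mult_T one_T)

lemma tt_gact: "g \<in> gal k0 \<Longrightarrow> gact T g (tt v) = tt (act g v)"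
  using tt_surj[OF gact_closed[OF _ tt_closed]] unfolding act_def by (metis f_inv_into_f rangeI)

text \<open>By \<open>divisible_if_trivial\<close>, an element trivial at level n is a multiple of
  p^n. With \<open>eq_level_of_vdvd\<close> this compares the topology of T, defined by levels, with
  the p-adic topology of the coordinates.\<close>

lemma vdvd_of_eq_level: "tt u n = tt v n \<Longrightarrow> vdvd (of_nat (p ^ n)) (u - v)"
proof -
  assume eq: "tt u n = tt v n"
  have "tt u = tt (u - v) \<otimes>\<^bsub>T\<^esub> tt v" by (simp flip: tt_plus)
  then have "tt (u - v) n \<otimes>\<^bsub>A\<^esub> tt v n = tt v n" using eq by (metis mult_T)
  then have "tt (u - v) n = \<one>\<^bsub>A\<^esub>" using T_A[OF tt_closed] by (simp add: A.l_cancel_one)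
  then obtain t' where "t' \<in> carrier T" "tt (u - v) = smul T (of_nat (p ^ n)) t'"
    using divisible_if_trivial[OF tt_closed] by metis
  moreover then obtain s where "t' = tt s" using tt_surj by blast
  ultimately have "u - v = sc2 (of_nat (p ^ n)) s" by (simp only: tt_scale tt_eq)
  then show ?thesis by simp
qed

lemma eq_level_of_vdvd: "vdvd (of_nat (p ^ n)) u \<Longrightarrow> i \<le> n \<Longrightarrow> tt (v + u) i = tt v i"
proof -
  assume u: "vdvd (of_nat (p ^ n)) u" and i: "i \<le> n"
  then obtain s where s: "u = sc2 (of_nat (p ^ n)) s" unfolding vdvd_iff by metis
  have "tt u i = tt s i [^]\<^bsub>A\<^esub> (p ^ n)"
    unfolding s tt_scale[symmetric] by (rule smul_of_nat[OF tt_closed])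
  also have "\<dots> = (tt s i [^]\<^bsub>A\<^esub> (p ^ i)) [^]\<^bsub>A\<^esub> (p ^ (n - i))"
    using i by (simp add: A.nat_pow_pow T_A[OF tt_closed] flip: power_add)
  also have "\<dots> = \<one>\<^bsub>A\<^esub>" by (simp add: T_tors[OF tt_closed])
  finally show ?thesis by (simp add: tt_plus mult_T T_A[OF tt_closed])
qed

lemma tate_model: "gmod_model T tt (\<lambda>j. {v. vdvd (w ^ j) v}) act sc2 (gal k0)"
proof (rule gmod_model.intro)
  show "bij_betw tt UNIV (carrier T)"
    by (rule bij_betwI') (use tt_closed tt_eq tt_surj in auto)
  show "act g (u + v) = act g u + act g v" if "g \<in> gal k0" for g u v
    using tt_eq[of "act g (u + v)" "act g u + act g v"]
    by (simp add: tt_plus gact_mult that tt_closed flip: tt_gact[OF that])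
  show "openin (mtop T) V \<longleftrightarrow> V \<subseteq> carrier T \<and>
    (\<forall>v. tt v \<in> V \<longrightarrow> (\<exists>j. \<forall>u\<in>{v. vdvd (w ^ j) v}. tt (v + u) \<in> V))" (is "_ \<longleftrightarrow> ?R") for V
  proof -
    have "openin (mtop T) V \<longleftrightarrow>
      V \<subseteq> carrier T \<and> (\<forall>x\<in>V. \<exists>F. finite F \<and> (\<forall>y\<in>carrier T. (\<forall>i\<in>F. y i = x i) \<longrightarrow> y \<in> V))"
      unfolding mtop_T by (rule openin_finite_agreement)
    also have "\<dots> \<longleftrightarrow> ?R"
    proof (intro conj_cong refl iffI allI ballI impI)
      fix v assume V: "\<forall>x\<in>V. \<exists>F. finite F \<and> (\<forall>y\<in>carrier T. (\<forall>i\<in>F. y i = x i) \<longrightarrow> y \<in> V)" and v: "tt v \<in> V"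
      obtain F where F: "finite F" "\<And>y. y \<in> carrier T \<Longrightarrow> \<forall>i\<in>F. y i = tt v i \<Longrightarrow> y \<in> V"
        using bspec[OF V v] by metis
      define n where "n = Max (insert 0 F)"
      have n: "i \<le> n" if "i \<in> F" for i using F(1) that by (simp add: n_def)
      \<comment> \<open>Powers of p and of \<open>w\<close> divide powers of each other, so
        neighbourhoods given by levels translate into neighbourhoods given by
        \<open>w\<close>.\<close>
      obtain j where j: "of_nat (p ^ n) dvd w ^ j" using p_power_dvd_w_power by blast
      have "tt (v + u) \<in> V" if "vdvd (w ^ j) u" for u
        using eq_level_of_vdvd[OF vdvd_trans[OF j that] n] by (intro F(2) tt_closed) simp
      then show "\<exists>j. \<forall>u\<in>{v. vdvd (w ^ j) v}. tt (v + u) \<in> V" by blast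
    next
      fix x assume sub: "V \<subseteq> carrier T" and V: "\<forall>v. tt v \<in> V \<longrightarrow> (\<exists>j. \<forall>u\<in>{v. vdvd (w ^ j) v}. tt (v + u) \<in> V)" and x: "x \<in> V"
      obtain v where v: "x = tt v" using tt_surj sub x by blast
      obtain j where j: "\<And>u. vdvd (w ^ j) u \<Longrightarrow> tt (v + u) \<in> V"
        using V[rule_format, of v] x unfolding v by blast
      have "y \<in> V" if y: "y \<in> carrier T" "y j = x j" for y
      proof -
        obtain u where u: "y = tt u" using tt_surj y by blast
        then have "vdvd (w ^ j) (u - v)"
          using vdvd_of_eq_level[of u j v] y v vdvd_trans[OF w_power_dvd_p_power] by blast
        from j[OF this] u show ?thesis by simp
      qed
      then show "\<exists>F. finite F \<and> (\<forall>y\<in>carrier T. (\<forall>i\<in>F. y i = x i) \<longrightarrow> y \<in> V)"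
        by (intro exI[of _ "{j}"]) simp
    qed
    finally show ?thesis .
  qed
qed (simp_all add: tt_plus tt_0 tt_gact tt_scale sc2_simps vdvd_add)

lemma lattice_rep: "lattice_rep p w k0 L \<gamma> T tt act"
proof (intro lattice_rep.intro lattice_rep_axioms.intro iwasawa_tower_axioms tate_model)
  show "act g (sc2 r v) = sc2 r (act g v)" if "g \<in> gal k0" for g r v
    using tt_eq[of "act g (sc2 r v)" "sc2 r (act g v)"]
    by (simp add: gact_smul that tt_closed flip: tt_gact[OF that] tt_scale)
  show "act (g \<circ> h) v = act g (act h v)" if "g \<in> gal k0" "h \<in> gal k0" for g h v
    using tt_eq[of "act (g \<circ> h) v" "act g (act h v)"]
    by (simp add: gact_T pact_comp flip: tt_gact[OF that(1)] tt_gact[OF that(2)] tt_gact[OF gal_comp[OF that]])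
  show "\<exists>F. finite F \<and> (\<forall>h\<in>gal k0. agree F h g \<longrightarrow> vdvd (w ^ j) (act h v - act g v))" if g: "g \<in> gal k0" for g j v
  proof (intro exI conjI ballI impI)
    \<comment> \<open>Level j of the image is determined by the images of the coordinates of one
      projective point, and those beyond d vanish. Level j suffices since \<open>w ^ j\<close>
      divides p^j.\<close>
    show "finite (tt v j ` {..d})" by simp
    fix h assume h: "h \<in> gal k0" "agree (tt v j ` {..d}) h g"
    have "h (tt v j i) = g (tt v j i)" for i
    proof (cases "i \<le> d")
      case False
      then show ?thesis using Aq_beyond[OF T_A[OF tt_closed[of v], of j], of i] gal_01(1)[OF g] gal_01(1)[OF h(1)] by simp
    qed (use h(2) in \<open>simp add: agree_def\<close>)
    then have "tt (act h v) j = tt (act g v) j"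
      by (simp add: gact_T pact_def flip: tt_gact[OF g] tt_gact[OF h(1)])
    from vdvd_trans[OF w_power_dvd_p_power vdvd_of_eq_level[OF this]]
    show "vdvd (w ^ j) (act h v - act g v)" .
  qed
qed

end

text \<open>For finite depth M the generator is \<open>w ^ M\<close>. For infinite depth, as at n =
  1, the ideal consists of the elements divisible by all powers of \<open>w\<close>, so it is zero
  by separatedness.\<close>

lemma (in padic) kol_ideal_principal: "\<exists>c. kol_ideal a w emb n = {r. c dvd r}"
proof (cases "INF l\<in>prime_factors n. kol_depth a w emb l")
  case (enat M)
  have "kol_ideal a w emb n = {r. w ^ M dvd r}"
    unfolding kol_ideal_def enat using w_power_le by auto
  then show ?thesis by blast
next
  case infinity
  have "kol_ideal a w emb n = {r. 0 dvd r}"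
    unfolding kol_ideal_def infinity using separated by auto
  then show ?thesis by blast
qed

theorem lemma5p6:
  fixes D :: int and p N Np Nm n m d :: nat
    and f :: "complex \<Rightarrow> complex" and a :: "nat \<Rightarrow> complex"
    and w :: "'o::{idom,ring_char_0}" and emb :: "complex \<Rightarrow> 'o"
    and A :: "pt monoid" and e :: "(pt \<Rightarrow> pt) \<Rightarrow> 'o"
    and R :: "(real^2^2) set" and \<phi> :: "complex \<Rightarrow> pt" and \<tau> :: "nat \<Rightarrow> complex"
    and L :: "nat \<Rightarrow> complex set" and \<gamma> \<delta> :: gal
    and X :: "signed \<Rightarrow> (gal \<Rightarrow> nat \<Rightarrow> nat \<Rightarrow> pt) set"
    and rho :: "nat \<Rightarrow> gal" and S :: "gal set" and s :: signed
    and \<kappa> :: "(gal \<Rightarrow> (nat \<Rightarrow> nat \<Rightarrow> pt) set) set"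
    and \<alpha> :: "gal \<Rightarrow> 'o"
  defines "G_K \<equiv> gal (quad_field D)"
    and "T \<equiv> tate p d A e"
    and "I \<equiv> kol_ideal a w emb n"
  assumes setting: "nonordinary_heegner_setting D p N Np Nm f a w emb d A e"
    and tower: "anticyclotomic D p L \<gamma>"
    and order: "eichler_order Np Nm R"
    and parametrization: "shimura_parametrization R N d A \<phi>"
    and points: "compatible_cm_points D p N a w emb d A e R \<phi> \<tau>"
    and n: "n \<in> kol_numbers D p N a w emb"
    and kappa: "signed_kolyvagin_class D p w (emb (a p)) T (heegner_class D p d A e \<phi> \<tau>)
                  L \<gamma> n I \<delta> X rho S s \<kappa>"
    and vanishing: "specialize D \<gamma> T I (\<lambda>_. 1) \<kappa> = \<one>\<^bsub>H1 G_K (twist_quot T I (\<lambda>_. 1))\<^esub>"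
    and m: "m > 0"
    and character: "gamma_character D L w \<alpha>"
    and congruence: "\<forall>g\<in>G_K. w ^ m dvd \<alpha> g - 1"
  shows "specialize D \<gamma> T I \<alpha> \<kappa>
    \<in> H1_smul G_K (twist_quot T I \<alpha>) (w ^ m) ` carrier (H1 G_K (twist_quot T I \<alpha>))"
proof -
  have pw: "padic p w"
    using setting by (simp add: padic_def nonordinary_heegner_setting_def heegner_levels_def local_hecke_field_def)
  interpret padic p w by (rule pw)
  have tow: "iwasawa_tower p w (quad_field D) L \<gamma>"
  proof (intro iwasawa_tower.intro iwasawa_tower_axioms.intro pw)
    show "zp_tower p (gal (quad_field D)) L \<gamma>" using tower by (simp add: anticyclotomic_def)
    show "\<sigma> ` L k = L k" if "\<sigma> \<in> gal (quad_field D)" for \<sigma> k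
      using tower gal_subset_gal_Rats that unfolding anticyclotomic_def by blast
  qed
  have att: "attached_GL2_variety p N a emb d A e"
    using setting by (simp add: nonordinary_heegner_setting_def)
  have "\<exists>b1\<in>carrier T. \<exists>b2\<in>carrier T. \<forall>t\<in>carrier T.
      \<exists>!xy. t = smul T (fst xy) b1 \<otimes>\<^bsub>T\<^esub> smul T (snd xy) b2"
    using conjunct2[OF conjunct2[OF att[unfolded attached_GL2_variety_def Let_def]]] unfolding T_def
    by (elim bexE conjE) (intro bexI)
  then obtain b1 b2 where b: "b1 \<in> carrier T" "b2 \<in> carrier T"
    "\<And>t. t \<in> carrier T \<Longrightarrow> \<exists>!xy. t = smul T (fst xy) b1 \<otimes>\<^bsub>T\<^esub> smul T (snd xy) b2"
    by (elim bexE) (rule that, assumption+, erule bspec)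
  have "tate_setting p d A e"
    using att by (simp add: tate_setting_def attached_GL2_variety_def)
  then interpret tl: tate_lattice p d w "quad_field D" L \<gamma> A e b1 b2
    using b unfolding T_def by (intro tate_lattice.intro tate_lattice_axioms.intro tow)
  interpret lattice_rep p w "quad_field D" L \<gamma> T tl.tt tl.act
    unfolding T_def by (rule tl.lattice_rep)
  obtain c where c: "I = {r. c dvd r}" using kol_ideal_principal unfolding I_def by blast
  have \<gamma>: "ginv \<gamma> \<in> gal (quad_field D)" by (rule gal_ginv[OF tl.gamma])
  \<comment> \<open>The congruence is applied at the inverse of \<gamma>, whose character value is
    substituted for 1 + X; this is the factorization of b with r = \<open>w ^ m\<close>.\<close>
  then obtain t where t: "\<alpha> (ginv \<gamma>) - 1 = w ^ m * t"
    using congruence unfolding G_K_def by (auto elim: dvdE)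
  \<comment> \<open>Positivity of m makes b divisible by \<open>w\<close>, as the convergence of the
    evaluation requires.\<close>
  have wb: "w dvd \<alpha> (ginv \<gamma>) - 1" using m by (simp add: t dvd_power)
  have \<kappa>: "\<kappa> \<in> carrier (H1 (gal (quad_field D)) (quot_gmod (iwasawa w L \<gamma> T) (ideal_mult I (iwasawa w L \<gamma> T))))"
    using kappa unfolding signed_kolyvagin_class_def Let_def by blast
  have van: "H1_map (gal (quad_field D)) (twist_quot T I (\<lambda>_. 1))
      (coset_map (twist T (\<lambda>_. 1)) (ideal_mult I (twist T (\<lambda>_. 1))) (ser_eval T 0)) \<kappa>
      = \<one>\<^bsub>H1 (gal (quad_field D)) (twist_quot T I (\<lambda>_. 1))\<^esub>"
    using vanishing unfolding specialize_def G_K_def by simp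
  have \<alpha>: "\<And>g h. g \<in> gal (quad_field D) \<Longrightarrow> h \<in> gal (quad_field D) \<Longrightarrow> \<alpha> (g \<circ> h) = \<alpha> g * \<alpha> h"
    "\<And>j. \<exists>k. \<forall>g\<in>gal (quad_field D). agree (L k) g id \<longrightarrow> w ^ j dvd \<alpha> g - 1"
    using character unfolding gamma_character_def by blast+
  have \<alpha>1: "\<alpha> id = 1"
    using character gal_id unfolding gamma_character_def by (simp add: agree_def)
  show ?thesis
    unfolding specialize_def G_K_def
    by (rule vanishing_imp_divisible[OF c \<alpha> \<alpha>1 refl wb t \<kappa> van])
qed

end
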